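(* Let $\Gamma$ be a finitely generated group and let $(\rho_N)$ be a sequence of permutation representations $\rho_N:\Gamma\to S_N$ which converges in distribution toward $\lambda$. Let $p\in\mathbb C[\Gamma]$ with $p=p^*$ and let $I_0\subset\mathbb R$ be a compact interval such that condition (AC) holds for $P=\lambda(p)$ on $I_0$. Let $I$ be a closed interval (of positive length) contained in the interior of $I_0$ and, for each $N$, let $(\varphi_\alpha)_{\alpha\in[N]}$ be an orthonormal eigenbasis of $P_N=\rho_N(p)$. Then, for any finite $T\subset\Gamma$ and any asymptotically uncorrelated sequence of $T$-local matrices $K_N\in M_N(\mathbb C)$ with $\|K_N\|_{1,\infty}\le1$, quantum ergodicity (QE) and quantum mixing (QM) hold in $I$.
   Context: Algebra. $e$ is the unit of $\Gamma$; $|g|$ is the word length of $g\in\Gamma$ for a fixed finite generating set. $\mathbb C[\Gamma]$ is the group algebra of finite sums $p=\sum_g p_g g$, with $p^*=\sum_g\bar p_g g^{-1}$. $\lambda$ is the left regular representation on $\ell^2(\Gamma)$, $\lambda(g)\delta_v=\delta_{gv}$. A permutation representation is a homomorphism $\rho_N:\Gamma\to S_N$; $g.x=\rho_N(g)(x)$ for $x\in[N]=\{1,\dots,N\}$, and $\rho_N(g)$ is identified with the matrix $\rho_N(g)(x,y)=\mathbf 1(x=g.y)$. For a representation $\rho$, $\rho(p)=\sum_g p_g\rho(g)$. Sequences $(\rho_N)$ are indexed by an infinite set of integers $N\to\infty$. $(\rho_N)$ converges in distribution toward $\lambda$ if $\frac1N\mathrm{Tr}(\rho_N(g))\to0$ for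 all $g\in\Gamma\setminus\{e\}$. Scalar products are $\langle f,h\rangle=\sum_x\overline{f(x)}h(x)$. Condition (AC) on $I_0$: with $R^z=(P-z\,\mathrm{Id})^{-1}$, $\Im R^z=(R^z-(R^z)^* )/(2i)$ and $Q(g,h)=\langle\delta_g,Q\delta_h\rangle$, there is $C_0\ge1$ such that $C_0^{-1}\le(\Im R^z)(e,e)\le C_0$ for all $z=E+i\eta$ with $E\in I_0$, $0<\eta\le1$. Observables. $\|K\|_{1,\infty}=\max_{x,y}|K(x,y)|$. For finite $T\subset\Gamma$, $K_N\in M_N(\mathbb C)$ is $T$-local if $K_N(x,y)=0$ unless $x=g.y$ for some $g\in T$. Its average is $\langle K_N\rangle=\rho_N(k_N)$, $k_N=\sum_{g\in T}k_{N,g}\,g$, $k_{N,g}=\frac1N\sum_{x=1}^N K_N(g.x,x)$. A sequence $a_N\in\mathbb C^N$ is asymptotically uncorrelated if $\lim_{|g|\to\infty}\sigma(g)=0$, where $\sigma(g)=\limsup_{N\to\infty}\bigl|\frac1N\sum_{x\in[N]}\overline{(a_N(x)-\langle a_N\rangle)}(a_N(g.x)-\langle a_N\rangle)\bigr|$ and $\langle a_N\rangle=\frac1N\sum_x a_N(x)$. A sequence of $T$-local matrices $(K_N)$ is asymptotically uncorrelated if for every $t\in T$ the sequence $a_N(x)=K_N(t.x,x)$ is. Let $\lambda_\alpha$ be the eigenvalue of $\varphi_\alpha$, $\Lambda_J=\{\alpha:\lambda_\alpha\in J\}$ and $J_E^\eta=[E-\eta,E+\eta]$; averages over an empty index set are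 $0$. (QE) in $I$: $\displaystyle\lim_{N\to\infty}\frac1{|\Lambda_I|}\sum_{\alpha\in\Lambda_I}|\langle\varphi_\alpha,K_N\varphi_\alpha\rangle-\langle\varphi_\alpha,\langle K_N\rangle\varphi_\alpha\rangle|^2=0$. (QM) in $I$: $\displaystyle\lim_{\eta\to0}\limsup_{N\to\infty}\sup_{E_1,E_2}\frac1{|\Lambda_{J_{E_1}^\eta}|}\sum_{\alpha\in\Lambda_{J_{E_1}^\eta}}\sum_{\beta\in\Lambda_{J_{E_2}^\eta}}|\langle\varphi_\beta,K_N\varphi_\alpha\rangle-\langle\varphi_\beta,\langle K_N\rangle\varphi_\alpha\rangle|^2=0$, the supremum being over $E_1,E_2$ in the interior of $I$. *)

theory Defs
  imports "HOL-Analysis.Analysis" "HOL-Algebra.Sym_Groups" "HOL-Algebra.Generated_Groups"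
begin

section \<open>The group and its group algebra\<close>

definition word_length :: "('g, 'b) monoid_scheme \<Rightarrow> 'g set \<Rightarrow> 'g \<Rightarrow> nat" where
  "word_length G S g = (LEAST n. \<exists>ws. length ws = n \<and> set ws \<subseteq> S \<union> (\<lambda>s. inv\<^bsub>G\<^esub> s) ` S
     \<and> foldr (\<lambda>x y. x \<otimes>\<^bsub>G\<^esub> y) ws \<one>\<^bsub>G\<^esub> = g)"

text \<open>The filter \<open>|g| \<rightarrow> \<infinity>\<close> on the group.\<close>

definition at_group_infinity :: "('g, 'b) monoid_scheme \<Rightarrow> 'g set \<Rightarrow> 'g filter" where
  "at_group_infinity G S = inf (filtercomap (word_length G S) at_top) (principal (carrier G))"

text \<open>An element \<open>\<Sum>\<^sub>g p\<^sub>g g\<close> of the group algebra is its coefficient function, which vanishes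
  outside a finite subset of the carrier.\<close>

definition group_algebra :: "('g, 'b) monoid_scheme \<Rightarrow> ('g \<Rightarrow> complex) set" where
  "group_algebra G = {p. finite {g. p g \<noteq> 0} \<and> {g. p g \<noteq> 0} \<subseteq> carrier G}"

definition ga_star :: "('g, 'b) monoid_scheme \<Rightarrow> ('g \<Rightarrow> complex) \<Rightarrow> 'g \<Rightarrow> complex" where
  "ga_star G p = (\<lambda>g. if g \<in> carrier G then cnj (p (inv\<^bsub>G\<^esub> g)) else 0)"


section \<open>The left regular representation and the resolvent\<close>

text \<open>Elements of \<open>\<ell>\<^sup>2(G)\<close> are functions on the whole type that vanish off the carrier.\<close>

definition ell2 :: "('g, 'b) monoid_scheme \<Rightarrow> ('g \<Rightarrow> complex) set" where
  "ell2 G = {f. (\<forall>v. v \<notin> carrier G \<longrightarrow> f v = 0) \<and> (\<lambda>v. (cmod (f v))\<^sup>2) summable_on carrier G}"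

definition ell2_inner ::
  "('g, 'b) monoid_scheme \<Rightarrow> ('g \<Rightarrow> complex) \<Rightarrow> ('g \<Rightarrow> complex) \<Rightarrow> complex" where
  "ell2_inner G f h = (\<Sum>\<^sub>\<infinity>v\<in>carrier G. cnj (f v) * h v)"

definition delta :: "'g \<Rightarrow> 'g \<Rightarrow> complex" where
  "delta g = (\<lambda>v. if v = g then 1 else 0)"

definition left_regular ::
  "('g, 'b) monoid_scheme \<Rightarrow> 'g \<Rightarrow> ('g \<Rightarrow> complex) \<Rightarrow> 'g \<Rightarrow> complex" where
  "left_regular G g f = (\<lambda>v. if v \<in> carrier G then f (inv\<^bsub>G\<^esub> g \<otimes>\<^bsub>G\<^esub> v) else 0)"

lemma (in group) left_regular_delta:
  assumes "g \<in> carrier G" "v \<in> carrier G"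
  shows "left_regular G g (delta v) = delta (g \<otimes> v)"
  using assms by (auto simp: left_regular_def delta_def fun_eq_iff inv_solve_left')

definition left_regular_alg ::
  "('g, 'b) monoid_scheme \<Rightarrow> ('g \<Rightarrow> complex) \<Rightarrow> ('g \<Rightarrow> complex) \<Rightarrow> 'g \<Rightarrow> complex" where
  "left_regular_alg G p f = (\<lambda>v. \<Sum>g | p g \<noteq> 0. p g * left_regular G g f v)"

definition ell2_adjoint ::
  "('g, 'b) monoid_scheme \<Rightarrow> (('g \<Rightarrow> complex) \<Rightarrow> 'g \<Rightarrow> complex) \<Rightarrow> ('g \<Rightarrow> complex) \<Rightarrow> 'g \<Rightarrow> complex" where
  "ell2_adjoint G A f =
     (THE h. h \<in> ell2 G \<and> (\<forall>u\<in>ell2 G. ell2_inner G h u = ell2_inner G f (A u)))"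

definition ell2_entry ::
  "('g, 'b) monoid_scheme \<Rightarrow> (('g \<Rightarrow> complex) \<Rightarrow> 'g \<Rightarrow> complex) \<Rightarrow> 'g \<Rightarrow> 'g \<Rightarrow> complex" where
  "ell2_entry G Q g h = ell2_inner G (delta g) (Q (delta h))"

text \<open>The inverse of \<open>P - z\<close> is taken on \<open>\<ell>\<^sup>2(G)\<close>. It is used only for \<open>P\<close> bounded and self-adjoint
  and \<open>z\<close> not real, where \<open>P - z\<close> is a bijection of \<open>\<ell>\<^sup>2(G)\<close>.\<close>

definition resolvent ::
  "('g, 'b) monoid_scheme \<Rightarrow> (('g \<Rightarrow> complex) \<Rightarrow> 'g \<Rightarrow> complex) \<Rightarrow> complex
     \<Rightarrow> ('g \<Rightarrow> complex) \<Rightarrow> 'g \<Rightarrow> complex" where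
  "resolvent G P z = inv_into (ell2 G) (\<lambda>f v. P f v - z * f v)"

definition Im_op ::
  "('g, 'b) monoid_scheme \<Rightarrow> (('g \<Rightarrow> complex) \<Rightarrow> 'g \<Rightarrow> complex) \<Rightarrow> ('g \<Rightarrow> complex) \<Rightarrow> 'g \<Rightarrow> complex" where
  "Im_op G R = (\<lambda>f v. (R f v - ell2_adjoint G R f v) / (2 * \<i>))"

text \<open>The entry \<open>(\<Im> R\<^sup>z)(e, e)\<close> is of type \<open>complex\<close>; being the real number between the
  two bounds is expressed by membership in the image of a real interval.\<close>

definition cond_AC ::
  "('g, 'b) monoid_scheme \<Rightarrow> (('g \<Rightarrow> complex) \<Rightarrow> 'g \<Rightarrow> complex) \<Rightarrow> real set \<Rightarrow> bool" where
  "cond_AC G P I0 \<longleftrightarrow> (\<exists>C0\<ge>1. \<forall>E\<in>I0. \<forall>\<eta>. 0 < \<eta> \<and> \<eta> \<le> 1 \<longrightarrow>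
     ell2_entry G (Im_op G (resolvent G P (Complex E \<eta>))) \<one>\<^bsub>G\<^esub> \<one>\<^bsub>G\<^esub>
       \<in> complex_of_real ` {inverse C0..C0})"


section \<open>Vectors and matrices indexed by \<open>{1..N}\<close>\<close>

text \<open>Vectors in \<open>\<complex>\<^sup>N\<close> and matrices in \<open>M\<^sub>N(\<complex>)\<close> are functions of indices of type \<open>nat\<close>, of which only
  the values at indices in \<open>{1..N}\<close> (the set permuted by the library's \<open>sym_group N\<close>) are used.\<close>

type_synonym cvec = "nat \<Rightarrow> complex"
type_synonym cmatrix = "nat \<Rightarrow> nat \<Rightarrow> complex"

definition vec_inner :: "nat \<Rightarrow> cvec \<Rightarrow> cvec \<Rightarrow> complex" where
  "vec_inner N f h = (\<Sum>x\<in>{1..N}. cnj (f x) * h x)"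

definition mat_vec :: "nat \<Rightarrow> cmatrix \<Rightarrow> cvec \<Rightarrow> cvec" where
  "mat_vec N A f = (\<lambda>x. \<Sum>y\<in>{1..N}. A x y * f y)"

definition mat_trace :: "nat \<Rightarrow> cmatrix \<Rightarrow> complex" where
  "mat_trace N A = (\<Sum>x\<in>{1..N}. A x x)"

definition perm_mat :: "(nat \<Rightarrow> nat) \<Rightarrow> cmatrix" where
  "perm_mat \<pi> x y = (if x = \<pi> y then 1 else 0)"

definition rep_mat :: "('g \<Rightarrow> nat \<Rightarrow> nat) \<Rightarrow> ('g \<Rightarrow> complex) \<Rightarrow> cmatrix" where
  "rep_mat \<rho> p x y = (\<Sum>g | p g \<noteq> 0. p g * perm_mat (\<rho> g) x y)"

text \<open>An orthonormal family of \<open>N\<close> vectors in \<open>\<complex>\<^sup>N\<close> is a basis. The eigenvalues \<open>l \<alpha>\<close> are complex;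
  that they are real for a Hermitian matrix is not assumed.\<close>

definition orthonormal_eigenbasis ::
  "nat \<Rightarrow> cmatrix \<Rightarrow> (nat \<Rightarrow> cvec) \<Rightarrow> (nat \<Rightarrow> complex) \<Rightarrow> bool" where
  "orthonormal_eigenbasis N A \<phi> l \<longleftrightarrow>
     (\<forall>\<alpha>\<in>{1..N}. \<forall>\<beta>\<in>{1..N}. vec_inner N (\<phi> \<alpha>) (\<phi> \<beta>) = (if \<alpha> = \<beta> then 1 else 0)) \<and>
     (\<forall>\<alpha>\<in>{1..N}. \<forall>x\<in>{1..N}. mat_vec N A (\<phi> \<alpha>) x = l \<alpha> * \<phi> \<alpha> x)"


section \<open>Sequences of permutation representations\<close>

text \<open>Sequences are indexed by an infinite set \<open>D\<close> of positive integers; this is the filter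
  \<open>N \<rightarrow> \<infinity>\<close>, \<open>N \<in> D\<close>.\<close>

definition along :: "nat set \<Rightarrow> nat filter" where
  "along D = inf at_top (principal D)"

definition converges_to_regular ::
  "('g, 'b) monoid_scheme \<Rightarrow> nat set \<Rightarrow> (nat \<Rightarrow> 'g \<Rightarrow> nat \<Rightarrow> nat) \<Rightarrow> bool" where
  "converges_to_regular G D \<rho> \<longleftrightarrow> (\<forall>g\<in>carrier G - {\<one>\<^bsub>G\<^esub>}.
     ((\<lambda>N. mat_trace N (perm_mat (\<rho> N g)) / of_nat N) \<longlongrightarrow> 0) (along D))"


section \<open>Observables\<close>

definition norm_1_inf :: "nat \<Rightarrow> cmatrix \<Rightarrow> real" where
  "norm_1_inf N K = Max ((\<lambda>(x, y). cmod (K x y)) ` ({1..N} \<times> {1..N}))"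

definition is_local :: "nat \<Rightarrow> ('g \<Rightarrow> nat \<Rightarrow> nat) \<Rightarrow> 'g set \<Rightarrow> cmatrix \<Rightarrow> bool" where
  "is_local N \<rho> T K \<longleftrightarrow>
     (\<forall>x\<in>{1..N}. \<forall>y\<in>{1..N}. (\<nexists>g. g \<in> T \<and> x = \<rho> g y) \<longrightarrow> K x y = 0)"

definition avg_coeff :: "nat \<Rightarrow> ('g \<Rightarrow> nat \<Rightarrow> nat) \<Rightarrow> 'g set \<Rightarrow> cmatrix \<Rightarrow> 'g \<Rightarrow> complex" where
  "avg_coeff N \<rho> T K g = (if g \<in> T then (\<Sum>x\<in>{1..N}. K (\<rho> g x) x) / of_nat N else 0)"

definition avg_mat :: "nat \<Rightarrow> ('g \<Rightarrow> nat \<Rightarrow> nat) \<Rightarrow> 'g set \<Rightarrow> cmatrix \<Rightarrow> cmatrix" where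
  "avg_mat N \<rho> T K = rep_mat \<rho> (avg_coeff N \<rho> T K)"

definition vec_avg :: "nat \<Rightarrow> cvec \<Rightarrow> complex" where
  "vec_avg N a = (\<Sum>x\<in>{1..N}. a x) / of_nat N"

definition correlation ::
  "nat set \<Rightarrow> (nat \<Rightarrow> 'g \<Rightarrow> nat \<Rightarrow> nat) \<Rightarrow> (nat \<Rightarrow> cvec) \<Rightarrow> 'g \<Rightarrow> ereal" where
  "correlation D \<rho> a g = Limsup (along D) (\<lambda>N. ereal (cmod
     ((\<Sum>x\<in>{1..N}. cnj (a N x - vec_avg N (a N)) * (a N (\<rho> N g x) - vec_avg N (a N))) / of_nat N)))"

definition asymp_uncorrelated_vec ::
  "('g, 'b) monoid_scheme \<Rightarrow> 'g set \<Rightarrow> nat set \<Rightarrow> (nat \<Rightarrow> 'g \<Rightarrow> nat \<Rightarrow> nat) \<Rightarrow> (nat \<Rightarrow> cvec) \<Rightarrow> bool" where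
  "asymp_uncorrelated_vec G S D \<rho> a \<longleftrightarrow> (correlation D \<rho> a \<longlongrightarrow> 0) (at_group_infinity G S)"

definition asymp_uncorrelated ::
  "('g, 'b) monoid_scheme \<Rightarrow> 'g set \<Rightarrow> nat set \<Rightarrow> (nat \<Rightarrow> 'g \<Rightarrow> nat \<Rightarrow> nat) \<Rightarrow> 'g set
     \<Rightarrow> (nat \<Rightarrow> cmatrix) \<Rightarrow> bool" where
  "asymp_uncorrelated G S D \<rho> T K \<longleftrightarrow>
     (\<forall>t\<in>T. asymp_uncorrelated_vec G S D \<rho> (\<lambda>N x. K N (\<rho> N t x) x))"


section \<open>Quantum ergodicity and quantum mixing\<close>

definition spec_indices :: "nat \<Rightarrow> (nat \<Rightarrow> complex) \<Rightarrow> real set \<Rightarrow> nat set" where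
  "spec_indices N l J = {\<alpha>\<in>{1..N}. l \<alpha> \<in> complex_of_real ` J}"

definition fluctuation ::
  "nat \<Rightarrow> ('g \<Rightarrow> nat \<Rightarrow> nat) \<Rightarrow> 'g set \<Rightarrow> cmatrix \<Rightarrow> cvec \<Rightarrow> cvec \<Rightarrow> real" where
  "fluctuation N \<rho> T K f h =
     (cmod (vec_inner N f (mat_vec N K h) - vec_inner N f (mat_vec N (avg_mat N \<rho> T K) h)))\<^sup>2"

text \<open>Averages over an empty index set are \<open>0\<close> because \<open>x / 0 = 0\<close>.\<close>

definition quantum_ergodicity ::
  "nat set \<Rightarrow> (nat \<Rightarrow> 'g \<Rightarrow> nat \<Rightarrow> nat) \<Rightarrow> 'g set \<Rightarrow> (nat \<Rightarrow> cmatrix)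
     \<Rightarrow> (nat \<Rightarrow> nat \<Rightarrow> cvec) \<Rightarrow> (nat \<Rightarrow> nat \<Rightarrow> complex) \<Rightarrow> real set \<Rightarrow> bool" where
  "quantum_ergodicity D \<rho> T K \<phi> l I \<longleftrightarrow>
     ((\<lambda>N. (\<Sum>\<alpha>\<in>spec_indices N (l N) I. fluctuation N (\<rho> N) T (K N) (\<phi> N \<alpha>) (\<phi> N \<alpha>))
          / real (card (spec_indices N (l N) I))) \<longlongrightarrow> 0) (along D)"

definition mixing_avg ::
  "nat \<Rightarrow> ('g \<Rightarrow> nat \<Rightarrow> nat) \<Rightarrow> 'g set \<Rightarrow> cmatrix \<Rightarrow> (nat \<Rightarrow> cvec) \<Rightarrow> (nat \<Rightarrow> complex)
     \<Rightarrow> real \<Rightarrow> real \<Rightarrow> real \<Rightarrow> real" where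
  "mixing_avg N \<rho> T K \<phi> l \<eta> E1 E2 =
     (\<Sum>\<alpha>\<in>spec_indices N l {E1 - \<eta>..E1 + \<eta>}. \<Sum>\<beta>\<in>spec_indices N l {E2 - \<eta>..E2 + \<eta>}.
        fluctuation N \<rho> T K (\<phi> \<beta>) (\<phi> \<alpha>))
     / real (card (spec_indices N l {E1 - \<eta>..E1 + \<eta>}))"

definition quantum_mixing ::
  "nat set \<Rightarrow> (nat \<Rightarrow> 'g \<Rightarrow> nat \<Rightarrow> nat) \<Rightarrow> 'g set \<Rightarrow> (nat \<Rightarrow> cmatrix)
     \<Rightarrow> (nat \<Rightarrow> nat \<Rightarrow> cvec) \<Rightarrow> (nat \<Rightarrow> nat \<Rightarrow> complex) \<Rightarrow> real set \<Rightarrow> bool" where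
  "quantum_mixing D \<rho> T K \<phi> l I \<longleftrightarrow>
     ((\<lambda>\<eta>. Limsup (along D) (\<lambda>N. SUP (E1, E2)\<in>interior I \<times> interior I.
          ereal (mixing_avg N (\<rho> N) T (K N) (\<phi> N) (l N) \<eta> E1 E2))) \<longlongrightarrow> 0) (at_right 0)"

end

theory Submission
  imports Defs
begin

text \<open>
  Write \<open>M\<close> for the difference of \<open>K\<close> and its average and \<open>J\<^sub>i\<close> for the window of radius \<open>\<eta>\<close> around
  \<open>E\<^sub>i\<close>. On a window the function \<open>2 \<eta> Im (1 / (x - E - \<i> \<eta>))\<close> is at least \<open>1\<close>, so the sum of the
  squared matrix elements of \<open>M\<close> between the two windows is at most \<open>4 \<eta>\<^sup>2 Tr (F\<^sub>1 M\<^sup>* F\<^sub>2 M)\<close>, where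
  \<open>F\<^sub>i\<close> is the imaginary part of the resolvent of \<open>P\<^sub>N\<close> at \<open>E\<^sub>i + \<i> \<eta>\<close>. The number of
  eigenvalues in a window is at least of order \<open>\<eta> N\<close>. It is therefore enough to show that this trace
  is at most \<open>N (o(1) / \<eta> + O(1))\<close>, with \<open>N \<rightarrow> \<infinity>\<close> before \<open>\<eta> \<rightarrow> 0\<close>.

  For fixed \<open>\<eta>\<close> the matrix \<open>F\<^sub>i\<close> is close, in normalised Hilbert-Schmidt norm, to the image under
  \<open>\<rho>\<^sub>N\<close> of a finite truncation of the kernel \<open>k\<^sub>i(g) = (Im R)(g, e)\<close> of the group. Indeed, if \<open>h\<close> is
  the column \<open>R \<delta>\<^sub>e\<close> and \<open>h'\<close> is a truncation, then \<open>(P - z) h' - \<delta>\<^sub>e\<close> is a finitely supported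
  element of small norm. Convergence in distribution carries this norm over to \<open>\<rho>\<^sub>N\<close>, and
  inverting \<open>P\<^sub>N - z\<close> costs only a factor \<open>1 / \<eta>\<close> (\<open>local_approximation\<close>). On the group
  this rests on \<open>P - z\<close> being a bijection of \<open>\<ell>\<^sup>2\<close> (\<open>Pz_inj\<close>, \<open>Pz_surj\<close>).

  Up to overlaps of negligible size, \<open>M\<close> is a sum over \<open>t \<in> T\<close> of a multiplication by a centred
  function \<open>b\<close> followed by the permutation \<open>\<rho>\<^sub>N(t)\<close>. For each such term the trace becomes, in the
  limit, at most \<open>N\<close> times the sum over \<open>g\<close> of
  \<open>|k\<^sub>1(g)| |k\<^sub>2(t g\<^sup>-\<^sup>1 t\<^sup>-\<^sup>1)| \<sigma>(g)\<close> (\<open>twisted_form_asymptotics\<close>). Condition (AC) enters through two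
  bounds on the kernels. Since \<open>Im R = \<eta> R\<^sup>* R\<close>, every entry is bounded by \<open>C\<close>
  (\<open>Im_kernel_bounded\<close>), and the square sum is bounded by \<open>C / \<eta>\<close> (\<open>Im_kernel_sq_sum\<close>). Where
  \<open>\<sigma>\<close> is below \<open>\<delta>\<close> the square sums give at most \<open>\<delta> C / \<eta>\<close>; the remaining finitely many \<open>g\<close>
  contribute \<open>O(1)\<close> by the entrywise bound. This is the required estimate.

  The lower bound on the number of eigenvalues (\<open>density_lower_bound\<close>) follows from the two-sided
  bound in (AC) at two different heights. Finite nets of energies make both estimates uniform, and
  quantum ergodicity follows by covering the interval with windows and keeping only
  the diagonal terms of the mixing sums.
\<close>

section \<open>Square-summable functions on a group\<close>

lemma cnj_diff_over_2i: "(w - cnj w) / (2 * \<i>) = of_real (Im w)"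
  by (simp add: complex_eq_iff)

definition ell2_norm :: "('g, 'b) monoid_scheme \<Rightarrow> ('g \<Rightarrow> complex) \<Rightarrow> real" where
  "ell2_norm G f = sqrt (\<Sum>\<^sub>\<infinity>v\<in>carrier G. (cmod (f v))\<^sup>2)"

lemma ell2_norm_nonneg: "0 \<le> ell2_norm G f"
  unfolding ell2_norm_def by (intro real_sqrt_ge_zero infsum_nonneg) auto

lemma ell2_norm_sq: "(ell2_norm G f)\<^sup>2 = (\<Sum>\<^sub>\<infinity>v\<in>carrier G. (cmod (f v))\<^sup>2)"
  unfolding ell2_norm_def by (intro real_sqrt_pow2 infsum_nonneg) auto

lemma L2_set_le_ell2_norm:
  assumes "f \<in> ell2 G" "finite F" "F \<subseteq> carrier G"
  shows "L2_set (\<lambda>v. cmod (f v)) F \<le> ell2_norm G f"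
  unfolding L2_set_def ell2_norm_def
  using assms by (intro real_sqrt_le_mono finite_sum_le_infsum) (auto simp: ell2_def)

text \<open>Membership in \<open>\<ell>\<^sup>2\<close> and norm estimates are obtained together from uniform bounds on finite
  sets, which reduces the inequalities below to those for \<open>L2_set\<close>.\<close>

lemma ell2_boundedI:
  assumes "\<And>v. v \<notin> carrier G \<Longrightarrow> f v = 0"
    and "\<And>F. finite F \<Longrightarrow> F \<subseteq> carrier G \<Longrightarrow> L2_set (\<lambda>v. cmod (f v)) F \<le> B"
  shows "f \<in> ell2 G" "ell2_norm G f \<le> B"
proof -
  have B: "0 \<le> B" using assms(2)[of "{}"] by simp
  have *: "(\<Sum>v\<in>F. (cmod (f v))\<^sup>2) \<le> B\<^sup>2" if "finite F" "F \<subseteq> carrier G" for F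
  proof -
    have "(L2_set (\<lambda>v. cmod (f v)) F)\<^sup>2 \<le> B\<^sup>2"
      using assms(2)[OF that] by (intro power_mono) auto
    thus ?thesis by (simp add: L2_set_def sum_nonneg)
  qed
  have s: "(\<lambda>v. (cmod (f v))\<^sup>2) summable_on carrier G"
    by (rule nonneg_bdd_above_summable_on) (auto intro!: bdd_aboveI2 *)
  show "f \<in> ell2 G" using s assms(1) by (simp add: ell2_def)
  show "ell2_norm G f \<le> B"
    unfolding ell2_norm_def using B
    by (intro real_le_lsqrt infsum_le_finite_sums[OF s] *) auto
qed

lemma cmod_le_ell2_norm:
  assumes "f \<in> ell2 G" "v \<in> carrier G"
  shows "cmod (f v) \<le> ell2_norm G f"
  using L2_set_le_ell2_norm[of f G "{v}"] assms by simp

lemma L2_set_sum_le: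
  fixes f :: "'i \<Rightarrow> 'g \<Rightarrow> complex"
  shows "L2_set (\<lambda>v. cmod (\<Sum>i\<in>A. f i v)) F \<le> (\<Sum>i\<in>A. L2_set (\<lambda>v. cmod (f i v)) F)"
proof (induction A rule: infinite_finite_induct)
  case (insert a A)
  have "L2_set (\<lambda>v. cmod (\<Sum>i\<in>insert a A. f i v)) F
    \<le> L2_set (\<lambda>v. cmod (f a v) + cmod (\<Sum>i\<in>A. f i v)) F"
    using insert(1,2) by (intro L2_set_mono) (auto intro: norm_triangle_ineq)
  also have "\<dots> \<le> L2_set (\<lambda>v. cmod (f a v)) F + L2_set (\<lambda>v. cmod (\<Sum>i\<in>A. f i v)) F"
    by (rule L2_set_triangle_ineq)
  finally show ?case using insert by simp
qed (auto simp: L2_set_def)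

lemma ell2_add:
  assumes "f \<in> ell2 G" "h \<in> ell2 G"
  shows "(\<lambda>v. f v + h v) \<in> ell2 G" "ell2_norm G (\<lambda>v. f v + h v) \<le> ell2_norm G f + ell2_norm G h"
proof -
  have *: "L2_set (\<lambda>v. cmod (f v + h v)) F \<le> ell2_norm G f + ell2_norm G h"
    if F: "finite F" "F \<subseteq> carrier G" for F
  proof -
    have "L2_set (\<lambda>v. cmod (f v + h v)) F \<le> L2_set (\<lambda>v. cmod (f v) + cmod (h v)) F"
      by (intro L2_set_mono) (auto intro: norm_triangle_ineq)
    also have "\<dots> \<le> L2_set (\<lambda>v. cmod (f v)) F + L2_set (\<lambda>v. cmod (h v)) F"
      by (rule L2_set_triangle_ineq)
    finally show ?thesis
      using L2_set_le_ell2_norm[OF assms(1) F] L2_set_le_ell2_norm[OF assms(2) F] by linarith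
  qed
  have 0: "f v + h v = 0" if "v \<notin> carrier G" for v using assms that by (simp add: ell2_def)
  show "(\<lambda>v. f v + h v) \<in> ell2 G" "ell2_norm G (\<lambda>v. f v + h v) \<le> ell2_norm G f + ell2_norm G h"
    using ell2_boundedI[of G "\<lambda>v. f v + h v"] 0 * by blast+
qed

lemma ell2_scale:
  assumes "f \<in> ell2 G"
  shows "(\<lambda>v. c * f v) \<in> ell2 G" "ell2_norm G (\<lambda>v. c * f v) = cmod c * ell2_norm G f"
  using assms
  by (auto simp: ell2_def ell2_norm_def norm_mult power_mult_distrib infsum_cmult_right'
      real_sqrt_mult intro: summable_on_cmult_right)

lemma ell2_diff:
  assumes "f \<in> ell2 G" "h \<in> ell2 G"
  shows "(\<lambda>v. f v - h v) \<in> ell2 G"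
  using ell2_add(1)[OF assms(1) ell2_scale(1)[OF assms(2), of "-1"]] by simp

lemma ell2_finite_support:
  assumes "finite F" "F \<subseteq> carrier G" "\<And>v. v \<notin> F \<Longrightarrow> f v = 0"
  shows "f \<in> ell2 G"
proof -
  have "(\<lambda>v. (cmod (f v))\<^sup>2) summable_on carrier G \<longleftrightarrow> (\<lambda>v. (cmod (f v))\<^sup>2) summable_on F"
    using assms by (intro summable_on_cong_neutral) auto
  thus ?thesis using assms by (auto simp: ell2_def)
qed

lemma delta_in_ell2: "g \<in> carrier G \<Longrightarrow> delta g \<in> ell2 G"
  by (rule ell2_finite_support[of "{g}"]) (auto simp: delta_def)

lemma ell2_inner_abs_summable:
  assumes "f \<in> ell2 G" "h \<in> ell2 G"
  shows "(\<lambda>v. cmod (cnj (f v) * h v)) summable_on carrier G"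
proof -
  have "(\<lambda>v. (cmod (f v))\<^sup>2 + (cmod (h v))\<^sup>2) summable_on carrier G"
    using assms by (intro summable_on_add) (auto simp: ell2_def)
  thus ?thesis
  proof (rule Infinite_Sum.abs_summable_on_comparison_test')
    fix v
    have "0 \<le> (cmod (f v) - cmod (h v))\<^sup>2 + (cmod (f v))\<^sup>2 + (cmod (h v))\<^sup>2" by simp
    thus "cmod (cnj (f v) * h v) \<le> (cmod (f v))\<^sup>2 + (cmod (h v))\<^sup>2"
      by (simp add: norm_mult power2_diff)
  qed
qed

lemma ell2_inner_summable:
  assumes "f \<in> ell2 G" "h \<in> ell2 G"
  shows "(\<lambda>v. cnj (f v) * h v) summable_on carrier G"
  by (rule abs_summable_summable[OF ell2_inner_abs_summable[OF assms]])

lemma ell2_Cauchy_Schwarz: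
  assumes "f \<in> ell2 G" "h \<in> ell2 G"
  shows "cmod (ell2_inner G f h) \<le> ell2_norm G f * ell2_norm G h"
proof -
  have "cmod (ell2_inner G f h) \<le> (\<Sum>\<^sub>\<infinity>v\<in>carrier G. cmod (cnj (f v) * h v))"
    unfolding ell2_inner_def by (rule norm_infsum_bound[OF ell2_inner_abs_summable[OF assms]])
  also have "\<dots> \<le> ell2_norm G f * ell2_norm G h"
  proof (rule infsum_le_finite_sums[OF ell2_inner_abs_summable[OF assms]])
    fix F assume F: "finite F" "F \<subseteq> carrier G"
    have "(\<Sum>v\<in>F. cmod (cnj (f v) * h v)) \<le> L2_set (\<lambda>v. cmod (f v)) F * L2_set (\<lambda>v. cmod (h v)) F"
      using L2_set_mult_ineq[of "\<lambda>v. cmod (f v)" "\<lambda>v. cmod (h v)" F] by (simp add: norm_mult)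
    also have "\<dots> \<le> ell2_norm G f * ell2_norm G h"
      using L2_set_le_ell2_norm[OF _ F] assms by (intro mult_mono) (auto simp: ell2_norm_nonneg)
    finally show "(\<Sum>v\<in>F. cmod (cnj (f v) * h v)) \<le> ell2_norm G f * ell2_norm G h" .
  qed
  finally show ?thesis .
qed

lemma has_sum_finite_sum:
  fixes f :: "'i \<Rightarrow> 'g \<Rightarrow> complex"
  assumes "\<And>i. i \<in> I \<Longrightarrow> (f i has_sum s i) A"
  shows "((\<lambda>v. \<Sum>i\<in>I. f i v) has_sum (\<Sum>i\<in>I. s i)) A"
  using assms by (induction I rule: infinite_finite_induct) (auto intro: has_sum_add)

lemma ell2_inner_self:
  assumes "f \<in> ell2 G"
  shows "ell2_inner G f f = of_real ((ell2_norm G f)\<^sup>2)"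
proof -
  have "((\<lambda>v. (cmod (f v))\<^sup>2) has_sum (ell2_norm G f)\<^sup>2) (carrier G)"
    using assms unfolding ell2_norm_sq by (intro has_sum_infsum) (auto simp: ell2_def)
  hence "((\<lambda>v. complex_of_real ((cmod (f v))\<^sup>2)) has_sum of_real ((ell2_norm G f)\<^sup>2)) (carrier G)"
    by (rule has_sum_of_real)
  hence "((\<lambda>v. cnj (f v) * f v) has_sum of_real ((ell2_norm G f)\<^sup>2)) (carrier G)"
    by (simp only: complex_norm_square mult.commute)
  thus ?thesis unfolding ell2_inner_def by (rule infsumI)
qed

lemma cnj_ell2_inner: "cnj (ell2_inner G f h) = ell2_inner G h f"
  unfolding ell2_inner_def by (simp add: mult.commute flip: infsum_cnj)

lemma ell2_inner_add_right:
  assumes "f \<in> ell2 G" "h \<in> ell2 G" "k \<in> ell2 G"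
  shows "ell2_inner G f (\<lambda>v. h v + k v) = ell2_inner G f h + ell2_inner G f k"
  using assms by (simp add: ell2_inner_def ring_distribs infsum_add ell2_inner_summable)

lemma ell2_inner_scale_right: "ell2_inner G f (\<lambda>v. c * h v) = c * ell2_inner G f h"
  by (simp add: ell2_inner_def mult.left_commute infsum_cmult_right')

lemma ell2_inner_diff_right:
  assumes "f \<in> ell2 G" "h \<in> ell2 G" "k \<in> ell2 G"
  shows "ell2_inner G f (\<lambda>v. h v - k v) = ell2_inner G f h - ell2_inner G f k"
  using ell2_inner_add_right[OF assms(1,2) ell2_scale(1)[OF assms(3), of "-1"]]
    ell2_inner_scale_right[of G f "-1" k] by simp

lemma ell2_inner_diff_left:
  assumes "f \<in> ell2 G" "h \<in> ell2 G" "k \<in> ell2 G"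
  shows "ell2_inner G (\<lambda>v. h v - k v) f = ell2_inner G h f - ell2_inner G k f"
  using ell2_inner_diff_right[OF assms] cnj_ell2_inner[of G] by (metis complex_cnj_diff)

lemma ell2_inner_scale_left: "ell2_inner G (\<lambda>v. c * h v) f = cnj c * ell2_inner G h f"
  using ell2_inner_scale_right[of G f c h] cnj_ell2_inner[of G] by (metis complex_cnj_mult)

lemma ell2_inner_delta_left:
  assumes "g \<in> carrier G"
  shows "ell2_inner G (delta g) f = f g"
proof -
  have "ell2_inner G (delta g) f = (\<Sum>\<^sub>\<infinity>v\<in>{g}. cnj (delta g v) * f v)"
    unfolding ell2_inner_def using assms by (intro infsum_cong_neutral) (auto simp: delta_def)
  thus ?thesis by (simp add: delta_def)
qed

lemma ell2_inner_delta_right: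
  assumes "g \<in> carrier G"
  shows "ell2_inner G f (delta g) = cnj (f g)"
  using ell2_inner_delta_left[OF assms] cnj_ell2_inner by metis

lemma ell2_norm_zeroD:
  assumes "f \<in> ell2 G" "ell2_norm G f \<le> 0"
  shows "f = (\<lambda>v. 0)"
proof
  fix v show "f v = 0"
  proof (cases "v \<in> carrier G")
    case True
    have "cmod (f v) \<le> 0"
      using cmod_le_ell2_norm[OF assms(1) True] assms(2) by linarith
    thus ?thesis by simp
  qed (use assms in \<open>auto simp: ell2_def\<close>)
qed


section \<open>The resolvent of a self-adjoint element of the group algebra\<close>

locale hermitian_element = group G for G :: "('g, 'b) monoid_scheme" (structure) +
  fixes p :: "'g \<Rightarrow> complex"
  assumes p_alg: "p \<in> group_algebra G" and p_star: "ga_star G p = p"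
begin

abbreviation P where "P \<equiv> left_regular_alg G p"

definition supp where "supp = {g. p g \<noteq> 0}"

lemma finite_supp: "finite supp" and supp_carrier: "supp \<subseteq> carrier G"
  using p_alg by (auto simp: supp_def group_algebra_def)

lemma p_inv:
  assumes "g \<in> carrier G"
  shows "p (inv g) = cnj (p g)"
proof -
  have "cnj (p (inv g)) = p g"
    using fun_cong[OF p_star, of g] assms by (simp add: ga_star_def)
  thus ?thesis by (metis complex_cnj_cnj)
qed

lemma supp_inv: "(\<lambda>g. inv g) ` supp = supp"
proof -
  have "inv g \<in> supp" if "g \<in> supp" for g
    using that supp_carrier p_inv[of g] by (auto simp: supp_def)
  moreover have "inv (inv g) = g" if "g \<in> supp" for g
    using that supp_carrier by auto
  ultimately show ?thesis by (metis (no_types, lifting) image_eqI image_subsetI subsetI subset_antisym)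
qed

lemma P_apply: "P f v = (\<Sum>g\<in>supp. p g * left_regular G g f v)"
  by (simp add: left_regular_alg_def supp_def)

lemma left_regular_ell2:
  assumes "f \<in> ell2 G" "g \<in> carrier G"
  shows "left_regular G g f \<in> ell2 G" "ell2_norm G (left_regular G g f) = ell2_norm G f"
proof -
  have b: "bij_betw (\<lambda>v. inv g \<otimes> v) (carrier G) (carrier G)"
    using assms(2) by (intro bij_betw_byWitness[where f' = "\<lambda>v. g \<otimes> v"])
      (auto simp flip: m_assoc)
  have "(\<lambda>v. (cmod (left_regular G g f v))\<^sup>2) summable_on carrier G
     \<longleftrightarrow> (\<lambda>v. (cmod (f (inv g \<otimes> v)))\<^sup>2) summable_on carrier G"
    by (intro summable_on_cong) (simp add: left_regular_def)
  also have "\<dots> \<longleftrightarrow> (\<lambda>v. (cmod (f v))\<^sup>2) summable_on carrier G"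
    by (rule summable_on_reindex_bij_betw[OF b])
  finally show "left_regular G g f \<in> ell2 G"
    using assms by (auto simp: ell2_def left_regular_def)
  have "(\<Sum>\<^sub>\<infinity>v\<in>carrier G. (cmod (left_regular G g f v))\<^sup>2)
     = (\<Sum>\<^sub>\<infinity>v\<in>carrier G. (cmod (f (inv g \<otimes> v)))\<^sup>2)"
    by (intro infsum_cong) (simp add: left_regular_def)
  also have "\<dots> = (\<Sum>\<^sub>\<infinity>v\<in>carrier G. (cmod (f v))\<^sup>2)"
    by (rule infsum_reindex_bij_betw[OF b])
  finally show "ell2_norm G (left_regular G g f) = ell2_norm G f"
    by (simp add: ell2_norm_def)
qed

definition pnorm :: real where "pnorm = (\<Sum>g\<in>supp. cmod (p g))"

lemma pnorm_nonneg: "0 \<le> pnorm" by (simp add: pnorm_def sum_nonneg)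

lemma P_ell2:
  assumes "f \<in> ell2 G"
  shows "P f \<in> ell2 G" "ell2_norm G (P f) \<le> pnorm * ell2_norm G f"
proof -
  have *: "L2_set (\<lambda>v. cmod (P f v)) F \<le> pnorm * ell2_norm G f"
    if F: "finite F" "F \<subseteq> carrier G" for F
  proof -
    have "L2_set (\<lambda>v. cmod (P f v)) F
        \<le> (\<Sum>g\<in>supp. L2_set (\<lambda>v. cmod (p g * left_regular G g f v)) F)"
      unfolding P_apply by (rule L2_set_sum_le)
    also have "\<dots> \<le> (\<Sum>g\<in>supp. cmod (p g) * ell2_norm G f)"
    proof (rule sum_mono)
      fix g assume g: "g \<in> supp"
      have g': "g \<in> carrier G" using g supp_carrier by auto
      have "L2_set (\<lambda>v. cmod (p g * left_regular G g f v)) F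
         \<le> ell2_norm G (\<lambda>v. p g * left_regular G g f v)"
        using assms g' F by (intro L2_set_le_ell2_norm ell2_scale left_regular_ell2)
      thus "L2_set (\<lambda>v. cmod (p g * left_regular G g f v)) F \<le> cmod (p g) * ell2_norm G f"
        using assms g' by (simp add: ell2_scale left_regular_ell2)
    qed
    finally show ?thesis by (simp add: pnorm_def sum_distrib_right)
  qed
  have 0: "P f v = 0" if "v \<notin> carrier G" for v using that by (simp add: P_apply left_regular_def)
  show "P f \<in> ell2 G" "ell2_norm G (P f) \<le> pnorm * ell2_norm G f"
    using ell2_boundedI[of G "P f"] 0 * by blast+
qed

lemma left_regular_adjoint:
  assumes "g \<in> carrier G"
  shows "ell2_inner G f (left_regular G g h) = ell2_inner G (left_regular G (inv g) f) h"
  unfolding ell2_inner_def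
  by (rule infsum_reindex_bij_witness[of _ "\<lambda>v. g \<otimes> v" "\<lambda>v. inv g \<otimes> v"])
    (use assms in \<open>auto simp: left_regular_def m_assoc[symmetric]\<close>)

lemma P_selfadjoint:
  assumes "f \<in> ell2 G" "h \<in> ell2 G"
  shows "ell2_inner G f (P h) = ell2_inner G (P f) h"
proof -
  have carr: "g \<in> carrier G" if "g \<in> supp" for g using that supp_carrier by auto
  have expand: "ell2_inner G f (P h) = (\<Sum>g\<in>supp. p g * ell2_inner G f (left_regular G g h))"
    if "f \<in> ell2 G" "h \<in> ell2 G" for f h
  proof -
    have "((\<lambda>v. \<Sum>g\<in>supp. p g * (cnj (f v) * left_regular G g h v)) has_sum
        (\<Sum>g\<in>supp. p g * ell2_inner G f (left_regular G g h))) (carrier G)"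
    proof (rule has_sum_finite_sum, rule has_sum_cmult_right)
      fix g assume "g \<in> supp"
      thus "((\<lambda>v. cnj (f v) * left_regular G g h v) has_sum ell2_inner G f (left_regular G g h)) (carrier G)"
        unfolding ell2_inner_def using that carr
        by (intro has_sum_infsum ell2_inner_summable left_regular_ell2(1)) auto
    qed
    also have "(\<lambda>v. \<Sum>g\<in>supp. p g * (cnj (f v) * left_regular G g h v)) = (\<lambda>v. cnj (f v) * P h v)"
      unfolding P_apply sum_distrib_left by (auto simp: algebra_simps)
    finally show ?thesis unfolding ell2_inner_def by (rule infsumI)
  qed
  have "ell2_inner G f (P h) = (\<Sum>g\<in>supp. p g * ell2_inner G (left_regular G (inv g) f) h)"
    unfolding expand[OF assms] using carr by (intro sum.cong) (auto simp: left_regular_adjoint)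
  also have "\<dots> = (\<Sum>g\<in>supp. cnj (p g) * ell2_inner G (left_regular G g f) h)"
    by (rule sum.reindex_bij_witness[of _ "\<lambda>g. inv g" "\<lambda>g. inv g"])
      (use carr supp_inv p_inv in auto)
  also have "\<dots> = cnj (ell2_inner G h (P f))"
    unfolding expand[OF assms(2,1)] by (simp add: cnj_ell2_inner)
  finally show ?thesis by (simp add: cnj_ell2_inner)
qed

lemma P_inner_real:
  assumes "f \<in> ell2 G"
  shows "Im (ell2_inner G f (P f)) = 0"
proof -
  have "cnj (ell2_inner G f (P f)) = ell2_inner G f (P f)"
    using P_selfadjoint[OF assms assms] by (simp add: cnj_ell2_inner)
  thus ?thesis by (metis Reals_cnj_iff complex_is_Real_iff)
qed

abbreviation Pz :: "complex \<Rightarrow> ('g \<Rightarrow> complex) \<Rightarrow> 'g \<Rightarrow> complex" where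
  "Pz z f \<equiv> (\<lambda>v. P f v - z * f v)"

lemma Pz_ell2: 
  assumes "f \<in> ell2 G"
  shows "Pz z f \<in> ell2 G" "ell2_norm G (Pz z f) \<le> (pnorm + cmod z) * ell2_norm G f"
proof -
  show "Pz z f \<in> ell2 G" by (intro ell2_diff P_ell2 ell2_scale assms)
  have "ell2_norm G (\<lambda>v. P f v + (-z) * f v) \<le> ell2_norm G (P f) + ell2_norm G (\<lambda>v. (-z) * f v)"
    by (intro ell2_add P_ell2 ell2_scale assms)
  also have "\<dots> \<le> pnorm * ell2_norm G f + cmod z * ell2_norm G f"
    using P_ell2(2)[OF assms] ell2_scale(2)[OF assms, of "-z"] by simp
  finally show "ell2_norm G (Pz z f) \<le> (pnorm + cmod z) * ell2_norm G f"
    by (simp add: algebra_simps)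
qed

lemma P_diff: "P (\<lambda>v. f v - h v) v = P f v - P h v"
  unfolding P_apply sum_subtractf[symmetric]
  by (intro sum.cong) (auto simp: left_regular_def right_diff_distrib)

text \<open>If \<open>P d = z d\<close> then the real number \<open>\<langle>d, P d\<rangle>\<close> equals \<open>z\<close> times the squared norm of \<open>d\<close>.\<close>

lemma Pz_inj:
  assumes "Im z \<noteq> 0" "f \<in> ell2 G" "h \<in> ell2 G" "Pz z f = Pz z h"
  shows "f = h"
proof -
  define d where "d = (\<lambda>v. f v - h v)"
  have d: "d \<in> ell2 G" unfolding d_def by (intro ell2_diff assms)
  have "P d v = z * d v" for v
    using fun_cong[OF assms(4), of v] by (simp add: d_def P_diff algebra_simps)
  hence "P d = (\<lambda>v. z * d v)" by auto
  hence "ell2_inner G d (P d) = z * of_real ((ell2_norm G d)\<^sup>2)"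
    by (simp add: ell2_inner_scale_right ell2_inner_self d)
  hence "Im z * (ell2_norm G d)\<^sup>2 = 0"
    using P_inner_real[OF d] by simp
  hence "d = (\<lambda>v. 0)" using assms(1) d by (intro ell2_norm_zeroD) auto
  thus ?thesis by (auto simp: d_def fun_eq_iff)
qed


lemma ell2_norm_diff_sq:
  assumes "f \<in> ell2 G" "h \<in> ell2 G"
  shows "(ell2_norm G (\<lambda>v. f v - h v))\<^sup>2
     = (ell2_norm G f)\<^sup>2 - 2 * Re (ell2_inner G f h) + (ell2_norm G h)\<^sup>2"
proof -
  have "complex_of_real ((ell2_norm G (\<lambda>v. f v - h v))\<^sup>2)
      = ell2_inner G f f - ell2_inner G f h - (cnj (ell2_inner G f h) - ell2_inner G h h)"
    using assms
    by (simp add: ell2_inner_self[symmetric] ell2_diff ell2_inner_diff_left ell2_inner_diff_right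
        cnj_ell2_inner del: of_real_power)
  also have "\<dots> = of_real ((ell2_norm G f)\<^sup>2 - 2 * Re (ell2_inner G f h) + (ell2_norm G h)\<^sup>2)"
    using complex_add_cnj[of "ell2_inner G f h"]
    by (simp add: ell2_inner_self assms algebra_simps)
  finally show ?thesis using of_real_eq_iff by blast
qed

text \<open>As \<open>\<langle>d, P d\<rangle>\<close> is real, rotating \<open>P - z\<close> by \<open>\<i> sgn (Im z)\<close> gives an operator whose quadratic form
  has real part \<open>|Im z|\<close> times the squared norm. A gradient step of length \<open>s\<close> then multiplies squared
  norms by at most \<open>1 - 2 s |Im z| + (s B)\<^sup>2\<close>, and \<open>s = |Im z| / B\<^sup>2\<close> minimises this.\<close>

lemma Pz_contraction:
  fixes z :: complex and d :: "'g \<Rightarrow> complex"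
  defines "B \<equiv> pnorm + cmod z"
  defines "c \<equiv> complex_of_real (\<bar>Im z\<bar> / B\<^sup>2) * (\<i> * of_real (sgn (Im z)))"
  assumes z: "Im z \<noteq> 0" and d: "d \<in> ell2 G"
  shows "(\<lambda>v. d v - c * Pz z d v) \<in> ell2 G"
    "ell2_norm G (\<lambda>v. d v - c * Pz z d v) \<le> sqrt (1 - (Im z / B)\<^sup>2) * ell2_norm G d"
proof -
  define t where "t = \<bar>Im z\<bar> / B\<^sup>2"
  have B: "B > 0"
    using z pnorm_nonneg abs_Im_le_cmod[of z] unfolding B_def by linarith
  have w: "(\<lambda>v. c * Pz z d v) \<in> ell2 G"
    by (intro ell2_scale(1) Pz_ell2(1) d)
  show "(\<lambda>v. d v - c * Pz z d v) \<in> ell2 G"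
    by (intro ell2_diff d w)
  have c: "cmod c = t" using z by (simp add: c_def t_def norm_mult norm_divide norm_power abs_sgn_eq)
  have "ell2_inner G d (\<lambda>v. c * Pz z d v) = c * (ell2_inner G d (P d) - z * of_real ((ell2_norm G d)\<^sup>2))"
    using d by (simp add: ell2_inner_scale_right ell2_inner_diff_right P_ell2 ell2_scale ell2_inner_self)
  moreover have "Re (c * (ell2_inner G d (P d) - z * of_real ((ell2_norm G d)\<^sup>2)))
     = t * (sgn (Im z) * Im z) * (ell2_norm G d)\<^sup>2"
    using P_inner_real[OF d] by (simp add: c_def t_def)
  ultimately have 1: "Re (ell2_inner G d (\<lambda>v. c * Pz z d v)) = t * \<bar>Im z\<bar> * (ell2_norm G d)\<^sup>2"
    by (simp add: abs_sgn mult.commute)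
  have "ell2_norm G (\<lambda>v. c * Pz z d v) \<le> t * (B * ell2_norm G d)"
    unfolding ell2_scale(2)[OF Pz_ell2(1)[OF d]] c B_def
    by (intro mult_left_mono Pz_ell2 d) (simp add: t_def)
  hence 2: "(ell2_norm G (\<lambda>v. c * Pz z d v))\<^sup>2 \<le> (t * (B * ell2_norm G d))\<^sup>2"
    by (intro power_mono ell2_norm_nonneg)
  have "(ell2_norm G (\<lambda>v. d v - c * Pz z d v))\<^sup>2
     \<le> (1 - 2 * (t * \<bar>Im z\<bar>) + (t * B)\<^sup>2) * (ell2_norm G d)\<^sup>2"
    unfolding ell2_norm_diff_sq[OF d w] 1 using 2 by (simp add: algebra_simps power2_eq_square)
  also have "1 - 2 * (t * \<bar>Im z\<bar>) + (t * B)\<^sup>2 = 1 - (Im z / B)\<^sup>2"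
    using B by (simp add: t_def field_simps power2_eq_square)
  finally have "ell2_norm G (\<lambda>v. d v - c * Pz z d v) \<le> sqrt ((1 - (Im z / B)\<^sup>2) * (ell2_norm G d)\<^sup>2)"
    by (rule real_le_rsqrt)
  thus "ell2_norm G (\<lambda>v. d v - c * Pz z d v) \<le> sqrt (1 - (Im z / B)\<^sup>2) * ell2_norm G d"
    by (simp add: real_sqrt_mult ell2_norm_nonneg)
qed

text \<open>Completeness of \<open>\<ell>\<^sup>2\<close> in the form needed for a Neumann series. The geometric bounds on the norms
  bound the partial sums on every finite set, and such bounds pass to the pointwise limit.\<close>

lemma ell2_series:
  assumes d: "\<And>n. d n \<in> ell2 G" and dn: "\<And>n::nat. ell2_norm G (d n) \<le> M * \<kappa> ^ n"
    and k: "0 \<le> \<kappa>" "\<kappa> < 1" and h: "\<And>v. (\<lambda>n. d n v) sums h v"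
  shows "h \<in> ell2 G"
proof (rule ell2_boundedI(1))
  fix v assume "v \<notin> carrier G"
  hence "(\<lambda>n. d n v) = (\<lambda>n. 0)" using d by (auto simp: ell2_def)
  thus "h v = 0" using h[of v] sums_0 sums_unique2 by metis
next
  have M: "0 \<le> M" using dn[of 0] ell2_norm_nonneg[of G "d 0"] by simp
  fix F assume F: "finite F" "F \<subseteq> carrier G"
  have "(\<lambda>n. L2_set (\<lambda>v. cmod (\<Sum>i<n. d i v)) F) \<longlonglongrightarrow> L2_set (\<lambda>v. cmod (h v)) F"
    unfolding L2_set_def
  proof (rule tendsto_real_sqrt, rule tendsto_sum)
    fix v
    have "(\<lambda>n. \<Sum>i<n. d i v) \<longlonglongrightarrow> h v" using h[of v] unfolding sums_def .
    thus "(\<lambda>n. (cmod (\<Sum>i<n. d i v))\<^sup>2) \<longlonglongrightarrow> (cmod (h v))\<^sup>2"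
      by (intro tendsto_power tendsto_norm)
  qed
  moreover have "L2_set (\<lambda>v. cmod (\<Sum>i<n. d i v)) F \<le> M * (1 / (1 - \<kappa>))" for n
  proof -
    have "L2_set (\<lambda>v. cmod (\<Sum>i<n. d i v)) F \<le> (\<Sum>i<n. L2_set (\<lambda>v. cmod (d i v)) F)"
      by (rule L2_set_sum_le)
    also have "\<dots> \<le> (\<Sum>i<n. M * \<kappa> ^ i)"
      by (intro sum_mono order_trans[OF L2_set_le_ell2_norm[OF d F] dn])
    also have "\<dots> \<le> (\<Sum>i. M * \<kappa> ^ i)"
      using k M by (intro sum_le_suminf summable_mult[OF summable_geometric]) auto
    also have "\<dots> = M * (1 / (1 - \<kappa>))"
      using k by (simp add: suminf_mult suminf_geometric summable_geometric)
    finally show ?thesis .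
  qed
  ultimately show "L2_set (\<lambda>v. cmod (h v)) F \<le> M * (1 / (1 - \<kappa>))"
    by (intro LIMSEQ_le_const2) auto
qed

lemma P_sums:
  assumes "\<And>v. (\<lambda>n::nat. d n v) sums h v"
  shows "(\<lambda>n. P (d n) v) sums P h v"
  unfolding P_apply
proof (intro sums_sum sums_mult)
  fix g show "(\<lambda>n. left_regular G g (d n) v) sums left_regular G g h v"
    using assms by (cases "v \<in> carrier G") (auto simp: left_regular_def)
qed

text \<open>The fixed point equation \<open>h = V h + c u\<close> for the contraction \<open>V d = d - c (P - z) d\<close> is solved
  by its Neumann series.\<close>

lemma Pz_surj:
  assumes z: "Im z \<noteq> 0" and u: "u \<in> ell2 G"
  shows "\<exists>h\<in>ell2 G. Pz z h = u"
proof -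
  define B where "B = pnorm + cmod z"
  define c where "c = complex_of_real (\<bar>Im z\<bar> / B\<^sup>2) * (\<i> * of_real (sgn (Im z)))"
  define \<kappa> where "\<kappa> = sqrt (1 - (Im z / B)\<^sup>2)"
  define V where "V = (\<lambda>d v. d v - c * Pz z d v)"
  define d where "d = (\<lambda>n. (V ^^ n) (\<lambda>v. c * u v))"
  have dS: "d (Suc n) = V (d n)" for n by (simp add: d_def)
  have B: "B > 0" "\<bar>Im z\<bar> \<le> B"
    using z pnorm_nonneg abs_Im_le_cmod[of z] unfolding B_def by linarith+
  have c0: "c \<noteq> 0" using z B(1) by (simp add: c_def sgn_eq_0_iff)
  have "\<bar>Im z / B\<bar> \<le> 1" using B by (simp add: abs_divide)
  hence le1: "(Im z / B)\<^sup>2 \<le> 1" by (simp only: abs_square_le_1)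
  have gt0: "(Im z / B)\<^sup>2 > 0" using B(1) z by simp
  have k: "0 \<le> \<kappa>" "\<kappa> < 1" using le1 gt0 by (simp_all add: \<kappa>_def)
  have dE: "d n \<in> ell2 G" for n
  proof (induction n)
    case 0 show ?case unfolding d_def by (simp add: ell2_scale(1)[OF u])
  next
    case (Suc n) show ?case
      unfolding dS V_def c_def B_def by (rule Pz_contraction(1)[OF z Suc])
  qed
  have dN: "ell2_norm G (d n) \<le> ell2_norm G (d 0) * \<kappa> ^ n" for n
  proof (induction n)
    case (Suc n)
    have "ell2_norm G (d (Suc n)) \<le> \<kappa> * ell2_norm G (d n)"
      using Pz_contraction(2)[OF z dE[of n]] by (simp add: dS V_def \<kappa>_def c_def B_def)
    also have "\<dots> \<le> \<kappa> * (ell2_norm G (d 0) * \<kappa> ^ n)" using Suc k by (intro mult_left_mono)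
    finally show ?case by (simp add: mult_ac)
  qed simp
  define h where "h = (\<lambda>v. \<Sum>n. d n v)"
  have hs: "(\<lambda>n. d n v) sums h v" for v
  proof (cases "v \<in> carrier G")
    case True
    have "summable (\<lambda>n. ell2_norm G (d 0) * \<kappa> ^ n)"
      by (rule summable_mult[OF summable_geometric]) (use k in simp)
    moreover have "cmod (d n v) \<le> ell2_norm G (d 0) * \<kappa> ^ n" for n
      by (rule order_trans[OF cmod_le_ell2_norm[OF dE True] dN])
    ultimately have "summable (\<lambda>n. d n v)"
      by (rule summable_comparison_test')
    thus ?thesis by (simp add: h_def summable_sums)
  next
    case False
    hence "d n v = 0" for n using dE[of n] by (simp add: ell2_def)
    thus ?thesis by (simp add: h_def)
  qed
  have hE: "h \<in> ell2 G" by (rule ell2_series[OF dE dN k hs])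
  \<comment> \<open>Since \<open>P\<close> only involves finitely many translations, it may be applied to the series
    term by term and pointwise.\<close>
  have "Pz z h v = u v" for v
  proof -
    have "(\<lambda>n. d n v - c * (P (d n) v - z * d n v)) sums (h v - c * (P h v - z * h v))"
      by (intro sums_diff sums_mult hs P_sums)
    hence "(\<lambda>n. d (Suc n) v) sums (h v - c * (P h v - z * h v))"
      by (simp add: dS V_def)
    moreover have "(\<lambda>n. d (Suc n) v) sums (h v - d 0 v)"
      using hs[of v] sums_Suc_iff[of "\<lambda>n. d n v" "h v - d 0 v"] by simp
    ultimately have "h v - c * (P h v - z * h v) = h v - d 0 v"
      by (rule sums_unique2)
    hence "h v - c * (P h v - z * h v) = h v - c * u v" by (simp add: d_def)
    thus ?thesis using c0 by simp
  qed
  thus ?thesis using hE by blast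
qed

lemma resolvent_props:
  assumes "Im z \<noteq> 0" "u \<in> ell2 G"
  shows "resolvent G P z u \<in> ell2 G" "Pz z (resolvent G P z u) = u"
proof -
  have u: "u \<in> Pz z ` ell2 G" using Pz_surj[OF assms] by auto
  show "resolvent G P z u \<in> ell2 G" unfolding resolvent_def by (rule inv_into_into[OF u])
  show "Pz z (resolvent G P z u) = u"
    unfolding resolvent_def by (rule f_inv_into_f[OF u])
qed

lemma adjoint_resolvent:
  assumes z: "Im z \<noteq> 0" and f: "f \<in> ell2 G"
  shows "ell2_adjoint G (resolvent G P z) f = resolvent G P (cnj z) f"
  unfolding ell2_adjoint_def
proof (rule the_equality)
  let ?h = "resolvent G P (cnj z) f"
  have z': "Im (cnj z) \<noteq> 0" using z by simp
  note h = resolvent_props[OF z' f]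
  show *: "?h \<in> ell2 G \<and> (\<forall>u\<in>ell2 G. ell2_inner G ?h u = ell2_inner G f (resolvent G P z u))"
  proof (intro conjI ballI h(1))
    fix u assume u: "u \<in> ell2 G"
    note r = resolvent_props[OF z u]
    have "ell2_inner G ?h (Pz z (resolvent G P z u)) = ell2_inner G (Pz (cnj z) ?h) (resolvent G P z u)"
      using h(1) r(1) by (simp add: ell2_inner_diff_right ell2_inner_diff_left P_ell2 ell2_scale
          P_selfadjoint ell2_inner_scale_left ell2_inner_scale_right)
    thus "ell2_inner G ?h u = ell2_inner G f (resolvent G P z u)" unfolding r(2) h(2) .
  qed
  fix h' assume h': "h' \<in> ell2 G \<and> (\<forall>u\<in>ell2 G. ell2_inner G h' u = ell2_inner G f (resolvent G P z u))"
  show "h' = ?h"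
  proof
    fix v show "h' v = ?h v"
    proof (cases "v \<in> carrier G")
      case True
      hence "ell2_inner G h' (delta v) = ell2_inner G ?h (delta v)"
        using * h' delta_in_ell2[of v G] by simp
      thus ?thesis by (simp add: ell2_inner_delta_right[OF True])
    next
      case False thus ?thesis using h' h(1) by (simp add: ell2_def)
    qed
  qed
qed

text \<open>The adjoint of \<open>R\<^sup>z\<close> is the resolvent at the conjugate point, whose \<open>(e, e)\<close> entry is the conjugate
  of that of \<open>R\<^sup>z\<close>.\<close>

lemma Im_resolvent_entry:
  assumes "Im z \<noteq> 0"
  shows "ell2_entry G (Im_op G (resolvent G P z)) \<one> \<one> = of_real (Im (resolvent G P z (delta \<one>) \<one>))"
proof -
  let ?w = "resolvent G P z (delta \<one>) \<one>"
  have z': "Im (cnj z) \<noteq> 0" using assms by simp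
  have d: "delta \<one> \<in> ell2 G" by (intro delta_in_ell2) auto
  note r = resolvent_props[OF assms d] and r' = resolvent_props[OF z' d]
  have "ell2_inner G (resolvent G P (cnj z) (delta \<one>)) (Pz z (resolvent G P z (delta \<one>)))
      = ell2_inner G (Pz (cnj z) (resolvent G P (cnj z) (delta \<one>))) (resolvent G P z (delta \<one>))"
    using r(1) r'(1) by (simp add: ell2_inner_diff_right ell2_inner_diff_left P_ell2 ell2_scale
          P_selfadjoint ell2_inner_scale_left ell2_inner_scale_right)
  hence "cnj (resolvent G P (cnj z) (delta \<one>) \<one>) = ?w"
    unfolding r(2) r'(2) by (simp add: ell2_inner_delta_left ell2_inner_delta_right)
  hence "resolvent G P (cnj z) (delta \<one>) \<one> = cnj ?w" by (metis complex_cnj_cnj)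
  hence "ell2_entry G (Im_op G (resolvent G P z)) \<one> \<one> = (?w - cnj ?w) / (2 * \<i>)"
    by (simp add: ell2_entry_def ell2_inner_delta_left Im_op_def adjoint_resolvent[OF assms d])
  thus ?thesis by (simp only: cnj_diff_over_2i)
qed


section \<open>The Green function\<close>

text \<open>Right translations commute with \<open>P\<close>, so the column of the resolvent at \<open>g\<close> is a translate of
  the column at the unit.\<close>

lemma right_translate:
  assumes h: "h \<in> ell2 G" and g: "g \<in> carrier G" and eq: "Pz z h = delta \<one>"
  defines "k \<equiv> (\<lambda>v. if v \<in> carrier G then h (v \<otimes> inv g) else 0)"
  shows "k \<in> ell2 G" "ell2_norm G k = ell2_norm G h" "Pz z k = delta g"
proof -
  have b: "bij_betw (\<lambda>v. v \<otimes> inv g) (carrier G) (carrier G)"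
    using g by (intro bij_betw_byWitness[where f' = "\<lambda>v. v \<otimes> g"]) (auto simp: m_assoc)
  have "(\<lambda>v. (cmod (k v))\<^sup>2) summable_on carrier G
     \<longleftrightarrow> (\<lambda>v. (cmod (h (v \<otimes> inv g)))\<^sup>2) summable_on carrier G"
    by (intro summable_on_cong) (simp add: k_def)
  also have "\<dots> \<longleftrightarrow> (\<lambda>v. (cmod (h v))\<^sup>2) summable_on carrier G"
    by (rule summable_on_reindex_bij_betw[OF b])
  finally show "k \<in> ell2 G" using h by (auto simp: ell2_def k_def)
  have "(\<Sum>\<^sub>\<infinity>v\<in>carrier G. (cmod (k v))\<^sup>2) = (\<Sum>\<^sub>\<infinity>v\<in>carrier G. (cmod (h (v \<otimes> inv g)))\<^sup>2)"
    by (intro infsum_cong) (simp add: k_def)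
  also have "\<dots> = (\<Sum>\<^sub>\<infinity>v\<in>carrier G. (cmod (h v))\<^sup>2)" by (rule infsum_reindex_bij_betw[OF b])
  finally show "ell2_norm G k = ell2_norm G h" by (simp add: ell2_norm_def)
  have Pk: "P k v = P h (v \<otimes> inv g)" if v: "v \<in> carrier G" for v
    unfolding P_apply
  proof (intro sum.cong refl)
    fix a assume "a \<in> supp"
    hence "a \<in> carrier G" using supp_carrier by auto
    thus "p a * left_regular G a k v = p a * left_regular G a h (v \<otimes> inv g)"
      using v g by (simp add: left_regular_def k_def m_assoc)
  qed
  show "Pz z k = delta g"
  proof
    fix v show "Pz z k v = delta g v"
    proof (cases "v \<in> carrier G")
      case True
      have "Pz z k v = delta \<one> (v \<otimes> inv g)"
        using fun_cong[OF eq, of "v \<otimes> inv g"] True Pk[OF True] by (simp add: k_def)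
      also have "\<dots> = delta g v"
        using True g inv_equality[of v "inv g"] by (auto simp: delta_def)
      finally show ?thesis .
    next
      case False
      thus ?thesis using g by (auto simp: P_apply left_regular_def k_def delta_def)
    qed
  qed
qed

text \<open>The Ward identity: pair the equation \<open>(P - z) h = \<delta>\<^sub>e\<close> with \<open>h\<close> and take imaginary parts.\<close>

lemma green_norm:
  assumes h: "h \<in> ell2 G" and eq: "Pz z h = delta \<one>"
  shows "Im z * (ell2_norm G h)\<^sup>2 = Im (h \<one>)"
proof -
  have "cnj (h \<one>) = ell2_inner G h (Pz z h)"
    unfolding eq by (simp add: ell2_inner_delta_right)
  also have "\<dots> = ell2_inner G h (P h) - z * of_real ((ell2_norm G h)\<^sup>2)"
    using h by (simp add: ell2_inner_diff_right P_ell2 ell2_scale ell2_inner_scale_right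
        ell2_inner_self)
  finally have "Im (cnj (h \<one>)) = Im (ell2_inner G h (P h) - z * of_real ((ell2_norm G h)\<^sup>2))"
    by (rule arg_cong)
  thus ?thesis using P_inner_real[OF h] by simp
qed

text \<open>For the column \<open>h = R \<delta>\<^sub>e\<close> of a resolvent this is the column of \<open>Im R\<close> at the unit, because
  \<open>R\<^sup>*(v, e)\<close> is the conjugate of \<open>R(e, v) = h(v\<^sup>-\<^sup>1)\<close>.\<close>

definition Im_kernel :: "('g \<Rightarrow> complex) \<Rightarrow> 'g \<Rightarrow> complex" where
  "Im_kernel h = (\<lambda>v. if v \<in> carrier G then (h v - cnj (h (inv v))) / (2 * \<i>) else 0)"

lemma Im_kernel_one: "Im_kernel h \<one> = of_real (Im (h \<one>))"
  using cnj_diff_over_2i[of "h \<one>"] by (simp only: Im_kernel_def inv_one one_closed if_True)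

text \<open>The entry \<open>(Im R)(g, e)\<close> equals \<open>Im z \<langle>R \<delta>\<^sub>g, R \<delta>\<^sub>e\<rangle>\<close>, and both columns have the same norm. By the
  Cauchy-Schwarz inequality and the Ward identity it is at most the diagonal entry, uniformly in the height
  \<open>Im z\<close>.\<close>

lemma Im_kernel_bounded:
  assumes h: "h \<in> ell2 G" and eq: "Pz z h = delta \<one>" and z: "Im z > 0"
  shows "cmod (Im_kernel h g) \<le> Im (h \<one>)"
proof (cases "g \<in> carrier G")
  case g: True
  define k where "k = (\<lambda>v. if v \<in> carrier G then h (v \<otimes> inv g) else 0)"
  have k: "k \<in> ell2 G" "ell2_norm G k = ell2_norm G h" "Pz z k = delta g"
    using right_translate[OF h g eq] unfolding k_def by auto
  \<comment> \<open>Evaluating \<open>\<langle>k, (P - z) h\<rangle>\<close> and \<open>\<langle>(P - z) k, h\<rangle>\<close> expresses \<open>h\<close> at \<open>g\<close> and at its inverse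
    by the same number \<open>\<langle>P k, h\<rangle>\<close>, which cancels in the difference.\<close>
  have "cnj (h (inv g)) = ell2_inner G k (Pz z h)"
    using g unfolding eq by (simp add: ell2_inner_delta_right k_def)
  also have "\<dots> = ell2_inner G (P k) h - z * ell2_inner G k h"
    using h k(1) by (simp add: ell2_inner_diff_right P_ell2 ell2_scale ell2_inner_scale_right
        P_selfadjoint)
  finally have 1: "cnj (h (inv g)) = ell2_inner G (P k) h - z * ell2_inner G k h" .
  have "h g = ell2_inner G (Pz z k) h"
    unfolding k(3) using g by (simp add: ell2_inner_delta_left)
  also have "\<dots> = ell2_inner G (P k) h - cnj z * ell2_inner G k h"
    using h k(1) by (simp add: ell2_inner_diff_left P_ell2 ell2_scale ell2_inner_scale_left)
  finally have 2: "h g - cnj (h (inv g)) = (z - cnj z) * ell2_inner G k h"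
    using 1 by (simp add: algebra_simps)
  have "Im_kernel h g = (z - cnj z) / (2 * \<i>) * ell2_inner G k h"
    using g 2 by (simp only: Im_kernel_def if_True times_divide_eq_left)
  hence "Im_kernel h g = of_real (Im z) * ell2_inner G k h"
    by (simp only: cnj_diff_over_2i)
  hence "cmod (Im_kernel h g) = Im z * cmod (ell2_inner G k h)"
    using z by (simp add: norm_mult)
  also have "\<dots> \<le> Im z * (ell2_norm G k * ell2_norm G h)"
    using z h k(1) by (intro mult_left_mono ell2_Cauchy_Schwarz) auto
  also have "\<dots> = Im (h \<one>)"
    using green_norm[OF h eq] k(2) by (simp add: power2_eq_square)
  finally show ?thesis .
next
  case False
  have "0 \<le> Im (h \<one>)" using green_norm[OF h eq] z by (metis mult_nonneg_nonneg order_less_imp_le zero_le_power2)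
  thus ?thesis using False by (simp add: Im_kernel_def)
qed

lemma sum_sq_le_ell2_norm_sq:
  assumes "h \<in> ell2 G" "finite F" "F \<subseteq> carrier G"
  shows "(\<Sum>v\<in>F. (cmod (h v))\<^sup>2) \<le> (ell2_norm G h)\<^sup>2"
  unfolding ell2_norm_sq using assms by (intro finite_sum_le_infsum) (auto simp: ell2_def)

lemma Im_kernel_sq_sum:
  assumes h: "h \<in> ell2 G" and eq: "Pz z h = delta \<one>" and z: "Im z > 0"
    and F: "finite F" "F \<subseteq> carrier G"
  shows "(\<Sum>v\<in>F. (cmod (Im_kernel h v))\<^sup>2) \<le> Im (h \<one>) / Im z"
proof -
  have "(cmod (Im_kernel h v))\<^sup>2 \<le> ((cmod (h v))\<^sup>2 + (cmod (h (inv v)))\<^sup>2) / 2" if "v \<in> F" for v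
  proof -
    have "cmod (Im_kernel h v) \<le> (cmod (h v) + cmod (h (inv v))) / 2"
      using that F norm_triangle_ineq4[of "h v" "cnj (h (inv v))"]
      by (auto simp: Im_kernel_def norm_divide norm_mult)
    hence "(cmod (Im_kernel h v))\<^sup>2 \<le> ((cmod (h v) + cmod (h (inv v))) / 2)\<^sup>2"
      by (intro power_mono) auto
    also have "\<dots> \<le> ((cmod (h v))\<^sup>2 + (cmod (h (inv v)))\<^sup>2) / 2"
      using sum_squares_bound[of "cmod (h v)" "cmod (h (inv v))"]
      by (simp add: power2_eq_square field_simps)
    finally show ?thesis .
  qed
  hence "(\<Sum>v\<in>F. (cmod (Im_kernel h v))\<^sup>2) \<le> (\<Sum>v\<in>F. ((cmod (h v))\<^sup>2 + (cmod (h (inv v)))\<^sup>2) / 2)"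
    by (rule sum_mono)
  also have "\<dots> = ((\<Sum>v\<in>F. (cmod (h v))\<^sup>2) + (\<Sum>v\<in>F. (cmod (h (inv v)))\<^sup>2)) / 2"
    by (simp add: sum.distrib flip: sum_divide_distrib)
  also have "(\<Sum>v\<in>F. (cmod (h (inv v)))\<^sup>2) = (\<Sum>v\<in>(\<lambda>v. inv v) ` F. (cmod (h v))\<^sup>2)"
    by (subst sum.reindex) (use F in \<open>auto intro: inj_on_subset[OF inv_inj]\<close>)
  also have "((\<Sum>v\<in>F. (cmod (h v))\<^sup>2) + (\<Sum>v\<in>(\<lambda>v. inv v) ` F. (cmod (h v))\<^sup>2)) / 2
      \<le> ((ell2_norm G h)\<^sup>2 + (ell2_norm G h)\<^sup>2) / 2"
    using F by (intro divide_right_mono add_mono sum_sq_le_ell2_norm_sq h) auto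
  also have "\<dots> = Im (h \<one>) / Im z"
    using green_norm[OF h eq] z by (simp add: field_simps)
  finally show ?thesis .
qed

text \<open>Truncating the column \<open>h\<close> to a large finite set changes \<open>(P - z) h = \<delta>\<^sub>e\<close> by little because \<open>P\<close> is
  bounded. The set is taken symmetric so that the imaginary part of the truncated element is
  the truncation of \<open>Im_kernel h\<close>, and contains the unit so that the diagonal entry survives.\<close>

lemma approximate_inverse:
  assumes h: "h \<in> ell2 G" and eq: "Pz z h = delta \<one>" and e: "\<epsilon> > 0"
  obtains F where "finite F" "F \<subseteq> carrier G" "\<one> \<in> F" "(\<lambda>g. inv g) ` F = F"
    "\<And>F'. finite F' \<Longrightarrow> F' \<subseteq> carrier G \<Longrightarrow>
       (\<Sum>v\<in>F'. (cmod (Pz z (\<lambda>g. if g \<in> F then h g else 0) v - delta \<one> v))\<^sup>2) \<le> \<epsilon>"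
proof -
  define B where "B = pnorm + cmod z + 1"
  have B: "B > 0" using pnorm_nonneg by (auto simp: B_def intro: add_nonneg_pos)
  have s: "(\<lambda>v. (cmod (h v))\<^sup>2) summable_on carrier G" using h by (simp add: ell2_def)
  obtain F0 where F0: "finite F0" "F0 \<subseteq> carrier G"
    "dist (\<Sum>v\<in>F0. (cmod (h v))\<^sup>2) ((ell2_norm G h)\<^sup>2) \<le> \<epsilon> / B\<^sup>2"
    using infsum_finite_approximation[OF s, of "\<epsilon> / B\<^sup>2"] e B unfolding ell2_norm_sq by auto
  define F where "F = insert \<one> F0 \<union> (\<lambda>g. inv g) ` insert \<one> F0"
  have F: "finite F" "F \<subseteq> carrier G" "\<one> \<in> F" "F0 \<subseteq> F" using F0 by (auto simp: F_def)
  have inv: "(\<lambda>g. inv g) ` F = F"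
  proof -
    have "(\<lambda>g. inv g) ` (\<lambda>g. inv g) ` insert \<one> F0 = insert \<one> F0"
    proof -
      have "inv (inv x) = x" if "x \<in> insert \<one> F0" for x using that F0(2) by auto
      thus ?thesis unfolding image_image by simp
    qed
    thus ?thesis unfolding F_def image_Un by (simp only: Un_commute)
  qed
  define hF where "hF = (\<lambda>g. if g \<in> F then h g else 0)"
  define d where "d = (\<lambda>v. hF v - h v)"
  have hF: "hF \<in> ell2 G" by (rule ell2_finite_support[of F]) (use F in \<open>auto simp: hF_def\<close>)
  have d: "d \<in> ell2 G" unfolding d_def by (intro ell2_diff hF h)
  have "(ell2_norm G d)\<^sup>2 \<le> \<epsilon> / B\<^sup>2"
    unfolding ell2_norm_sq
  proof (rule infsum_le_finite_sums)
    show "(\<lambda>v. (cmod (d v))\<^sup>2) summable_on carrier G" using d by (simp add: ell2_def)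
    fix A assume A: "finite A" "A \<subseteq> carrier G"
    have "(\<Sum>v\<in>A. (cmod (d v))\<^sup>2) + (\<Sum>v\<in>F0. (cmod (h v))\<^sup>2)
      \<le> (\<Sum>v\<in>A - F. (cmod (h v))\<^sup>2) + (\<Sum>v\<in>F. (cmod (h v))\<^sup>2)"
    proof (rule add_mono)
      have "(\<Sum>v\<in>A. (cmod (d v))\<^sup>2) = (\<Sum>v\<in>A - F. (cmod (h v))\<^sup>2)"
        using A by (intro sum.mono_neutral_cong_right) (auto simp: d_def hF_def)
      thus "(\<Sum>v\<in>A. (cmod (d v))\<^sup>2) \<le> (\<Sum>v\<in>A - F. (cmod (h v))\<^sup>2)" by simp
      show "(\<Sum>v\<in>F0. (cmod (h v))\<^sup>2) \<le> (\<Sum>v\<in>F. (cmod (h v))\<^sup>2)"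
        using F by (intro sum_mono2) auto
    qed
    also have "\<dots> = (\<Sum>v\<in>(A - F) \<union> F. (cmod (h v))\<^sup>2)"
      using A F by (intro sum.union_disjoint[symmetric]) auto
    also have "\<dots> \<le> (ell2_norm G h)\<^sup>2"
      using A F by (intro sum_sq_le_ell2_norm_sq h) auto
    finally show "(\<Sum>v\<in>A. (cmod (d v))\<^sup>2) \<le> \<epsilon> / B\<^sup>2"
      using F0(3) by (simp add: dist_real_def)
  qed
  hence Bd: "(B * ell2_norm G d)\<^sup>2 \<le> \<epsilon>"
    using B by (simp add: power_mult_distrib field_simps)
  have r: "Pz z hF v - delta \<one> v = Pz z d v" for v
    unfolding eq[symmetric] d_def P_diff by (simp add: algebra_simps)
  show thesis
  proof (rule that[of F])
    fix F' assume F': "finite F'" "F' \<subseteq> carrier G"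
    have "(\<Sum>v\<in>F'. (cmod (Pz z hF v - delta \<one> v))\<^sup>2) \<le> (ell2_norm G (Pz z d))\<^sup>2"
      unfolding r by (intro sum_sq_le_ell2_norm_sq Pz_ell2 d F')
    also have "\<dots> \<le> (B * ell2_norm G d)\<^sup>2"
    proof (rule power_mono[OF _ ell2_norm_nonneg])
      show "ell2_norm G (Pz z d) \<le> B * ell2_norm G d"
        using Pz_ell2(2)[OF d, of z] ell2_norm_nonneg[of G d] unfolding B_def
        by (simp add: algebra_simps)
    qed
    finally show "(\<Sum>v\<in>F'. (cmod (Pz z (\<lambda>g. if g \<in> F then h g else 0) v - delta \<one> v))\<^sup>2) \<le> \<epsilon>"
      using Bd unfolding hF_def by simp
  qed (use F inv in auto)
qed

lemma Pz_support:
  assumes F: "finite F" "F \<subseteq> carrier G" "\<one> \<in> F" "{g. f g \<noteq> 0} \<subseteq> F"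
  shows "finite (F \<union> (\<lambda>(a, g). a \<otimes> g) ` (supp \<times> F))"
    "F \<union> (\<lambda>(a, g). a \<otimes> g) ` (supp \<times> F) \<subseteq> carrier G"
    "{g. Pz z f g - delta \<one> g \<noteq> 0} \<subseteq> F \<union> (\<lambda>(a, g). a \<otimes> g) ` (supp \<times> F)"
proof -
  show "finite (F \<union> (\<lambda>(a, g). a \<otimes> g) ` (supp \<times> F))" using F finite_supp by auto
  show "F \<union> (\<lambda>(a, g). a \<otimes> g) ` (supp \<times> F) \<subseteq> carrier G" using F supp_carrier by auto
  have "Pz z f g - delta \<one> g = 0" if g: "g \<notin> F \<union> (\<lambda>(a, g). a \<otimes> g) ` (supp \<times> F)" for g
  proof -
    have "left_regular G a f g = 0" if a: "a \<in> supp" for a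
    proof (rule ccontr)
      have a': "a \<in> carrier G" using a supp_carrier by auto
      assume "left_regular G a f g \<noteq> 0"
      hence gc: "g \<in> carrier G" and "inv a \<otimes> g \<in> F"
        using F(4) by (auto simp: left_regular_def split: if_splits)
      moreover have "g = a \<otimes> (inv a \<otimes> g)" using a' gc by (simp add: m_assoc[symmetric])
      ultimately show False using g a by force
    qed
    hence "P f g = 0" by (simp add: P_apply)
    thus "Pz z f g - delta \<one> g = 0" using g F(3,4) by (auto simp: delta_def)
  qed
  thus "{g. Pz z f g - delta \<one> g \<noteq> 0} \<subseteq> F \<union> (\<lambda>(a, g). a \<otimes> g) ` (supp \<times> F)"
    by blast
qed

lemma AC_green:
  assumes "cond_AC G P I"
  obtains C where "C \<ge> 1"
    "\<And>E \<eta>. E \<in> I \<Longrightarrow> 0 < \<eta> \<Longrightarrow> \<eta> \<le> 1 \<Longrightarrow>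
       \<exists>h\<in>ell2 G. Pz (Complex E \<eta>) h = delta \<one> \<and> 1 / C \<le> Im (h \<one>) \<and> Im (h \<one>) \<le> C"
proof -
  obtain C where C: "C \<ge> 1" "\<And>E \<eta>. E \<in> I \<Longrightarrow> 0 < \<eta> \<Longrightarrow> \<eta> \<le> 1 \<Longrightarrow>
     ell2_entry G (Im_op G (resolvent G P (Complex E \<eta>))) \<one> \<one> \<in> complex_of_real ` {inverse C..C}"
    using assms unfolding cond_AC_def by blast
  show thesis
  proof (rule that[OF C(1)])
    fix E \<eta> :: real assume *: "E \<in> I" "0 < \<eta>" "\<eta> \<le> 1"
    hence z: "Im (Complex E \<eta>) \<noteq> 0" by simp
    have d: "delta \<one> \<in> ell2 G" by (intro delta_in_ell2) auto
    have "Im (resolvent G P (Complex E \<eta>) (delta \<one>) \<one>) \<in> {inverse C..C}"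
      using C(2)[OF *] unfolding Im_resolvent_entry[OF z] by auto
    thus "\<exists>h\<in>ell2 G. Pz (Complex E \<eta>) h = delta \<one> \<and> 1 / C \<le> Im (h \<one>) \<and> Im (h \<one>) \<le> C"
      using resolvent_props[OF z d]
      by (intro bexI[of _ "resolvent G P (Complex E \<eta>) (delta \<one>)"]) (auto simp: inverse_eq_divide)
  qed
qed

end

section \<open>Matrices and eigenbases\<close>

text \<open>The squared Hilbert-Schmidt norm of the restriction to indices in \<open>{1..N}\<close>.\<close>

definition hs2 :: "nat \<Rightarrow> cmatrix \<Rightarrow> real" where
  "hs2 N A = (\<Sum>x=1..N. \<Sum>y=1..N. (cmod (A x y))\<^sup>2)"

text \<open>The matrix of the operator with eigenvectors \<open>\<phi> \<alpha>\<close> and eigenvalues \<open>f \<alpha>\<close>, that is, a function of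
  the operator diagonalised by \<open>\<phi>\<close>.\<close>

definition spec_mat :: "nat \<Rightarrow> (nat \<Rightarrow> cvec) \<Rightarrow> (nat \<Rightarrow> complex) \<Rightarrow> cmatrix" where
  "spec_mat N \<phi> f x y = (\<Sum>\<alpha>=1..N. f \<alpha> * (\<phi> \<alpha> x * cnj (\<phi> \<alpha> y)))"

lemma hs2_nonneg: "0 \<le> hs2 N A" by (simp add: hs2_def sum_nonneg)

lemma hs2_cong:
  "(\<And>x y. x \<in> {1..N} \<Longrightarrow> y \<in> {1..N} \<Longrightarrow> A x y = B x y) \<Longrightarrow> hs2 N A = hs2 N B"
  unfolding hs2_def by (intro sum.cong refl) simp

lemma hs2_prod: "hs2 N A = (\<Sum>(x, y)\<in>{1..N} \<times> {1..N}. (cmod (A x y))\<^sup>2)"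
  by (simp add: hs2_def sum.cartesian_product)

lemma cmod_sq_diff_le: "(cmod (a - b))\<^sup>2 \<le> 2 * ((cmod a)\<^sup>2 + (cmod b)\<^sup>2)"
proof -
  have "(cmod (a - b))\<^sup>2 \<le> (cmod a + cmod b)\<^sup>2"
    by (intro power_mono norm_triangle_ineq4) auto
  also have "\<dots> \<le> 2 * ((cmod a)\<^sup>2 + (cmod b)\<^sup>2)"
    using sum_squares_bound[of "cmod a" "cmod b"] by (simp add: power2_sum)
  finally show ?thesis .
qed

lemma hs2_diff_le: "hs2 N (\<lambda>x y. A x y - B x y) \<le> 2 * (hs2 N A + hs2 N B)"
  unfolding hs2_def sum.distrib[symmetric] sum_distrib_left by (intro sum_mono cmod_sq_diff_le)

lemma hs2_adjoint: "hs2 N (\<lambda>x y. cnj (A y x)) = hs2 N A"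
  unfolding hs2_def by (subst sum.swap) simp

lemma hs2_imaginary_part:
  "hs2 N (\<lambda>x y. (A x y - cnj (A y x)) / (2 * \<i>)) \<le> hs2 N A"
proof -
  have "hs2 N (\<lambda>x y. (A x y - cnj (A y x)) / (2 * \<i>)) = hs2 N (\<lambda>x y. A x y - cnj (A y x)) / 4"
    by (simp add: hs2_def norm_divide norm_mult power_divide sum_divide_distrib)
  also have "\<dots> \<le> 2 * (hs2 N A + hs2 N (\<lambda>x y. cnj (A y x))) / 4"
    by (intro divide_right_mono hs2_diff_le) simp
  finally show ?thesis by (simp add: hs2_adjoint)
qed

lemma trace_le_hs2: "(cmod (\<Sum>x=1..N. A x x))\<^sup>2 \<le> real N * hs2 N A"
proof -
  have "(\<Sum>x=1..N. cmod (A x x) * 1)\<^sup>2 \<le> (\<Sum>x=1..N. (cmod (A x x))\<^sup>2) * (\<Sum>x=1..N. 1\<^sup>2)"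
    by (rule Cauchy_Schwarz_ineq_sum)
  hence "(\<Sum>x=1..N. cmod (A x x))\<^sup>2 \<le> real N * (\<Sum>x=1..N. (cmod (A x x))\<^sup>2)"
    by (simp add: mult.commute)
  moreover have "(cmod (\<Sum>x=1..N. A x x))\<^sup>2 \<le> (\<Sum>x=1..N. cmod (A x x))\<^sup>2"
    by (intro power_mono norm_sum) simp
  moreover have "(\<Sum>x=1..N. (cmod (A x x))\<^sup>2) \<le> hs2 N A"
    unfolding hs2_def by (intro sum_mono member_le_sum) auto
  ultimately show ?thesis by (meson mult_left_mono of_nat_0_le_iff order_trans)
qed

lemma cmod_sq_sum_eq:
  "complex_of_real ((cmod (\<Sum>x\<in>A. f x))\<^sup>2) = (\<Sum>x\<in>A. \<Sum>y\<in>A. f x * cnj (f y))"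
  by (simp only: complex_norm_square cnj_sum sum_product)

lemma sum_swap_third:
  "(\<Sum>a\<in>A. \<Sum>b\<in>B. \<Sum>c\<in>C. f a b c) = (\<Sum>b\<in>B. \<Sum>c\<in>C. \<Sum>a\<in>A. f a b c)"
  by (subst sum.swap) (intro sum.cong refl sum.swap)

lemma sum_swap_pairs:
  "(\<Sum>a\<in>A. \<Sum>b\<in>B. \<Sum>c\<in>C. \<Sum>d\<in>D. f a b c d) = (\<Sum>c\<in>C. \<Sum>d\<in>D. \<Sum>a\<in>A. \<Sum>b\<in>B. f a b c d)"
proof -
  have "(\<Sum>a\<in>A. \<Sum>b\<in>B. \<Sum>c\<in>C. \<Sum>d\<in>D. f a b c d) = (\<Sum>a\<in>A. \<Sum>c\<in>C. \<Sum>d\<in>D. \<Sum>b\<in>B. f a b c d)"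
    by (intro sum.cong refl sum_swap_third)
  also have "\<dots> = (\<Sum>c\<in>C. \<Sum>d\<in>D. \<Sum>a\<in>A. \<Sum>b\<in>B. f a b c d)" by (rule sum_swap_third)
  finally show ?thesis .
qed

locale orthonormal_family =
  fixes N :: nat and \<phi> :: "nat \<Rightarrow> cvec"
  assumes orth: "\<And>\<alpha> \<beta>. \<alpha> \<in> {1..N} \<Longrightarrow> \<beta> \<in> {1..N} \<Longrightarrow>
    vec_inner N (\<phi> \<alpha>) (\<phi> \<beta>) = (if \<alpha> = \<beta> then 1 else 0)"
begin

text \<open>The defect \<open>E = 1 - \<Sum>\<^sub>\<alpha> \<phi>\<^sub>\<alpha> \<phi>\<^sub>\<alpha>\<^sup>*\<close> is an orthogonal projection, so its squared Hilbert-Schmidt norm is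
  its trace, which is \<open>N - N = 0\<close>.\<close>

lemma complete:
  assumes "x \<in> {1..N}" "y \<in> {1..N}"
  shows "(\<Sum>\<alpha>=1..N. \<phi> \<alpha> x * cnj (\<phi> \<alpha> y)) = (if x = y then 1 else 0)"
proof -
  define Q where "Q x y = (\<Sum>\<alpha>=1..N. \<phi> \<alpha> x * cnj (\<phi> \<alpha> y))" for x y
  define E where "E x y = (if x = y then 1 else 0) - Q x y" for x y
  have cQ: "Q y x = cnj (Q x y)" for x y by (simp add: Q_def mult.commute)
  have QQ: "(\<Sum>y=1..N. Q x y * Q y x) = Q x x" for x
  proof -
    have "(\<Sum>y=1..N. Q x y * Q y x)
      = (\<Sum>y=1..N. \<Sum>\<alpha>=1..N. \<Sum>\<beta>=1..N. \<phi> \<alpha> x * cnj (\<phi> \<beta> x) * (cnj (\<phi> \<alpha> y) * \<phi> \<beta> y))"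
      unfolding Q_def sum_product by (intro sum.cong refl) (simp only: mult_ac)
    also have "\<dots> = (\<Sum>\<alpha>=1..N. \<Sum>\<beta>=1..N. \<Sum>y=1..N. \<phi> \<alpha> x * cnj (\<phi> \<beta> x) * (cnj (\<phi> \<alpha> y) * \<phi> \<beta> y))"
      by (rule sum_swap_third)
    also have "\<dots> = (\<Sum>\<alpha>=1..N. \<Sum>\<beta>=1..N. \<phi> \<alpha> x * cnj (\<phi> \<beta> x) * (if \<alpha> = \<beta> then 1 else 0))"
      by (intro sum.cong refl) (simp add: vec_inner_def flip: sum_distrib_left orth)
    also have "\<dots> = Q x x" by (simp add: Q_def if_distrib sum.delta cong: if_cong)
    finally show ?thesis .
  qed
  have EE: "complex_of_real (\<Sum>y=1..N. (cmod (E x y))\<^sup>2) = E x x" if x: "x \<in> {1..N}" for x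
  proof -
    have "complex_of_real (\<Sum>y=1..N. (cmod (E x y))\<^sup>2)
      = (\<Sum>y=1..N. (if x = y then 1 - 2 * Q x x else 0) + Q x y * Q y x)"
      unfolding of_real_sum
    proof (intro sum.cong refl)
      fix y
      have "complex_of_real ((cmod (E x y))\<^sup>2) = E x y * cnj (E x y)"
        by (rule complex_norm_square)
      also have "\<dots> = (if x = y then 1 - 2 * Q x x else 0) + Q x y * Q y x"
        using cQ[of x x] by (auto simp: E_def cQ[of y x] algebra_simps)
      finally show "complex_of_real ((cmod (E x y))\<^sup>2)
        = (if x = y then 1 - 2 * Q x x else 0) + Q x y * Q y x" .
    qed
    also have "\<dots> = E x x" using x by (simp only: sum.distrib QQ) (simp add: E_def sum.delta')
    finally show ?thesis .
  qed
  have "complex_of_real (\<Sum>x=1..N. \<Sum>y=1..N. (cmod (E x y))\<^sup>2) = (\<Sum>x=1..N. E x x)"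
    unfolding of_real_sum[of _ "{1..N}"] by (rule sum.cong[OF refl EE[unfolded of_real_sum]])
  also have "\<dots> = of_nat N - (\<Sum>x=1..N. Q x x)" by (simp add: E_def sum_subtractf)
  also have "(\<Sum>x=1..N. Q x x) = (\<Sum>\<alpha>=1..N. vec_inner N (\<phi> \<alpha>) (\<phi> \<alpha>))"
    unfolding Q_def vec_inner_def by (subst sum.swap) (simp add: mult.commute)
  also have "\<dots> = of_nat N" by (simp add: orth)
  finally have "(\<Sum>x=1..N. \<Sum>y=1..N. (cmod (E x y))\<^sup>2) = 0"
    using of_real_eq_0_iff by (metis cancel_comm_monoid_add_class.diff_cancel)
  hence "(\<Sum>y=1..N. (cmod (E x y))\<^sup>2) = 0"
    using assms(1) by (subst (asm) sum_nonneg_eq_0_iff) (auto intro: sum_nonneg)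
  hence "(cmod (E x y))\<^sup>2 = 0"
    using assms(2) by (subst (asm) sum_nonneg_eq_0_iff) auto
  thus ?thesis by (simp add: E_def Q_def)
qed

lemma parseval:
  "(\<Sum>\<alpha>=1..N. (cmod (\<Sum>x=1..N. cnj (\<phi> \<alpha> x) * v x))\<^sup>2) = (\<Sum>x=1..N. (cmod (v x))\<^sup>2)"
proof -
  have "complex_of_real (\<Sum>\<alpha>=1..N. (cmod (\<Sum>x=1..N. cnj (\<phi> \<alpha> x) * v x))\<^sup>2)
     = (\<Sum>\<alpha>=1..N. \<Sum>x=1..N. \<Sum>y=1..N. v x * cnj (v y) * (\<phi> \<alpha> y * cnj (\<phi> \<alpha> x)))"
    unfolding of_real_sum cmod_sq_sum_eq by (simp add: mult_ac)
  also have "\<dots> = (\<Sum>x=1..N. \<Sum>y=1..N. \<Sum>\<alpha>=1..N. v x * cnj (v y) * (\<phi> \<alpha> y * cnj (\<phi> \<alpha> x)))"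
    by (rule sum_swap_third)
  also have "\<dots> = (\<Sum>x=1..N. \<Sum>y=1..N. v x * cnj (v y) * (if y = x then 1 else 0))"
    by (intro sum.cong refl) (simp only: complete flip: sum_distrib_left)
  also have "\<dots> = (\<Sum>x=1..N. v x * cnj (v x))"
    by (intro sum.cong refl) (simp add: if_distrib sum.delta cong: if_cong)
  also have "\<dots> = complex_of_real (\<Sum>x=1..N. (cmod (v x))\<^sup>2)"
    by (simp only: of_real_sum complex_norm_square)
  finally show ?thesis using of_real_eq_iff by blast
qed

lemma parseval_cnj:
  "(\<Sum>\<alpha>=1..N. (cmod (\<Sum>x=1..N. v x * \<phi> \<alpha> x))\<^sup>2) = (\<Sum>x=1..N. (cmod (v x))\<^sup>2)"
proof -
  have "cmod (\<Sum>x=1..N. v x * \<phi> \<alpha> x) = cmod (\<Sum>x=1..N. cnj (\<phi> \<alpha> x) * cnj (v x))" for \<alpha>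
    by (subst complex_mod_cnj[symmetric]) (simp only: cnj_sum complex_cnj_mult mult.commute)
  thus ?thesis using parseval[of "\<lambda>x. cnj (v x)"] by simp
qed

lemma hs2_coefficients:
  "hs2 N A = (\<Sum>\<alpha>=1..N. \<Sum>w=1..N. (cmod (\<Sum>x=1..N. cnj (\<phi> \<alpha> x) * A x w))\<^sup>2)"
proof -
  have "(\<Sum>\<alpha>=1..N. \<Sum>w=1..N. (cmod (\<Sum>x=1..N. cnj (\<phi> \<alpha> x) * A x w))\<^sup>2)
     = (\<Sum>w=1..N. \<Sum>x=1..N. (cmod (A x w))\<^sup>2)"
    by (subst sum.swap) (simp only: parseval)
  thus ?thesis unfolding hs2_def by (subst sum.swap) simp
qed

lemma hs2_matrix_elements:
  "(\<Sum>\<alpha>=1..N. \<Sum>\<beta>=1..N. (cmod (vec_inner N (\<phi> \<beta>) (mat_vec N A (\<phi> \<alpha>))))\<^sup>2) = hs2 N A"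
proof -
  have "(\<Sum>\<alpha>=1..N. \<Sum>\<beta>=1..N. (cmod (vec_inner N (\<phi> \<beta>) (mat_vec N A (\<phi> \<alpha>))))\<^sup>2)
      = (\<Sum>\<alpha>=1..N. \<Sum>x=1..N. (cmod (mat_vec N A (\<phi> \<alpha>) x))\<^sup>2)"
    unfolding vec_inner_def by (simp only: parseval)
  also have "\<dots> = (\<Sum>x=1..N. \<Sum>\<alpha>=1..N. (cmod (mat_vec N A (\<phi> \<alpha>) x))\<^sup>2)" by (rule sum.swap)
  also have "\<dots> = hs2 N A" unfolding mat_vec_def hs2_def by (simp only: parseval_cnj)
  finally show ?thesis .
qed

lemma spec_mat_coefficient:
  assumes "\<alpha> \<in> {1..N}"
  shows "(\<Sum>x=1..N. cnj (\<phi> \<alpha> x) * spec_mat N \<phi> f x w) = f \<alpha> * cnj (\<phi> \<alpha> w)"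
proof -
  have "(\<Sum>x=1..N. cnj (\<phi> \<alpha> x) * spec_mat N \<phi> f x w)
     = (\<Sum>\<beta>=1..N. \<Sum>x=1..N. f \<beta> * cnj (\<phi> \<beta> w) * (cnj (\<phi> \<alpha> x) * \<phi> \<beta> x))"
    unfolding spec_mat_def sum_distrib_left by (subst sum.swap) (simp add: mult_ac)
  also have "\<dots> = (\<Sum>\<beta>=1..N. f \<beta> * cnj (\<phi> \<beta> w) * (if \<alpha> = \<beta> then 1 else 0))"
    using assms by (intro sum.cong refl) (simp only: flip: sum_distrib_left vec_inner_def orth)
  also have "\<dots> = f \<alpha> * cnj (\<phi> \<alpha> w)"
    using assms by (simp add: if_distrib sum.delta' cong: if_cong)
  finally show ?thesis .
qed

lemma trace_spec_mat: "(\<Sum>x=1..N. spec_mat N \<phi> f x x) = (\<Sum>\<alpha>=1..N. f \<alpha>)"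
proof -
  have "(\<Sum>x=1..N. spec_mat N \<phi> f x x) = (\<Sum>\<alpha>=1..N. f \<alpha> * vec_inner N (\<phi> \<alpha>) (\<phi> \<alpha>))"
    unfolding spec_mat_def vec_inner_def sum_distrib_left by (subst sum.swap) (simp add: mult_ac)
  thus ?thesis by (simp add: orth)
qed

text \<open>Both sides are \<open>Tr (F\<^sub>1 M\<^sup>* F\<^sub>2 M)\<close>, in the eigenbasis and in the standard basis, for the matrix \<open>M\<close>
  that multiplies by \<open>b\<close> and then moves the point \<open>y\<close> to \<open>\<tau> y\<close>.\<close>

lemma weighted_matrix_elements:
  fixes f1 f2 :: "nat \<Rightarrow> real"
  shows "complex_of_real (\<Sum>\<alpha>=1..N. \<Sum>\<beta>=1..N. f1 \<alpha> * f2 \<beta> *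
      (cmod (\<Sum>y=1..N. cnj (\<phi> \<beta> (\<tau> y)) * (b y * \<phi> \<alpha> y)))\<^sup>2)
    = (\<Sum>y=1..N. \<Sum>y'=1..N. b y * cnj (b y') * spec_mat N \<phi> (\<lambda>\<alpha>. of_real (f1 \<alpha>)) y y'
         * spec_mat N \<phi> (\<lambda>\<beta>. of_real (f2 \<beta>)) (\<tau> y') (\<tau> y))"
    (is "?L = ?R")
proof -
  let ?t = "\<lambda>\<alpha> \<beta> y y'. of_real (f1 \<alpha>) * of_real (f2 \<beta>) *
    (cnj (\<phi> \<beta> (\<tau> y)) * (b y * \<phi> \<alpha> y) * cnj (cnj (\<phi> \<beta> (\<tau> y')) * (b y' * \<phi> \<alpha> y')))"
  have "?L = (\<Sum>\<alpha>=1..N. \<Sum>\<beta>=1..N. \<Sum>y=1..N. \<Sum>y'=1..N. ?t \<alpha> \<beta> y y')"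
    by (simp only: of_real_sum of_real_mult cmod_sq_sum_eq sum_distrib_left)
  also have "\<dots> = (\<Sum>y=1..N. \<Sum>y'=1..N. \<Sum>\<alpha>=1..N. \<Sum>\<beta>=1..N. ?t \<alpha> \<beta> y y')"
    by (rule sum_swap_pairs)
  also have "\<dots> = ?R"
  proof (intro sum.cong refl)
    fix y y'
    have "b y * cnj (b y') * spec_mat N \<phi> (\<lambda>\<alpha>. of_real (f1 \<alpha>)) y y'
         * spec_mat N \<phi> (\<lambda>\<beta>. of_real (f2 \<beta>)) (\<tau> y') (\<tau> y)
       = b y * cnj (b y') * (spec_mat N \<phi> (\<lambda>\<alpha>. of_real (f1 \<alpha>)) y y'
         * spec_mat N \<phi> (\<lambda>\<beta>. of_real (f2 \<beta>)) (\<tau> y') (\<tau> y))" by (simp only: mult.assoc)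
    also have "\<dots> = b y * cnj (b y') * (\<Sum>\<alpha>=1..N. \<Sum>\<beta>=1..N.
        of_real (f1 \<alpha>) * (\<phi> \<alpha> y * cnj (\<phi> \<alpha> y')) *
        (of_real (f2 \<beta>) * (\<phi> \<beta> (\<tau> y') * cnj (\<phi> \<beta> (\<tau> y)))))"
      unfolding spec_mat_def sum_product ..
    also have "\<dots> = (\<Sum>\<alpha>=1..N. \<Sum>\<beta>=1..N. ?t \<alpha> \<beta> y y')"
      unfolding sum_distrib_left by (intro sum.cong refl) (simp add: mult_ac)
    finally show "(\<Sum>\<alpha>=1..N. \<Sum>\<beta>=1..N. ?t \<alpha> \<beta> y y')
       = b y * cnj (b y') * spec_mat N \<phi> (\<lambda>\<alpha>. of_real (f1 \<alpha>)) y y'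
         * spec_mat N \<phi> (\<lambda>\<beta>. of_real (f2 \<beta>)) (\<tau> y') (\<tau> y)" by (rule sym)
  qed
  finally show ?thesis .
qed

end

locale hermitian_eigenbasis = orthonormal_family +
  fixes A :: cmatrix and l :: "nat \<Rightarrow> complex"
  assumes herm: "\<And>x y. x \<in> {1..N} \<Longrightarrow> y \<in> {1..N} \<Longrightarrow> A x y = cnj (A y x)"
    and eigen: "\<And>\<alpha> x. \<alpha> \<in> {1..N} \<Longrightarrow> x \<in> {1..N} \<Longrightarrow> mat_vec N A (\<phi> \<alpha>) x = l \<alpha> * \<phi> \<alpha> x"
begin

lemma left_eigen:
  assumes "\<alpha> \<in> {1..N}" "y \<in> {1..N}"
  shows "(\<Sum>x=1..N. cnj (\<phi> \<alpha> x) * A x y) = cnj (l \<alpha>) * cnj (\<phi> \<alpha> y)"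
proof -
  have "(\<Sum>x=1..N. cnj (\<phi> \<alpha> x) * A x y) = cnj (mat_vec N A (\<phi> \<alpha>) y)"
    unfolding mat_vec_def cnj_sum
  proof (intro sum.cong refl)
    fix x assume "x \<in> {1..N}"
    from herm[OF assms(2) this] show "cnj (\<phi> \<alpha> x) * A x y = cnj (A y x * \<phi> \<alpha> x)" by simp
  qed
  thus ?thesis using eigen[OF assms] by simp
qed

lemma eigenvalue_real:
  assumes a: "\<alpha> \<in> {1..N}"
  shows "cnj (l \<alpha>) = l \<alpha>"
proof -
  have "(\<Sum>y=1..N. (\<Sum>x=1..N. cnj (\<phi> \<alpha> x) * A x y) * \<phi> \<alpha> y)
     = (\<Sum>x=1..N. cnj (\<phi> \<alpha> x) * mat_vec N A (\<phi> \<alpha>) x)"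
    unfolding mat_vec_def sum_distrib_left sum_distrib_right by (subst sum.swap) (simp add: mult_ac)
  moreover have "(\<Sum>y=1..N. (\<Sum>x=1..N. cnj (\<phi> \<alpha> x) * A x y) * \<phi> \<alpha> y)
     = cnj (l \<alpha>) * vec_inner N (\<phi> \<alpha>) (\<phi> \<alpha>)"
    unfolding vec_inner_def sum_distrib_left
    by (intro sum.cong refl) (simp only: left_eigen[OF a] mult.assoc)
  moreover have "(\<Sum>x=1..N. cnj (\<phi> \<alpha> x) * mat_vec N A (\<phi> \<alpha>) x)
     = l \<alpha> * vec_inner N (\<phi> \<alpha>) (\<phi> \<alpha>)"
    unfolding vec_inner_def sum_distrib_left
    by (intro sum.cong refl) (simp only: eigen[OF a] mult.left_commute)
  ultimately show ?thesis using orth[OF a a] by simp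
qed

lemma Im_eigenvalue: "\<alpha> \<in> {1..N} \<Longrightarrow> Im (l \<alpha>) = 0"
  using eigenvalue_real[of \<alpha>] by (simp add: complex_eq_iff)

text \<open>An approximate right inverse \<open>X\<close> of \<open>A - z\<close> with residual \<open>W\<close> satisfies
  \<open>X - (A - z)\<^sup>-\<^sup>1 = (A - z)\<^sup>-\<^sup>1 W\<close>. In the eigenbasis the rows of \<open>W\<close> are divided by
  \<open>l \<alpha> - z\<close>, which has modulus at least \<open>|Im z|\<close>.\<close>

lemma resolvent_approximation:
  assumes z: "Im z \<noteq> 0"
  shows "hs2 N (\<lambda>x w. X x w - spec_mat N \<phi> (\<lambda>\<alpha>. 1 / (l \<alpha> - z)) x w)
    \<le> hs2 N (\<lambda>x w. (\<Sum>y=1..N. A x y * X y w) - z * X x w - (if x = w then 1 else 0)) / (Im z)\<^sup>2"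
proof -
  have "(cmod (\<Sum>x=1..N. cnj (\<phi> \<alpha> x) * (X x w - spec_mat N \<phi> (\<lambda>\<alpha>. 1 / (l \<alpha> - z)) x w)))\<^sup>2
    \<le> (cmod (\<Sum>x=1..N. cnj (\<phi> \<alpha> x) *
        ((\<Sum>y=1..N. A x y * X y w) - z * X x w - (if x = w then 1 else 0))))\<^sup>2 / (Im z)\<^sup>2"
    (is "(cmod ?L)\<^sup>2 \<le> (cmod ?R)\<^sup>2 / _")
    if a: "\<alpha> \<in> {1..N}" and w: "w \<in> {1..N}" for \<alpha> w
  proof -
    define c where "c = (\<Sum>x=1..N. cnj (\<phi> \<alpha> x) * X x w)"
    have L: "?L = c - 1 / (l \<alpha> - z) * cnj (\<phi> \<alpha> w)"
      using spec_mat_coefficient[OF a]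
      by (simp add: right_diff_distrib sum_subtractf c_def)
    have 1: "(\<Sum>x=1..N. cnj (\<phi> \<alpha> x) * (\<Sum>y=1..N. A x y * X y w)) = l \<alpha> * c"
    proof -
      have "(\<Sum>x=1..N. cnj (\<phi> \<alpha> x) * (\<Sum>y=1..N. A x y * X y w))
        = (\<Sum>y=1..N. (\<Sum>x=1..N. cnj (\<phi> \<alpha> x) * A x y) * X y w)"
        unfolding sum_distrib_left sum_distrib_right by (subst sum.swap) (simp add: mult_ac)
      also have "\<dots> = (\<Sum>y=1..N. l \<alpha> * (cnj (\<phi> \<alpha> y) * X y w))"
        by (intro sum.cong refl) (simp only: left_eigen[OF a] eigenvalue_real[OF a] mult.assoc)
      finally show ?thesis by (simp add: c_def sum_distrib_left)
    qed
    have 2: "(\<Sum>x=1..N. cnj (\<phi> \<alpha> x) * (if x = w then 1 else 0)) = cnj (\<phi> \<alpha> w)"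
      using w by (simp add: if_distrib sum.delta cong: if_cong)
    have 3: "(\<Sum>x=1..N. cnj (\<phi> \<alpha> x) * (z * X x w)) = z * c"
      by (simp add: c_def sum_distrib_left mult_ac)
    have R: "?R = (l \<alpha> - z) * c - cnj (\<phi> \<alpha> w)"
      unfolding right_diff_distrib sum_subtractf 1 2 3 by (simp add: algebra_simps)
    have ne: "l \<alpha> - z \<noteq> 0" using Im_eigenvalue[OF a] z by (auto simp: complex_eq_iff)
    have factor: "u * c - k = u * (c - 1 / u * k)" if "u \<noteq> 0" for u k :: complex
      using that by (simp add: right_diff_distrib)
    have "?R = (l \<alpha> - z) * ?L" unfolding R L by (rule factor[OF ne])
    hence "cmod ?R = cmod (l \<alpha> - z) * cmod ?L" by (simp only: norm_mult)
    moreover have "\<bar>Im z\<bar> \<le> cmod (l \<alpha> - z)"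
      using abs_Im_le_cmod[of "l \<alpha> - z"] Im_eigenvalue[OF a] by simp
    ultimately have "\<bar>Im z\<bar> * cmod ?L \<le> cmod ?R"
      by (simp only: mult_right_mono[OF _ norm_ge_zero])
    hence "(\<bar>Im z\<bar> * cmod ?L)\<^sup>2 \<le> (cmod ?R)\<^sup>2" by (intro power_mono) auto
    moreover have "0 < (Im z)\<^sup>2" using z by simp
    ultimately show ?thesis
      by (subst pos_le_divide_eq) (simp_all only: power_mult_distrib power2_abs mult.commute)
  qed
  thus ?thesis unfolding hs2_coefficients sum_divide_distrib by (intro sum_mono) auto
qed

lemma imaginary_resolvent_approximation:
  assumes z: "Im z \<noteq> 0"
  shows "hs2 N (\<lambda>x w. spec_mat N \<phi> (\<lambda>\<alpha>. of_real (Im (1 / (l \<alpha> - z)))) x w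
      - (X x w - cnj (X w x)) / (2 * \<i>))
    \<le> hs2 N (\<lambda>x w. (\<Sum>y=1..N. A x y * X y w) - z * X x w - (if x = w then 1 else 0)) / (Im z)\<^sup>2"
proof -
  let ?H = "spec_mat N \<phi> (\<lambda>\<alpha>. 1 / (l \<alpha> - z))"
  have Feq: "spec_mat N \<phi> (\<lambda>\<alpha>. of_real (Im (1 / (l \<alpha> - z)))) x w = (?H x w - cnj (?H w x)) / (2 * \<i>)" for x w
    unfolding spec_mat_def cnj_sum sum_subtractf[symmetric] sum_divide_distrib
    by (intro sum.cong refl, subst cnj_diff_over_2i[symmetric])
      (simp add: algebra_simps diff_divide_distrib)
  have "(a - b) / k - (c - d) / k = - (((c - a) - (d - b)) / k)" for a b c d k :: complex
    by (simp add: diff_divide_distrib)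
  hence "spec_mat N \<phi> (\<lambda>\<alpha>. of_real (Im (1 / (l \<alpha> - z)))) x w - (X x w - cnj (X w x)) / (2 * \<i>)
     = - (((X x w - ?H x w) - cnj (X w x - ?H w x)) / (2 * \<i>))" for x w
    unfolding Feq complex_cnj_diff by blast
  hence "hs2 N (\<lambda>x w. spec_mat N \<phi> (\<lambda>\<alpha>. of_real (Im (1 / (l \<alpha> - z)))) x w - (X x w - cnj (X w x)) / (2 * \<i>))
     = hs2 N (\<lambda>x w. ((X x w - ?H x w) - cnj (X w x - ?H w x)) / (2 * \<i>))"
    by (simp only: hs2_def norm_minus_cancel)
  also have "\<dots> \<le> hs2 N (\<lambda>x w. X x w - ?H x w)" by (rule hs2_imaginary_part)
  also note resolvent_approximation[OF z]
  finally show ?thesis .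
qed

end

section \<open>Permutation representations\<close>

lemma rep_mat_support:
  assumes "finite A" "{g. f g \<noteq> 0} \<subseteq> A"
  shows "rep_mat r f x y = (\<Sum>g\<in>A. f g * perm_mat (r g) x y)"
  unfolding rep_mat_def using assms by (intro sum.mono_neutral_left) auto

definition coincidences :: "nat \<Rightarrow> ('g \<Rightarrow> nat \<Rightarrow> nat) \<Rightarrow> 'g \<Rightarrow> 'g \<Rightarrow> nat" where
  "coincidences N r g h = card {y \<in> {1..N}. r g y = r h y}"

text \<open>The trace \<open>Tr (F\<^sub>1 M\<^sup>* F\<^sub>2 M)\<close> for the matrix \<open>M(x, y) = b(y) 1(x = \<tau> y)\<close>.\<close>

definition twisted_form :: "nat \<Rightarrow> cvec \<Rightarrow> (nat \<Rightarrow> nat) \<Rightarrow> cmatrix \<Rightarrow> cmatrix \<Rightarrow> complex" where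
  "twisted_form N b \<tau> F1 F2 =
     (\<Sum>y=1..N. \<Sum>y'=1..N. b y * cnj (b y') * F1 y y' * F2 (\<tau> y') (\<tau> y))"

lemma twisted_form_diff_left:
  "twisted_form N b \<tau> (\<lambda>x y. F x y - F' x y) H = twisted_form N b \<tau> F H - twisted_form N b \<tau> F' H"
  unfolding twisted_form_def sum_subtractf[symmetric]
  by (intro sum.cong refl) (simp add: algebra_simps)

lemma twisted_form_diff_right:
  "twisted_form N b \<tau> H (\<lambda>x y. F x y - F' x y) = twisted_form N b \<tau> H F - twisted_form N b \<tau> H F'"
  unfolding twisted_form_def sum_subtractf[symmetric]
  by (intro sum.cong refl) (simp add: algebra_simps)

text \<open>Only the Hilbert-Schmidt norms of the two matrices enter, so that each may be replaced by an
  approximation that is close to it in that norm alone.\<close>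

lemma twisted_form_bound:
  assumes \<tau>: "\<tau> permutes {1..N}" and b: "\<And>y. y \<in> {1..N} \<Longrightarrow> cmod (b y) \<le> \<beta>"
  shows "cmod (twisted_form N b \<tau> F1 F2) \<le> \<beta>\<^sup>2 * (sqrt (hs2 N F1) * sqrt (hs2 N F2))"
proof -
  let ?I = "{1..N} \<times> {1..N}"
  have "cmod (twisted_form N b \<tau> F1 F2)
     \<le> (\<Sum>(y, y')\<in>?I. cmod (b y * cnj (b y') * F1 y y' * F2 (\<tau> y') (\<tau> y)))"
    unfolding twisted_form_def sum.cartesian_product
    by (rule order_trans[OF norm_sum]) (simp add: split_def)
  also have "\<dots> \<le> (\<Sum>(y, y')\<in>?I. \<beta>\<^sup>2 * (cmod (F1 y y') * cmod (F2 (\<tau> y') (\<tau> y))))"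
  proof (rule sum_mono, clarify)
    fix y y' assume "y \<in> {1..N}" "y' \<in> {1..N}"
    hence "cmod (b y) * cmod (b y') \<le> \<beta> * \<beta>"
      using b[of y] b[of y'] by (intro mult_mono) (auto intro: order_trans[OF norm_ge_zero])
    thus "cmod (b y * cnj (b y') * F1 y y' * F2 (\<tau> y') (\<tau> y))
        \<le> \<beta>\<^sup>2 * (cmod (F1 y y') * cmod (F2 (\<tau> y') (\<tau> y)))"
      unfolding norm_mult power2_eq_square mult.assoc[symmetric] complex_mod_cnj
      by (intro mult_right_mono) auto
  qed
  also have "\<dots> = \<beta>\<^sup>2 * (\<Sum>p\<in>?I. \<bar>cmod (F1 (fst p) (snd p))\<bar> * \<bar>cmod (F2 (\<tau> (snd p)) (\<tau> (fst p)))\<bar>)"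
    by (simp add: sum_distrib_left split_def)
  also have "\<dots> \<le> \<beta>\<^sup>2 * (L2_set (\<lambda>p. cmod (F1 (fst p) (snd p))) ?I
      * L2_set (\<lambda>p. cmod (F2 (\<tau> (snd p)) (\<tau> (fst p)))) ?I)"
    by (intro mult_left_mono L2_set_mult_ineq) simp
  also have "L2_set (\<lambda>p. cmod (F1 (fst p) (snd p))) ?I = sqrt (hs2 N F1)"
    by (simp add: L2_set_def hs2_prod split_def)
  also have "L2_set (\<lambda>p. cmod (F2 (\<tau> (snd p)) (\<tau> (fst p)))) ?I = sqrt (hs2 N F2)"
  proof -
    have "(\<Sum>y=1..N. \<Sum>y'=1..N. (cmod (F2 (\<tau> y') (\<tau> y)))\<^sup>2)
        = (\<Sum>y=1..N. \<Sum>y'=1..N. (cmod (F2 y' (\<tau> y)))\<^sup>2)"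
    proof (rule sum.cong[OF refl])
      fix y
      show "(\<Sum>y'=1..N. (cmod (F2 (\<tau> y') (\<tau> y)))\<^sup>2) = (\<Sum>y'=1..N. (cmod (F2 y' (\<tau> y)))\<^sup>2)"
        using sum.permute[OF \<tau>, of "\<lambda>y'. (cmod (F2 y' (\<tau> y)))\<^sup>2"] by (simp only: o_def)
    qed
    also have "\<dots> = (\<Sum>y=1..N. \<Sum>y'=1..N. (cmod (F2 y' y))\<^sup>2)"
      using sum.permute[OF \<tau>, of "\<lambda>y. \<Sum>y'=1..N. (cmod (F2 y' y))\<^sup>2"] by (simp add: o_def)
    also have "\<dots> = hs2 N F2" unfolding hs2_def by (rule sum.swap)
    finally have "(\<Sum>p\<in>?I. (cmod (F2 (\<tau> (snd p)) (\<tau> (fst p))))\<^sup>2) = hs2 N F2"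
      by (simp add: sum.cartesian_product split_def)
    thus ?thesis by (simp add: L2_set_def)
  qed
  finally show ?thesis .
qed

locale perm_rep = group G for G :: "('g, 'b) monoid_scheme" (structure) +
  fixes N :: nat and r :: "'g \<Rightarrow> nat \<Rightarrow> nat"
  assumes r_hom: "r \<in> hom G (sym_group N)"
begin

lemma r_permutes: "g \<in> carrier G \<Longrightarrow> r g permutes {1..N}"
  using hom_in_carrier[OF r_hom] by (simp add: sym_group_carrier)

lemma r_mem: "g \<in> carrier G \<Longrightarrow> y \<in> {1..N} \<Longrightarrow> r g y \<in> {1..N}"
  using permutes_in_image[OF r_permutes] by blast

lemma r_mult: "g \<in> carrier G \<Longrightarrow> h \<in> carrier G \<Longrightarrow> r (g \<otimes> h) y = r g (r h y)"
  using hom_mult[OF r_hom] by (simp add: sym_group_mult)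

lemma r_one: "r \<one> y = y"
  using hom_one[OF r_hom group_axioms sym_group_is_group] by (simp add: sym_group_one)

lemma r_inv: "g \<in> carrier G \<Longrightarrow> r (inv g) (r g y) = y" "g \<in> carrier G \<Longrightarrow> r g (r (inv g) y) = y"
  using r_mult[of "inv g" g y] r_mult[of g "inv g" y] by (simp_all add: r_one)

lemma r_eq_iff: "g \<in> carrier G \<Longrightarrow> x = r g y \<longleftrightarrow> y = r (inv g) x"
  using r_inv by metis

lemma coincidences_eq_fixed_points:
  assumes "g \<in> carrier G" "h \<in> carrier G"
  shows "complex_of_real (coincidences N r g h) = mat_trace N (perm_mat (r (inv h \<otimes> g)))"
proof -
  have "{y \<in> {1..N}. r g y = r h y} = {y \<in> {1..N}. y = r (inv h \<otimes> g) y}"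
    using assms r_eq_iff[of h "r g _"] by (auto simp: r_mult)
  thus ?thesis
    by (simp add: coincidences_def mat_trace_def perm_mat_def sum.If_cases Int_def)
qed

lemma hs2_rep_mat:
  assumes A: "finite A" "A \<subseteq> carrier G" "{g. f g \<noteq> 0} \<subseteq> A"
  shows "complex_of_real (hs2 N (rep_mat r f))
    = (\<Sum>g\<in>A. \<Sum>h\<in>A. f g * cnj (f h) * of_real (coincidences N r g h))"
proof -
  have "complex_of_real (hs2 N (rep_mat r f)) = (\<Sum>x=1..N. \<Sum>y=1..N. \<Sum>g\<in>A. \<Sum>h\<in>A.
      f g * cnj (f h) * (perm_mat (r g) x y * perm_mat (r h) x y))"
    unfolding hs2_def of_real_sum rep_mat_support[OF A(1,3)] cmod_sq_sum_eq
    by (intro sum.cong refl) (auto simp: perm_mat_def)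
  also have "\<dots> = (\<Sum>g\<in>A. \<Sum>h\<in>A. \<Sum>x=1..N. \<Sum>y=1..N.
      f g * cnj (f h) * (perm_mat (r g) x y * perm_mat (r h) x y))"
    by (rule sum_swap_pairs)
  also have "\<dots> = (\<Sum>g\<in>A. \<Sum>h\<in>A. f g * cnj (f h) * of_real (coincidences N r g h))"
  proof (intro sum.cong refl)
    fix g h assume g: "g \<in> A"
    have "(\<Sum>x=1..N. perm_mat (r g) x y * perm_mat (r h) x y) = (if r g y = r h y then 1 else 0)"
      if "y \<in> {1..N}" for y
    proof -
      have "(\<Sum>x=1..N. perm_mat (r g) x y * perm_mat (r h) x y)
          = (\<Sum>x=1..N. if x = r g y then (if r g y = r h y then 1 else 0) else 0)"
        by (intro sum.cong refl) (auto simp: perm_mat_def)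
      thus ?thesis using r_mem[of g y] that g A(2) by (simp add: sum.delta subset_iff)
    qed
    hence "(\<Sum>y=1..N. \<Sum>x=1..N. perm_mat (r g) x y * perm_mat (r h) x y)
        = (\<Sum>y=1..N. if r g y = r h y then 1 else 0)" by (intro sum.cong refl)
    also have "\<dots> = of_real (coincidences N r g h)" by (simp add: coincidences_def sum.If_cases Int_def)
    finally show "(\<Sum>x=1..N. \<Sum>y=1..N. f g * cnj (f h) * (perm_mat (r g) x y * perm_mat (r h) x y))
        = f g * cnj (f h) * of_real (coincidences N r g h)"
      by (subst sum.swap) (simp only: flip: sum_distrib_left)
  qed
  finally show ?thesis .
qed

lemma rep_mat_adjoint:
  assumes A: "finite A" "A \<subseteq> carrier G" "{g. f g \<noteq> 0} \<subseteq> A" "(\<lambda>g. inv g) ` A = A"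
  shows "cnj (rep_mat r f y x) = (\<Sum>g\<in>A. cnj (f (inv g)) * perm_mat (r g) x y)"
proof -
  have c: "g \<in> carrier G" if "g \<in> A" for g using A(2) that by auto
  have "cnj (rep_mat r f y x) = (\<Sum>g\<in>A. cnj (f g) * perm_mat (r (inv g)) x y)"
    unfolding rep_mat_support[OF A(1,3)] cnj_sum
  proof (intro sum.cong refl)
    fix g assume "g \<in> A"
    hence "y = r g x \<longleftrightarrow> x = r (inv g) y" by (intro r_eq_iff c)
    thus "cnj (f g * perm_mat (r g) y x) = cnj (f g) * perm_mat (r (inv g)) x y"
      by (simp add: perm_mat_def)
  qed
  also have "\<dots> = (\<Sum>g\<in>A. cnj (f (inv g)) * perm_mat (r g) x y)"
    by (rule sum.reindex_bij_witness[of _ "\<lambda>g. inv g" "\<lambda>g. inv g"]) (use c A(4) in auto)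
  finally show ?thesis .
qed

text \<open>The condition \<open>t y = h t g y\<close> holds for all \<open>y\<close> if \<open>h = t g\<^sup>-\<^sup>1 t\<^sup>-\<^sup>1\<close>; otherwise, under convergence to
  the regular representation, it holds for few \<open>y\<close>. In the first case the inner sum is a correlation of \<open>b\<close>.\<close>

lemma twisted_form_rep_mat:
  assumes A: "finite A" "A \<subseteq> carrier G" "{g. f g \<noteq> 0} \<subseteq> A"
    and B: "finite B" "B \<subseteq> carrier G" "{g. k g \<noteq> 0} \<subseteq> B"
    and t: "t \<in> carrier G"
  shows "twisted_form N b (r t) (rep_mat r f) (rep_mat r k)
    = (\<Sum>g\<in>A. \<Sum>h\<in>B. f g * k h *
        (\<Sum>y=1..N. if r t y = r (h \<otimes> t \<otimes> g) y then b (r g y) * cnj (b y) else 0))"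
proof -
  let ?t = "\<lambda>y y' g h. f g * k h * (b y * cnj (b y') *
      (perm_mat (r g) y y' * perm_mat (r h) (r t y') (r t y)))"
  have "twisted_form N b (r t) (rep_mat r f) (rep_mat r k)
    = (\<Sum>y=1..N. \<Sum>y'=1..N. \<Sum>g\<in>A. \<Sum>h\<in>B. ?t y y' g h)"
    unfolding twisted_form_def
  proof (intro sum.cong refl)
    fix y y'
    have "b y * cnj (b y') * rep_mat r f y y' * rep_mat r k (r t y') (r t y)
       = b y * cnj (b y') * (rep_mat r f y y' * rep_mat r k (r t y') (r t y))"
      by (simp only: mult.assoc)
    also have "\<dots> = b y * cnj (b y') * (\<Sum>g\<in>A. \<Sum>h\<in>B. (f g * perm_mat (r g) y y') *
        (k h * perm_mat (r h) (r t y') (r t y)))"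
      unfolding rep_mat_support[OF A(1,3)] rep_mat_support[OF B(1,3)] sum_product ..
    also have "\<dots> = (\<Sum>g\<in>A. \<Sum>h\<in>B. ?t y y' g h)"
      unfolding sum_distrib_left by (intro sum.cong refl) (simp only: mult_ac)
    finally show "b y * cnj (b y') * rep_mat r f y y' * rep_mat r k (r t y') (r t y)
       = (\<Sum>g\<in>A. \<Sum>h\<in>B. ?t y y' g h)" .
  qed
  also have "\<dots> = (\<Sum>g\<in>A. \<Sum>h\<in>B. \<Sum>y=1..N. \<Sum>y'=1..N. ?t y y' g h)"
    by (rule sum_swap_pairs)
  also have "\<dots> = (\<Sum>g\<in>A. \<Sum>h\<in>B. f g * k h *
        (\<Sum>y=1..N. if r t y = r (h \<otimes> t \<otimes> g) y then b (r g y) * cnj (b y) else 0))"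
  proof (intro sum.cong refl)
    fix g h assume g: "g \<in> A" and h: "h \<in> B"
    have g': "g \<in> carrier G" and h': "h \<in> carrier G" using A B g h by auto
    have "(\<Sum>y=1..N. b y * cnj (b y') * (perm_mat (r g) y y' * perm_mat (r h) (r t y') (r t y)))
       = (if r t y' = r (h \<otimes> t \<otimes> g) y' then b (r g y') * cnj (b y') else 0)"
      if "y' \<in> {1..N}" for y'
    proof -
      have "(\<Sum>y=1..N. b y * cnj (b y') * (perm_mat (r g) y y' * perm_mat (r h) (r t y') (r t y)))
        = (\<Sum>y=1..N. if y = r g y' then
            (if r t y' = r (h \<otimes> t \<otimes> g) y' then b (r g y') * cnj (b y') else 0) else 0)"
        using g' h' t by (intro sum.cong refl) (auto simp: perm_mat_def r_mult)
      thus ?thesis using r_mem[OF g' that] by (simp add: sum.delta)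
    qed
    hence "(\<Sum>y'=1..N. \<Sum>y=1..N. b y * cnj (b y') * (perm_mat (r g) y y' * perm_mat (r h) (r t y') (r t y)))
      = (\<Sum>y'=1..N. if r t y' = r (h \<otimes> t \<otimes> g) y' then b (r g y') * cnj (b y') else 0)"
      by (intro sum.cong refl)
    thus "(\<Sum>y=1..N. \<Sum>y'=1..N. ?t y y' g h) = f g * k h *
      (\<Sum>y=1..N. if r t y = r (h \<otimes> t \<otimes> g) y then b (r g y) * cnj (b y) else 0)"
      by (subst sum.swap) (simp only: flip: sum_distrib_left)
  qed
  finally show ?thesis .
qed

end

locale hermitian_rep = hermitian_element G p + perm_rep G N r
  for G :: "('g, 'b) monoid_scheme" (structure) and p N r
begin

lemma rep_mat_hermitian: "rep_mat r p x y = cnj (rep_mat r p y x)"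
proof -
  have 0: "{g. p g \<noteq> 0} \<subseteq> supp" by (simp add: supp_def)
  have "cnj (rep_mat r p y x) = (\<Sum>g\<in>supp. cnj (p (inv g)) * perm_mat (r g) x y)"
    by (rule rep_mat_adjoint[OF finite_supp supp_carrier 0 supp_inv])
  also have "\<dots> = rep_mat r p x y"
    unfolding rep_mat_support[OF finite_supp 0]
    using supp_carrier by (intro sum.cong refl) (auto simp: p_inv)
  finally show ?thesis by simp
qed

text \<open>The representation turns the convolution product of the group algebra into the matrix product.\<close>

lemma rep_mat_Pz:
  assumes F: "finite F" "F \<subseteq> carrier G" "\<one> \<in> F" "{g. f g \<noteq> 0} \<subseteq> F"
    and x: "x \<in> {1..N}" and w: "w \<in> {1..N}"
  shows "(\<Sum>y=1..N. rep_mat r p x y * rep_mat r f y w) - z * rep_mat r f x w - (if x = w then 1 else 0)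
    = rep_mat r (\<lambda>g. Pz z f g - delta \<one> g) x w"
proof -
  define A where "A = F \<union> (\<lambda>(a, g). a \<otimes> g) ` (supp \<times> F)"
  note A = Pz_support[OF F, folded A_def]
  have FA: "F \<subseteq> A" by (auto simp: A_def)
  have "rep_mat r (\<lambda>g. Pz z f g - delta \<one> g) x w
    = (\<Sum>g\<in>A. P f g * perm_mat (r g) x w) - z * (\<Sum>g\<in>A. f g * perm_mat (r g) x w)
      - (\<Sum>g\<in>A. delta \<one> g * perm_mat (r g) x w)"
    unfolding rep_mat_support[OF A(1,3)]
    by (simp only: left_diff_distrib sum_subtractf sum_distrib_left mult.assoc)
  also have "(\<Sum>g\<in>A. f g * perm_mat (r g) x w) = rep_mat r f x w"
    using F(4) FA by (intro rep_mat_support[symmetric] A(1)) auto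
  also have "(\<Sum>g\<in>A. delta \<one> g * perm_mat (r g) x w) = (if x = w then 1 else 0)"
  proof -
    have "(\<Sum>g\<in>A. delta \<one> g * perm_mat (r g) x w) = (\<Sum>g\<in>A. if g = \<one> then perm_mat (r \<one>) x w else 0)"
      by (intro sum.cong refl) (auto simp: delta_def)
    also have "\<dots> = perm_mat (r \<one>) x w" using FA F(3) A(1) by (auto simp: sum.delta)
    finally show ?thesis by (simp add: perm_mat_def r_one)
  qed
  also have "(\<Sum>g\<in>A. P f g * perm_mat (r g) x w) = (\<Sum>y=1..N. rep_mat r p x y * rep_mat r f y w)"
  proof -
    have "(\<Sum>g\<in>A. P f g * perm_mat (r g) x w)
      = (\<Sum>a\<in>supp. \<Sum>g\<in>A. p a * (left_regular G a f g * perm_mat (r g) x w))"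
      unfolding P_apply sum_distrib_right by (subst sum.swap) (simp only: mult.assoc)
    also have "\<dots> = (\<Sum>a\<in>supp. \<Sum>b\<in>F. p a * (f b * perm_mat (r (a \<otimes> b)) x w))"
    proof (rule sum.cong[OF refl])
      fix a assume a: "a \<in> supp"
      have a': "a \<in> carrier G" using a supp_carrier by auto
      have inj: "inj_on (\<lambda>b. a \<otimes> b) F" using a' F(2) by (intro inj_onI) (auto simp: subset_iff)
      have "(\<Sum>b\<in>F. p a * (f b * perm_mat (r (a \<otimes> b)) x w))
        = (\<Sum>b\<in>F. p a * (left_regular G a f (a \<otimes> b) * perm_mat (r (a \<otimes> b)) x w))"
      proof (intro sum.cong refl)
        fix b assume "b \<in> F"
        hence "b \<in> carrier G" using F(2) by auto
        thus "p a * (f b * perm_mat (r (a \<otimes> b)) x w)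
          = p a * (left_regular G a f (a \<otimes> b) * perm_mat (r (a \<otimes> b)) x w)"
          using a' by (simp add: left_regular_def m_assoc[symmetric])
      qed
      also have "\<dots> = (\<Sum>g\<in>(\<lambda>b. a \<otimes> b) ` F. p a * (left_regular G a f g * perm_mat (r g) x w))"
        by (subst sum.reindex[OF inj]) simp
      also have "\<dots> = (\<Sum>g\<in>A. p a * (left_regular G a f g * perm_mat (r g) x w))"
      proof (rule sum.mono_neutral_left[OF A(1)])
        show "(\<lambda>b. a \<otimes> b) ` F \<subseteq> A" using a by (auto simp: A_def)
        show "\<forall>g\<in>A - (\<lambda>b. a \<otimes> b) ` F. p a * (left_regular G a f g * perm_mat (r g) x w) = 0"
        proof
          fix g assume g: "g \<in> A - (\<lambda>b. a \<otimes> b) ` F"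
          have gc: "g \<in> carrier G" using g subsetD[OF A(2)] by blast
          have "g = a \<otimes> (inv a \<otimes> g)" using a' gc by (simp add: m_assoc[symmetric])
          hence "inv a \<otimes> g \<notin> F" using g by blast
          hence "f (inv a \<otimes> g) = 0" using F(4) by blast
          thus "p a * (left_regular G a f g * perm_mat (r g) x w) = 0"
            by (simp add: left_regular_def)
        qed
      qed
      finally show "(\<Sum>g\<in>A. p a * (left_regular G a f g * perm_mat (r g) x w))
        = (\<Sum>b\<in>F. p a * (f b * perm_mat (r (a \<otimes> b)) x w))" by simp
    qed
    also have "\<dots> = (\<Sum>a\<in>supp. \<Sum>b\<in>F. \<Sum>y=1..N. (p a * perm_mat (r a) x y) * (f b * perm_mat (r b) y w))"
    proof (intro sum.cong refl)
      fix a b assume "a \<in> supp" "b \<in> F"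
      hence ab: "a \<in> carrier G" "b \<in> carrier G" using supp_carrier F(2) by auto
      have "(\<Sum>y=1..N. (p a * perm_mat (r a) x y) * (f b * perm_mat (r b) y w))
        = (\<Sum>y=1..N. if y = r b w then p a * (f b * perm_mat (r (a \<otimes> b)) x w) else 0)"
        using ab by (intro sum.cong refl) (auto simp: perm_mat_def r_mult)
      also have "\<dots> = p a * (f b * perm_mat (r (a \<otimes> b)) x w)"
        using r_mem[OF ab(2) w] by (simp add: sum.delta)
      finally show "p a * (f b * perm_mat (r (a \<otimes> b)) x w)
        = (\<Sum>y=1..N. (p a * perm_mat (r a) x y) * (f b * perm_mat (r b) y w))" by simp
    qed
    also have "\<dots> = (\<Sum>y=1..N. \<Sum>a\<in>supp. \<Sum>b\<in>F. (p a * perm_mat (r a) x y) * (f b * perm_mat (r b) y w))"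
      by (rule sum_swap_third[symmetric])
    also have "\<dots> = (\<Sum>y=1..N. rep_mat r p x y * rep_mat r f y w)"
    proof (intro sum.cong refl)
      fix y
      have 0: "{g. p g \<noteq> 0} \<subseteq> supp" by (simp add: supp_def)
      show "(\<Sum>a\<in>supp. \<Sum>b\<in>F. (p a * perm_mat (r a) x y) * (f b * perm_mat (r b) y w))
        = rep_mat r p x y * rep_mat r f y w"
        unfolding rep_mat_support[OF finite_supp 0] rep_mat_support[OF F(1,4)] sum_product ..
    qed
    finally show ?thesis .
  qed
  finally show ?thesis by simp
qed

lemma imaginary_part_rep_mat:
  assumes F: "finite F" "F \<subseteq> carrier G" "(\<lambda>g. inv g) ` F = F"
  shows "(rep_mat r (\<lambda>g. if g \<in> F then h g else 0) x w
      - cnj (rep_mat r (\<lambda>g. if g \<in> F then h g else 0) w x)) / (2 * \<i>)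
    = rep_mat r (\<lambda>g. if g \<in> F then Im_kernel h g else 0) x w"
proof -
  let ?h = "\<lambda>g. if g \<in> F then h g else 0"
  have i: "inv g \<in> F" if "g \<in> F" for g using F(3) that by blast
  have "rep_mat r ?h x w - cnj (rep_mat r ?h w x)
    = (\<Sum>g\<in>F. ?h g * perm_mat (r g) x w) - (\<Sum>g\<in>F. cnj (?h (inv g)) * perm_mat (r g) x w)"
  proof (rule arg_cong2[where f = "(-)"])
    show "rep_mat r ?h x w = (\<Sum>g\<in>F. ?h g * perm_mat (r g) x w)"
      using F by (intro rep_mat_support) auto
    show "cnj (rep_mat r ?h w x) = (\<Sum>g\<in>F. cnj (?h (inv g)) * perm_mat (r g) x w)"
      using F by (intro rep_mat_adjoint) auto
  qed
  hence "(rep_mat r ?h x w - cnj (rep_mat r ?h w x)) / (2 * \<i>)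
    = (\<Sum>g\<in>F. (?h g - cnj (?h (inv g))) / (2 * \<i>) * perm_mat (r g) x w)"
    by (simp only: sum_subtractf[symmetric] sum_divide_distrib left_diff_distrib[symmetric]
        times_divide_eq_left)
  also have "\<dots> = (\<Sum>g\<in>F. (if g \<in> F then Im_kernel h g else 0) * perm_mat (r g) x w)"
    using F(2) i by (intro sum.cong refl) (auto simp: Im_kernel_def)
  also have "\<dots> = rep_mat r (\<lambda>g. if g \<in> F then Im_kernel h g else 0) x w"
    using F(1) by (intro rep_mat_support[symmetric]) auto
  finally show ?thesis .
qed

end

section \<open>Limits along the sequence of representations\<close>

lemma eventually_along_iff: "eventually Q (along D) \<longleftrightarrow> (\<forall>\<^sub>F N in at_top. N \<in> D \<longrightarrow> Q N)"
  by (simp add: along_def eventually_inf_principal)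

lemma eventually_in_D: "eventually (\<lambda>N. N \<in> D) (along D)"
  by (simp add: eventually_along_iff)

lemma along_neq_bot: 
  assumes "infinite D"
  shows "along D \<noteq> bot"
proof
  assume "along D = bot"
  hence "eventually (\<lambda>N. False) (along D)" by simp
  hence "\<forall>\<^sub>F N in at_top. N \<notin> D" by (simp add: eventually_along_iff)
  then obtain n where "\<forall>N\<ge>n. N \<notin> D" unfolding eventually_at_top_linorder by blast
  hence "D \<subseteq> {..<n}" by (meson lessThan_iff not_le subsetI)
  thus False using assms finite_subset by blast
qed

locale perm_seq = group G for G :: "('g, 'b) monoid_scheme" (structure) +
  fixes D :: "nat set" and \<rho> :: "nat \<Rightarrow> 'g \<Rightarrow> nat \<Rightarrow> nat"
  assumes D_inf: "infinite D" and D_pos: "0 \<notin> D"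
    and \<rho>_hom: "\<And>N. N \<in> D \<Longrightarrow> \<rho> N \<in> hom G (sym_group N)"
    and \<rho>_conv: "converges_to_regular G D \<rho>"
begin

lemma perm_repI: "N \<in> D \<Longrightarrow> perm_rep G N (\<rho> N)"
  using \<rho>_hom by (simp add: perm_rep_def perm_rep_axioms_def group_axioms)

lemma N_pos: "N \<in> D \<Longrightarrow> 0 < N" using D_pos by (cases "N = 0") auto

text \<open>Two elements agree at a point precisely when \<open>h\<^sup>-\<^sup>1 g\<close> fixes it, and the proportion of fixed
  points is a normalised trace.\<close>

lemma coincidences_limit:
  assumes g: "g \<in> carrier G" and h: "h \<in> carrier G"
  shows "((\<lambda>N. real (coincidences N (\<rho> N) g h) / real N) \<longlongrightarrow> (if g = h then 1 else 0)) (along D)"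
proof (cases "g = h")
  case True
  have "eventually (\<lambda>N. real (coincidences N (\<rho> N) g h) / real N = 1) (along D)"
    using eventually_in_D
  proof eventually_elim
    case (elim N)
    have "{y \<in> {1..N}. \<rho> N g y = \<rho> N h y} = {1..N}" using True by auto
    hence "coincidences N (\<rho> N) g h = N" unfolding coincidences_def by simp
    thus ?case using N_pos[OF elim] by simp
  qed
  thus ?thesis using True by (simp add: tendsto_eventually)
next
  case False
  have "inv h \<otimes> g \<noteq> \<one>" using g h False by (metis inv_closed inv_equality inv_inv l_inv inv_unique' m_closed)
  hence "inv h \<otimes> g \<in> carrier G - {\<one>}" using g h by simp
  hence "((\<lambda>N. mat_trace N (perm_mat (\<rho> N (inv h \<otimes> g))) / of_nat N) \<longlongrightarrow> 0) (along D)"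
    using \<rho>_conv by (simp add: converges_to_regular_def)
  hence "((\<lambda>N. cmod (mat_trace N (perm_mat (\<rho> N (inv h \<otimes> g))) / of_nat N)) \<longlongrightarrow> 0) (along D)"
    by (rule tendsto_norm_zero)
  moreover have "eventually (\<lambda>N. cmod (mat_trace N (perm_mat (\<rho> N (inv h \<otimes> g))) / of_nat N)
      = real (coincidences N (\<rho> N) g h) / real N) (along D)"
    using eventually_in_D
  proof eventually_elim
    case (elim N)
    interpret perm_rep G N "\<rho> N" by (rule perm_repI[OF elim])
    show ?case by (simp add: coincidences_eq_fixed_points[OF g h, symmetric] norm_divide)
  qed
  ultimately show ?thesis using False by (simp add: tendsto_cong)
qed

text \<open>Asymptotically, the translates by distinct group elements are orthogonal, so the normalised
  Hilbert-Schmidt norm converges to the norm in \<open>\<ell>\<^sup>2\<close> of the group.\<close>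

lemma hs2_limit:
  assumes A: "finite A" "A \<subseteq> carrier G" "{g. f g \<noteq> 0} \<subseteq> A"
  shows "((\<lambda>N. hs2 N (rep_mat (\<rho> N) f) / real N) \<longlongrightarrow> (\<Sum>g\<in>A. (cmod (f g))\<^sup>2)) (along D)"
proof -
  have c: "g \<in> carrier G" if "g \<in> A" for g using that A(2) by auto
  have "((\<lambda>N. \<Sum>g\<in>A. \<Sum>h\<in>A. f g * cnj (f h) * complex_of_real (real (coincidences N (\<rho> N) g h) / real N))
     \<longlongrightarrow> (\<Sum>g\<in>A. \<Sum>h\<in>A. f g * cnj (f h) * complex_of_real (if g = h then 1 else 0))) (along D)"
    by (intro tendsto_sum tendsto_mult tendsto_const tendsto_of_real coincidences_limit c)
  also have "(\<Sum>g\<in>A. \<Sum>h\<in>A. f g * cnj (f h) * complex_of_real (if g = h then 1 else 0))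
     = (\<Sum>g\<in>A. complex_of_real ((cmod (f g))\<^sup>2))"
  proof (rule sum.cong[OF refl])
    fix g assume "g \<in> A"
    have "(\<Sum>h\<in>A. f g * cnj (f h) * complex_of_real (if g = h then 1 else 0))
      = (\<Sum>h\<in>A. if g = h then f g * cnj (f g) else 0)" by (intro sum.cong refl) auto
    also have "\<dots> = complex_of_real ((cmod (f g))\<^sup>2)"
      using \<open>g \<in> A\<close> A(1) by (simp only: complex_norm_square) simp
    finally show "(\<Sum>h\<in>A. f g * cnj (f h) * complex_of_real (if g = h then 1 else 0))
      = complex_of_real ((cmod (f g))\<^sup>2)" .
  qed
  finally have "((\<lambda>N. Re (\<Sum>g\<in>A. \<Sum>h\<in>A. f g * cnj (f h) * complex_of_real (real (coincidences N (\<rho> N) g h) / real N)))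
     \<longlongrightarrow> Re (\<Sum>g\<in>A. complex_of_real ((cmod (f g))\<^sup>2))) (along D)" by (rule tendsto_Re)
  moreover have "eventually (\<lambda>N. Re (\<Sum>g\<in>A. \<Sum>h\<in>A. f g * cnj (f h) *
      complex_of_real (real (coincidences N (\<rho> N) g h) / real N)) = hs2 N (rep_mat (\<rho> N) f) / real N) (along D)"
    using eventually_in_D
  proof eventually_elim
    case (elim N)
    interpret perm_rep G N "\<rho> N" by (rule perm_repI[OF elim])
    have "complex_of_real (hs2 N (rep_mat (\<rho> N) f) / real N)
      = (\<Sum>g\<in>A. \<Sum>h\<in>A. f g * cnj (f h) * complex_of_real (real (coincidences N (\<rho> N) g h) / real N))"
      by (simp add: hs2_rep_mat[OF A] sum_divide_distrib)
    thus ?case by (metis Re_complex_of_real)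
  qed
  ultimately show ?thesis by (simp add: tendsto_cong)
qed

lemma trace_limit:
  assumes A: "finite A" "A \<subseteq> carrier G" "{g. f g \<noteq> 0} \<subseteq> A" and one: "\<one> \<in> A"
  shows "((\<lambda>N. (\<Sum>x=1..N. rep_mat (\<rho> N) f x x) / of_nat N) \<longlongrightarrow> f \<one>) (along D)"
proof -
  have c: "g \<in> carrier G" if "g \<in> A" for g using that A(2) by auto
  have "((\<lambda>N. \<Sum>g\<in>A. f g * complex_of_real (real (coincidences N (\<rho> N) g \<one>) / real N))
     \<longlongrightarrow> (\<Sum>g\<in>A. f g * complex_of_real (if g = \<one> then 1 else 0))) (along D)"
    by (intro tendsto_sum tendsto_mult tendsto_const tendsto_of_real coincidences_limit c one_closed)
  also have "(\<Sum>g\<in>A. f g * complex_of_real (if g = \<one> then 1 else 0)) = f \<one>"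
    using A(1) one by (simp add: if_distrib cong: if_cong)
  finally have *: "((\<lambda>N. \<Sum>g\<in>A. f g * complex_of_real (real (coincidences N (\<rho> N) g \<one>) / real N)) \<longlongrightarrow> f \<one>) (along D)" .
  have "eventually (\<lambda>N. (\<Sum>g\<in>A. f g * complex_of_real (real (coincidences N (\<rho> N) g \<one>) / real N))
      = (\<Sum>x=1..N. rep_mat (\<rho> N) f x x) / of_nat N) (along D)"
    using eventually_in_D
  proof eventually_elim
    case (elim N)
    interpret perm_rep G N "\<rho> N" by (rule perm_repI[OF elim])
    have "(\<Sum>x=1..N. rep_mat (\<rho> N) f x x) = (\<Sum>g\<in>A. f g * mat_trace N (perm_mat (\<rho> N g)))"
      unfolding rep_mat_support[OF A(1,3)] mat_trace_def sum_distrib_left by (rule sum.swap)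
    also have "\<dots> = (\<Sum>g\<in>A. f g * complex_of_real (coincidences N (\<rho> N) g \<one>))"
    proof (rule sum.cong[OF refl])
      fix g assume "g \<in> A"
      hence "g \<in> carrier G" by (rule c)
      thus "f g * mat_trace N (perm_mat (\<rho> N g)) = f g * complex_of_real (coincidences N (\<rho> N) g \<one>)"
        using coincidences_eq_fixed_points[of g \<one>] by simp
    qed
    finally show ?case by (simp add: sum_divide_distrib)
  qed
  with * show ?thesis by (simp add: tendsto_cong)
qed

end

section \<open>Spectral approximation by the group algebra\<close>

lemma Im_inverse_real_shift:
  assumes "Im w = 0"
  shows "Im (1 / (w - Complex E s)) = s / ((Re w - E)\<^sup>2 + s\<^sup>2)"
  using assms by (simp add: Im_divide power2_eq_square)

locale quantum_seq = hermitian_element G p + perm_seq G D \<rho>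
  for G :: "('g, 'b) monoid_scheme" (structure) and p D \<rho> +
  fixes \<phi> :: "nat \<Rightarrow> nat \<Rightarrow> cvec" and l :: "nat \<Rightarrow> nat \<Rightarrow> complex"
  assumes basis: "\<And>N. N \<in> D \<Longrightarrow> orthonormal_eigenbasis N (rep_mat (\<rho> N) p) (\<phi> N) (l N)"
begin

lemma hermitian_repI: "N \<in> D \<Longrightarrow> hermitian_rep G p N (\<rho> N)"
  using perm_repI by (simp add: hermitian_rep_def hermitian_element_axioms)

lemma eigenbasisI:
  assumes "N \<in> D"
  shows "hermitian_eigenbasis N (\<phi> N) (rep_mat (\<rho> N) p) (l N)"
proof -
  interpret hermitian_rep G p N "\<rho> N" by (rule hermitian_repI[OF assms])
  show ?thesis
  proof
    show "rep_mat (\<rho> N) p x y = cnj (rep_mat (\<rho> N) p y x)" for x y by (rule rep_mat_hermitian)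
  qed (use basis[OF assms] in \<open>auto simp: orthonormal_eigenbasis_def\<close>)
qed

abbreviation Im_res :: "complex \<Rightarrow> nat \<Rightarrow> cmatrix" where
  "Im_res z N \<equiv> spec_mat N (\<phi> N) (\<lambda>\<alpha>. of_real (Im (1 / (l N \<alpha> - z))))"

abbreviation cut_kernel :: "'g set \<Rightarrow> ('g \<Rightarrow> complex) \<Rightarrow> 'g \<Rightarrow> complex" where
  "cut_kernel F h \<equiv> (\<lambda>g. if g \<in> F then Im_kernel h g else 0)"

text \<open>This transfers information from the group to finite \<open>N\<close>: at a fixed height the
  imaginary part of the finite resolvent is, up to a small normalised Hilbert-Schmidt error, a local matrix
  with the same kernel as on the group.\<close>

lemma local_approximation:
  assumes h: "h \<in> ell2 G" and eq: "Pz z h = delta \<one>" and z: "Im z > 0" and e: "\<epsilon> > 0"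
  obtains F where "finite F" "F \<subseteq> carrier G" "\<one> \<in> F"
    "eventually (\<lambda>N. hs2 N (\<lambda>x y. Im_res z N x y - rep_mat (\<rho> N) (cut_kernel F h) x y) \<le> \<epsilon> * real N) (along D)"
proof -
  have e': "\<epsilon> * (Im z)\<^sup>2 / 2 > 0" using e z by simp
  obtain F where F: "finite F" "F \<subseteq> carrier G" "\<one> \<in> F" "(\<lambda>g. inv g) ` F = F"
    and small: "\<And>F'. finite F' \<Longrightarrow> F' \<subseteq> carrier G \<Longrightarrow>
       (\<Sum>v\<in>F'. (cmod (Pz z (\<lambda>g. if g \<in> F then h g else 0) v - delta \<one> v))\<^sup>2) \<le> \<epsilon> * (Im z)\<^sup>2 / 2"
    by (rule approximate_inverse[OF h eq e']) blast
  define hF where "hF = (\<lambda>g. if g \<in> F then h g else 0)"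
  define A where "A = F \<union> (\<lambda>(a, g). a \<otimes> g) ` (supp \<times> F)"
  define f where "f = (\<lambda>g. Pz z hF g - delta \<one> g)"
  have hF: "{g. hF g \<noteq> 0} \<subseteq> F" by (auto simp: hF_def)
  have A: "finite A" "A \<subseteq> carrier G" "{g. f g \<noteq> 0} \<subseteq> A"
    using Pz_support[OF F(1-3) hF] unfolding A_def f_def by auto
  have "((\<lambda>N. hs2 N (rep_mat (\<rho> N) f) / real N) \<longlongrightarrow> (\<Sum>g\<in>A. (cmod (f g))\<^sup>2)) (along D)"
    by (rule hs2_limit[OF A])
  moreover have "(\<Sum>g\<in>A. (cmod (f g))\<^sup>2) < \<epsilon> * (Im z)\<^sup>2"
    using small[OF A(1,2)] e' unfolding f_def hF_def by linarith
  ultimately have "eventually (\<lambda>N. hs2 N (rep_mat (\<rho> N) f) / real N < \<epsilon> * (Im z)\<^sup>2) (along D)"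
    by (rule order_tendstoD(2))
  hence "eventually (\<lambda>N. hs2 N (\<lambda>x y. Im_res z N x y - rep_mat (\<rho> N) (cut_kernel F h) x y) \<le> \<epsilon> * real N) (along D)"
    using eventually_in_D
  proof eventually_elim
    case (elim N)
    interpret hermitian_rep G p N "\<rho> N" by (rule hermitian_repI[OF elim(2)])
    interpret eb: hermitian_eigenbasis N "\<phi> N" "rep_mat (\<rho> N) p" "l N" by (rule eigenbasisI[OF elim(2)])
    have Np: "real N > 0" using N_pos[OF elim(2)] by simp
    have "hs2 N (\<lambda>x y. Im_res z N x y - rep_mat (\<rho> N) (cut_kernel F h) x y)
      = hs2 N (\<lambda>x w. Im_res z N x w - (rep_mat (\<rho> N) hF x w - cnj (rep_mat (\<rho> N) hF w x)) / (2 * \<i>))"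
      unfolding hF_def imaginary_part_rep_mat[OF F(1,2,4)] ..
    also have "\<dots> \<le> hs2 N (\<lambda>x w. (\<Sum>y=1..N. rep_mat (\<rho> N) p x y * rep_mat (\<rho> N) hF y w)
        - z * rep_mat (\<rho> N) hF x w - (if x = w then 1 else 0)) / (Im z)\<^sup>2"
      using z by (intro eb.imaginary_resolvent_approximation) simp
    also have "hs2 N (\<lambda>x w. (\<Sum>y=1..N. rep_mat (\<rho> N) p x y * rep_mat (\<rho> N) hF y w)
        - z * rep_mat (\<rho> N) hF x w - (if x = w then 1 else 0)) = hs2 N (rep_mat (\<rho> N) f)"
      unfolding f_def by (intro hs2_cong rep_mat_Pz[OF F(1-3) hF])
    also have "hs2 N (rep_mat (\<rho> N) f) / (Im z)\<^sup>2 \<le> \<epsilon> * real N"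
      using elim(1) Np z by (simp add: field_simps)
    finally show ?case .
  qed
  thus thesis using that[OF F(1-3)] by blast
qed

text \<open>The normalised trace is continuous for the normalised Hilbert-Schmidt norm, and on local matrices
  it converges to the coefficient of the unit.\<close>

lemma trace_resolvent_limit:
  assumes h: "h \<in> ell2 G" and eq: "Pz z h = delta \<one>" and z: "Im z > 0"
  shows "((\<lambda>N. (\<Sum>\<alpha>=1..N. Im (1 / (l N \<alpha> - z))) / real N) \<longlongrightarrow> Im (h \<one>)) (along D)"
proof (rule tendstoI)
  fix e :: real assume e: "e > 0"
  obtain F where F: "finite F" "F \<subseteq> carrier G" "\<one> \<in> F"
    and ap: "eventually (\<lambda>N. hs2 N (\<lambda>x y. Im_res z N x y - rep_mat (\<rho> N) (cut_kernel F h) x y) \<le> (e / 2)\<^sup>2 * real N) (along D)"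
    using local_approximation[OF h eq z, of "(e / 2)\<^sup>2"] e by auto
  have "((\<lambda>N. (\<Sum>x=1..N. rep_mat (\<rho> N) (cut_kernel F h) x x) / of_nat N) \<longlongrightarrow> cut_kernel F h \<one>) (along D)"
    by (rule trace_limit[OF F(1,2) _ F(3)]) auto
  hence "((\<lambda>N. (\<Sum>x=1..N. rep_mat (\<rho> N) (cut_kernel F h) x x) / of_nat N) \<longlongrightarrow> of_real (Im (h \<one>))) (along D)"
    using F(3) by (simp add: Im_kernel_one)
  hence "eventually (\<lambda>N. dist ((\<Sum>x=1..N. rep_mat (\<rho> N) (cut_kernel F h) x x) / of_nat N) (of_real (Im (h \<one>))) < e / 2) (along D)"
    using e by (intro tendstoD) auto
  thus "eventually (\<lambda>N. dist ((\<Sum>\<alpha>=1..N. Im (1 / (l N \<alpha> - z))) / real N) (Im (h \<one>)) < e) (along D)"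
    using ap eventually_in_D
  proof eventually_elim
    case (elim N)
    interpret eb: hermitian_eigenbasis N "\<phi> N" "rep_mat (\<rho> N) p" "l N" by (rule eigenbasisI[OF elim(3)])
    have Np: "real N > 0" using N_pos[OF elim(3)] by simp
    let ?T = "\<Sum>x=1..N. rep_mat (\<rho> N) (cut_kernel F h) x x"
    have tr: "complex_of_real (\<Sum>\<alpha>=1..N. Im (1 / (l N \<alpha> - z))) = (\<Sum>x=1..N. Im_res z N x x)"
      unfolding eb.trace_spec_mat by simp
    have "(cmod ((\<Sum>x=1..N. Im_res z N x x) - ?T))\<^sup>2
       \<le> real N * hs2 N (\<lambda>x y. Im_res z N x y - rep_mat (\<rho> N) (cut_kernel F h) x y)"
      using trace_le_hs2[of "\<lambda>x y. Im_res z N x y - rep_mat (\<rho> N) (cut_kernel F h) x y" N]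
      by (simp only: sum_subtractf)
    also have "\<dots> \<le> real N * ((e / 2)\<^sup>2 * real N)" using elim(2) by (intro mult_left_mono) auto
    also have "\<dots> = (e / 2 * real N)\<^sup>2" by (simp add: power2_eq_square)
    finally have "cmod ((\<Sum>x=1..N. Im_res z N x x) - ?T) \<le> e / 2 * real N"
      using e by (intro power2_le_imp_le[of "cmod _"]) auto
    hence "cmod (((\<Sum>x=1..N. Im_res z N x x) - ?T) / of_nat N) \<le> e / 2"
      using Np by (simp add: norm_divide field_simps)
    hence "dist ((\<Sum>x=1..N. Im_res z N x x) / of_nat N) (?T / of_nat N) \<le> e / 2"
      by (simp add: dist_norm diff_divide_distrib)
    hence "dist ((\<Sum>x=1..N. Im_res z N x x) / of_nat N) (of_real (Im (h \<one>))) < e"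
      using elim(1) dist_triangle_le[of _ "?T / of_nat N"] by (smt (verit) dist_triangle field_sum_of_halves)
    moreover have "(\<Sum>x=1..N. Im_res z N x x) / of_nat N
      = complex_of_real ((\<Sum>\<alpha>=1..N. Im (1 / (l N \<alpha> - z))) / real N)"
      unfolding tr[symmetric] by simp
    ultimately show ?case by (simp only: dist_of_real)
  qed
qed

end

section \<open>A lower bound on the number of eigenvalues in a window\<close>

text \<open>At distance more than \<open>\<eta>\<close> the Poisson kernel of the smaller height \<open>s = \<eta> / L\<close> is dominated by
  \<open>2 / L\<close> times the one of height \<open>\<eta>\<close>. The difference is therefore positive only inside the
  window, where it is at most \<open>1 / s\<close>; this removes the slowly decaying tails.\<close>

lemma poisson_kernel_comparison:
  fixes u \<eta> L :: real
  assumes "L \<ge> 1" "\<eta> > 0"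
  defines "s \<equiv> \<eta> / L"
  shows "s * (s / (u\<^sup>2 + s\<^sup>2) - (2 / L) * (\<eta> / (u\<^sup>2 + \<eta>\<^sup>2))) \<le> (if \<bar>u\<bar> \<le> \<eta> then 1 else 0)"
proof -
  have s: "s > 0" using assms by (simp add: s_def)
  have pos: "u\<^sup>2 + s\<^sup>2 > 0" "u\<^sup>2 + \<eta>\<^sup>2 > 0"
    using s assms(2) by (auto intro: add_nonneg_pos)
  show ?thesis
  proof (cases "\<bar>u\<bar> \<le> \<eta>")
    case True
    have "s * (s / (u\<^sup>2 + s\<^sup>2)) \<le> 1" using pos by (simp add: power2_eq_square)
    moreover have "0 \<le> s * ((2 / L) * (\<eta> / (u\<^sup>2 + \<eta>\<^sup>2)))" using s assms pos by simp
    ultimately show ?thesis using True by (simp add: right_diff_distrib)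
  next
    case False
    have "\<eta>\<^sup>2 \<le> u\<^sup>2" using False assms(2) by (intro abs_le_square_iff[THEN iffD1]) auto
    hence "u\<^sup>2 + \<eta>\<^sup>2 \<le> 2 * (u\<^sup>2 + s\<^sup>2)" by (smt (verit) zero_le_power2)
    hence "s * (u\<^sup>2 + \<eta>\<^sup>2) \<le> s * (2 * (u\<^sup>2 + s\<^sup>2))" using s by (intro mult_left_mono) auto
    hence "s / (u\<^sup>2 + s\<^sup>2) \<le> 2 * s / (u\<^sup>2 + \<eta>\<^sup>2)"
      using pos by (simp add: divide_le_eq pos_le_divide_eq mult_ac)
    also have "\<dots> = (2 / L) * (\<eta> / (u\<^sup>2 + \<eta>\<^sup>2))" by (simp add: s_def)
    finally show ?thesis using False s by (simp add: mult_nonneg_nonpos)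
  qed
qed

text \<open>Condition (AC) enters through the column of the resolvent at the unit, in the form in which
  \<open>AC_green\<close> provides it.\<close>

locale ac_seq = quantum_seq +
  fixes C :: real and I0 :: "real set"
  assumes C1: "C \<ge> 1"
    and green: "\<And>E \<eta>. E \<in> I0 \<Longrightarrow> 0 < \<eta> \<Longrightarrow> \<eta> \<le> 1 \<Longrightarrow>
       \<exists>h\<in>ell2 G. Pz (Complex E \<eta>) h = delta \<one> \<and> 1 / C \<le> Im (h \<one>) \<and> Im (h \<one>) \<le> C"
begin

text \<open>Summing the comparison of Poisson kernels over the eigenvalues gives the two Green functions in the
  limit. The first is at least \<open>1 / C\<close> and the second at most \<open>C\<close>.\<close>

lemma density_lower_bound:
  assumes E: "E \<in> I0" and \<eta>: "0 < \<eta>" "\<eta> \<le> 1"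
  shows "eventually (\<lambda>N. \<eta> / (16 * C ^ 3) * real N
     \<le> real (card (spec_indices N (l N) {E - \<eta>..E + \<eta>}))) (along D)"
proof -
  \<comment> \<open>With this ratio the subtracted term \<open>(2 / L) C\<close> is half of the lower bound \<open>1 / C\<close>. The claimed
    constant is half of the limit, to leave room for the convergence.\<close>
  define L where "L = 4 * C\<^sup>2"
  define s where "s = \<eta> / L"
  have "1 \<le> C\<^sup>2" using C1 by (simp add: one_le_power)
  hence L: "L \<ge> 1" by (simp add: L_def)
  have s: "0 < s" "s \<le> 1" using L \<eta> by (auto simp: s_def divide_le_eq)
  obtain h where h: "h \<in> ell2 G" "Pz (Complex E s) h = delta \<one>" "1 / C \<le> Im (h \<one>)"
    using green[OF E s] by blast
  obtain k where k: "k \<in> ell2 G" "Pz (Complex E \<eta>) k = delta \<one>" "Im (k \<one>) \<le> C"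
    using green[OF E \<eta>] by blast
  let ?T = "\<lambda>\<eta> N. (\<Sum>\<alpha>=1..N. Im (1 / (l N \<alpha> - Complex E \<eta>))) / real N"
  have "((\<lambda>N. s * (?T s N - (2 / L) * ?T \<eta> N)) \<longlongrightarrow> s * (Im (h \<one>) - (2 / L) * Im (k \<one>))) (along D)"
    using s \<eta> by (intro tendsto_mult tendsto_const tendsto_diff trace_resolvent_limit h k) auto
  moreover have "\<eta> / (16 * C ^ 3) < s * (Im (h \<one>) - (2 / L) * Im (k \<one>))"
  proof -
    have "(2 / L) * Im (k \<one>) \<le> (2 / L) * C" using k(3) L by (intro mult_left_mono) auto
    also have "\<dots> = 1 / (2 * C)" using C1 by (simp add: L_def power2_eq_square)
    finally have "1 / (2 * C) \<le> Im (h \<one>) - (2 / L) * Im (k \<one>)" using h(3) by (simp add: field_simps)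
    hence "s * (1 / (2 * C)) \<le> s * (Im (h \<one>) - (2 / L) * Im (k \<one>))"
      using s by (intro mult_left_mono) auto
    moreover have "s * (1 / (2 * C)) = \<eta> / (8 * C ^ 3)"
      by (simp add: s_def L_def power2_eq_square power3_eq_cube)
    moreover have "\<eta> / (16 * C ^ 3) < \<eta> / (8 * C ^ 3)"
      using \<eta> C1 by (simp add: divide_strict_left_mono)
    ultimately show ?thesis by linarith
  qed
  ultimately have "eventually (\<lambda>N. \<eta> / (16 * C ^ 3) < s * (?T s N - (2 / L) * ?T \<eta> N)) (along D)"
    by (rule order_tendstoD(1))
  thus ?thesis using eventually_in_D
  proof eventually_elim
    case (elim N)
    interpret eb: hermitian_eigenbasis N "\<phi> N" "rep_mat (\<rho> N) p" "l N" by (rule eigenbasisI[OF elim(2)])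
    have Np: "real N > 0" using N_pos[OF elim(2)] by simp
    let ?J = "spec_indices N (l N) {E - \<eta>..E + \<eta>}"
    have "\<eta> / (16 * C ^ 3) * real N \<le> s * (?T s N - (2 / L) * ?T \<eta> N) * real N"
      using elim(1) Np by (intro mult_right_mono) auto
    also have "\<dots> = (\<Sum>\<alpha>=1..N. s * (Im (1 / (l N \<alpha> - Complex E s)) - (2 / L) * Im (1 / (l N \<alpha> - Complex E \<eta>))))"
      using Np by (simp add: sum_subtractf sum_distrib_left right_diff_distrib left_diff_distrib)
    also have "\<dots> \<le> (\<Sum>\<alpha>=1..N. if \<alpha> \<in> ?J then 1 else 0)"
    proof (rule sum_mono)
      fix \<alpha> assume a: "\<alpha> \<in> {1..N}"
      have im: "Im (l N \<alpha>) = 0" by (rule eb.Im_eigenvalue[OF a])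
      have "\<bar>Re (l N \<alpha>) - E\<bar> \<le> \<eta> \<Longrightarrow> \<alpha> \<in> ?J"
        using a im by (auto simp: spec_indices_def complex_eq_iff intro!: image_eqI[of _ _ "Re (l N \<alpha>)"])
      thus "s * (Im (1 / (l N \<alpha> - Complex E s)) - (2 / L) * Im (1 / (l N \<alpha> - Complex E \<eta>)))
         \<le> (if \<alpha> \<in> ?J then 1 else 0)"
        using poisson_kernel_comparison[OF L \<eta>(1), of "Re (l N \<alpha>) - E"]
        unfolding Im_inverse_real_shift[OF im] s_def[symmetric] by (auto split: if_splits)
    qed
    also have "\<dots> = real (card ?J)"
      by (simp add: sum.If_cases) (rule arg_cong[of _ _ card], auto simp: spec_indices_def)
    finally show ?case .
  qed
qed

end

section \<open>Decay of the twisted form\<close>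

lemma sum_unique_le:
  fixes c :: real
  assumes "finite A" "\<And>x y. x \<in> A \<Longrightarrow> y \<in> A \<Longrightarrow> Q x \<Longrightarrow> Q y \<Longrightarrow> x = y" "c \<ge> 0"
  shows "(\<Sum>x\<in>A. if Q x then c else 0) \<le> c"
proof -
  have "card {x \<in> A. Q x} \<le> 1"
    using assms(1,2) by (intro card_le_Suc0_iff_eq[THEN iffD2, unfolded One_nat_def[symmetric]]) auto
  hence "real (card {x \<in> A. Q x}) * c \<le> 1 * c" using assms(3) by (intro mult_right_mono) auto
  thus ?thesis using assms(1) by (simp add: sum.If_cases Int_def)
qed

context group
begin

text \<open>Each \<open>g\<close> is matched by at most one \<open>h\<close> with \<open>h t g = t\<close>, and conversely. Over matched pairs the
  weight \<open>\<delta>\<close> is handled by \<open>|k\<^sub>1 k\<^sub>2| \<le> (|k\<^sub>1|\<^sup>2 + |k\<^sub>2|\<^sup>2) / 2\<close> and the square sums, and the weight \<open>4\<close> on the finite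
  set \<open>B\<close> by the entrywise bounds.\<close>

lemma kernel_sum_bound:
  assumes F: "finite F1" "F1 \<subseteq> carrier G" "finite F2" "F2 \<subseteq> carrier G" and t: "t \<in> carrier G"
    and k1: "\<And>g. cmod (k1 g) \<le> C" "(\<Sum>g\<in>F1. (cmod (k1 g))\<^sup>2) \<le> M"
    and k2: "\<And>g. cmod (k2 g) \<le> C" "(\<Sum>g\<in>F2. (cmod (k2 g))\<^sup>2) \<le> M"
    and B: "finite B" and \<delta>: "\<delta> \<ge> 0" and e: "e \<ge> 0"
  shows "(\<Sum>g\<in>F1. \<Sum>h\<in>F2. cmod (k1 g) * cmod (k2 h) *
       (if h \<otimes> t \<otimes> g = t then (if g \<in> B then 4 else \<delta>) else e))
    \<le> \<delta> * M + 4 * real (card B) * C\<^sup>2 + e * (\<Sum>g\<in>F1. \<Sum>h\<in>F2. cmod (k1 g) * cmod (k2 h))"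
proof -
  let ?Q = "\<lambda>g h. h \<otimes> t \<otimes> g = t"
  have C0: "0 \<le> C" using k1(1) norm_ge_zero order_trans by blast
  have carr: "g \<in> F1 \<Longrightarrow> g \<in> carrier G" "g \<in> F2 \<Longrightarrow> g \<in> carrier G" for g using F by auto
  have u1: "h = h'" if "h \<in> F2" "h' \<in> F2" "?Q g h" "?Q g h'" "g \<in> F1" for g h h'
    using that carr t by (metis m_closed right_cancel)
  have u2: "g = g'" if "g \<in> F1" "g' \<in> F1" "?Q g h" "?Q g' h" "h \<in> F2" for g g' h
    using that carr t by (metis m_closed Units_eq Units_l_cancel)
  have term_le: "cmod (k1 g) * cmod (k2 h) * (if ?Q g h then (if g \<in> B then 4 else \<delta>) else e)
     \<le> (if ?Q g h then (if g \<in> B then 4 * C\<^sup>2 else 0) else 0)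
       + (if ?Q g h then \<delta> * ((cmod (k1 g))\<^sup>2 / 2) else 0)
       + (if ?Q g h then \<delta> * ((cmod (k2 h))\<^sup>2 / 2) else 0)
       + e * (cmod (k1 g) * cmod (k2 h))" for g h
  proof -
    have 1: "cmod (k1 g) * cmod (k2 h) \<le> C\<^sup>2"
      unfolding power2_eq_square using k1(1) k2(1) C0 by (intro mult_mono) auto
    have "cmod (k1 g) * cmod (k2 h) \<le> (cmod (k1 g))\<^sup>2 / 2 + (cmod (k2 h))\<^sup>2 / 2"
      using sum_squares_bound[of "cmod (k1 g)" "cmod (k2 h)"] by (simp add: field_simps)
    hence 2: "\<delta> * (cmod (k1 g) * cmod (k2 h)) \<le> \<delta> * ((cmod (k1 g))\<^sup>2 / 2) + \<delta> * ((cmod (k2 h))\<^sup>2 / 2)"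
      using \<delta> by (metis mult_left_mono distrib_left)
    have 3: "0 \<le> e * (cmod (k1 g) * cmod (k2 h))" "0 \<le> \<delta> * ((cmod (k1 g))\<^sup>2 / 2)"
      "0 \<le> \<delta> * ((cmod (k2 h))\<^sup>2 / 2)" using e \<delta> by auto
    have 4: "cmod (k1 g) * cmod (k2 h) * 4 \<le> 4 * C\<^sup>2" using 1 by simp
    have 5: "cmod (k1 g) * cmod (k2 h) * \<delta> = \<delta> * (cmod (k1 g) * cmod (k2 h))"
      "cmod (k1 g) * cmod (k2 h) * e = e * (cmod (k1 g) * cmod (k2 h))" by simp_all
    show ?thesis
    proof (cases "?Q g h")
      case True
      thus ?thesis
      proof (cases "g \<in> B")
        case True
        thus ?thesis using \<open>?Q g h\<close> 3 4 by (simp only: if_True simp_thms)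
      next
        case False
        thus ?thesis using \<open>?Q g h\<close> 2 3 5 by (simp only: if_True if_False simp_thms)
      qed
    next
      case False
      thus ?thesis using 5 by simp
    qed
  qed
  have "(\<Sum>g\<in>F1. \<Sum>h\<in>F2. if ?Q g h then (if g \<in> B then 4 * C\<^sup>2 else 0) else 0)
      \<le> (\<Sum>g\<in>F1. if g \<in> B then 4 * C\<^sup>2 else 0)"
    using F(3) u1 by (intro sum_mono sum_unique_le) auto
  also have "\<dots> = real (card (F1 \<inter> B)) * (4 * C\<^sup>2)" using F(1) by (simp add: sum.If_cases)
  also have "\<dots> \<le> real (card B) * (4 * C\<^sup>2)"
    using B by (intro mult_right_mono) (auto intro: card_mono)
  finally have s1: "(\<Sum>g\<in>F1. \<Sum>h\<in>F2. if ?Q g h then (if g \<in> B then 4 * C\<^sup>2 else 0) else 0)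
      \<le> 4 * real (card B) * C\<^sup>2" by simp
  have "(\<Sum>g\<in>F1. \<Sum>h\<in>F2. if ?Q g h then \<delta> * ((cmod (k1 g))\<^sup>2 / 2) else 0)
      \<le> (\<Sum>g\<in>F1. \<delta> * ((cmod (k1 g))\<^sup>2 / 2))"
    using F(3) u1 \<delta> by (intro sum_mono sum_unique_le) auto
  also have "\<dots> = \<delta> * ((\<Sum>g\<in>F1. (cmod (k1 g))\<^sup>2) / 2)"
    by (simp add: sum_distrib_left sum_divide_distrib)
  also have "\<dots> \<le> \<delta> * (M / 2)" using k1(2) \<delta> by (intro mult_left_mono divide_right_mono) auto
  finally have s2: "(\<Sum>g\<in>F1. \<Sum>h\<in>F2. if ?Q g h then \<delta> * ((cmod (k1 g))\<^sup>2 / 2) else 0) \<le> \<delta> * (M / 2)" .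
  have "(\<Sum>g\<in>F1. \<Sum>h\<in>F2. if ?Q g h then \<delta> * ((cmod (k2 h))\<^sup>2 / 2) else 0)
      = (\<Sum>h\<in>F2. \<Sum>g\<in>F1. if ?Q g h then \<delta> * ((cmod (k2 h))\<^sup>2 / 2) else 0)" by (rule sum.swap)
  also have "\<dots> \<le> (\<Sum>h\<in>F2. \<delta> * ((cmod (k2 h))\<^sup>2 / 2))"
    using F(1) u2 \<delta> by (intro sum_mono sum_unique_le) auto
  also have "\<dots> = \<delta> * ((\<Sum>h\<in>F2. (cmod (k2 h))\<^sup>2) / 2)"
    by (simp add: sum_distrib_left sum_divide_distrib)
  also have "\<dots> \<le> \<delta> * (M / 2)" using k2(2) \<delta> by (intro mult_left_mono divide_right_mono) auto
  finally have s3: "(\<Sum>g\<in>F1. \<Sum>h\<in>F2. if ?Q g h then \<delta> * ((cmod (k2 h))\<^sup>2 / 2) else 0) \<le> \<delta> * (M / 2)" .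
  have "(\<Sum>g\<in>F1. \<Sum>h\<in>F2. cmod (k1 g) * cmod (k2 h) * (if ?Q g h then (if g \<in> B then 4 else \<delta>) else e))
    \<le> (\<Sum>g\<in>F1. \<Sum>h\<in>F2. (if ?Q g h then (if g \<in> B then 4 * C\<^sup>2 else 0) else 0)
       + (if ?Q g h then \<delta> * ((cmod (k1 g))\<^sup>2 / 2) else 0)
       + (if ?Q g h then \<delta> * ((cmod (k2 h))\<^sup>2 / 2) else 0)
       + e * (cmod (k1 g) * cmod (k2 h)))"
    by (intro sum_mono term_le)
  also have "\<dots> = (\<Sum>g\<in>F1. \<Sum>h\<in>F2. if ?Q g h then (if g \<in> B then 4 * C\<^sup>2 else 0) else 0)
     + (\<Sum>g\<in>F1. \<Sum>h\<in>F2. if ?Q g h then \<delta> * ((cmod (k1 g))\<^sup>2 / 2) else 0)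
     + (\<Sum>g\<in>F1. \<Sum>h\<in>F2. if ?Q g h then \<delta> * ((cmod (k2 h))\<^sup>2 / 2) else 0)
     + e * (\<Sum>g\<in>F1. \<Sum>h\<in>F2. cmod (k1 g) * cmod (k2 h))"
    by (simp only: sum.distrib sum_distrib_left)
  also have "\<dots> \<le> 4 * real (card B) * C\<^sup>2 + \<delta> * (M / 2) + \<delta> * (M / 2)
     + e * (\<Sum>g\<in>F1. \<Sum>h\<in>F2. cmod (k1 g) * cmod (k2 h))"
    using s1 s2 s3 by linarith
  finally show ?thesis by (simp only: field_sum_of_halves flip: distrib_left)
qed

end

context quantum_seq
begin

text \<open>Inner sums over matched pairs are correlations of \<open>b\<close>, small outside \<open>B\<close> and at most \<open>4 N\<close>
  inside. The unmatched pairs are finite in number and each contributes \<open>o(N)\<close>.\<close>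

lemma twisted_form_local_asymptotics:
  assumes F: "finite F1" "F1 \<subseteq> carrier G" "finite F2" "F2 \<subseteq> carrier G" and t: "t \<in> carrier G"
    and f1: "{g. f1 g \<noteq> 0} \<subseteq> F1" and f2: "{g. f2 g \<noteq> 0} \<subseteq> F2"
    and k1: "\<And>g. cmod (f1 g) \<le> C" "(\<Sum>g\<in>F1. (cmod (f1 g))\<^sup>2) \<le> M"
    and k2: "\<And>g. cmod (f2 g) \<le> C" "(\<Sum>g\<in>F2. (cmod (f2 g))\<^sup>2) \<le> M"
    and B: "finite B" and \<delta>: "\<delta> \<ge> 0" and e: "\<epsilon> > 0"
    and b: "\<And>N y. N \<in> D \<Longrightarrow> y \<in> {1..N} \<Longrightarrow> cmod (b N y) \<le> 2"
    and corr: "\<And>g. g \<in> carrier G - B \<Longrightarrow>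
      eventually (\<lambda>N. cmod (\<Sum>y=1..N. b N (\<rho> N g y) * cnj (b N y)) \<le> \<delta> * real N) (along D)"
  shows "eventually (\<lambda>N. cmod (twisted_form N (b N) (\<rho> N t) (rep_mat (\<rho> N) f1) (rep_mat (\<rho> N) f2))
      \<le> real N * (\<delta> * M + 4 * real (card B) * C\<^sup>2 + \<epsilon>)) (along D)"
proof -
  define S where "S = (\<Sum>g\<in>F1. \<Sum>h\<in>F2. cmod (f1 g) * cmod (f2 h))"
  have S: "0 \<le> S" unfolding S_def by (intro sum_nonneg) auto
  define e where "e = \<epsilon> / (S + 1)"
  have e0: "e > 0" using S \<open>\<epsilon> > 0\<close> by (simp add: e_def)
  have eS: "e * S \<le> \<epsilon>" using S \<open>\<epsilon> > 0\<close> by (simp add: e_def field_simps)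
  define I where "I N g h = (\<Sum>y=1..N. if \<rho> N t y = \<rho> N (h \<otimes> t \<otimes> g) y
     then b N (\<rho> N g y) * cnj (b N y) else 0)" for N g h
  define w where "w g h = (if h \<otimes> t \<otimes> g = t then (if g \<in> B then 4 else \<delta>) else e)" for g h
  have carr: "g \<in> F1 \<Longrightarrow> g \<in> carrier G" "g \<in> F2 \<Longrightarrow> g \<in> carrier G" for g using F by auto
  have bb: "cmod (b N (\<rho> N g y) * cnj (b N y)) \<le> 4"
    if "N \<in> D" "g \<in> carrier G" "y \<in> {1..N}" for N g y
  proof -
    interpret perm_rep G N "\<rho> N" by (rule perm_repI[OF that(1)])
    have "cmod (b N (\<rho> N g y)) * cmod (b N y) \<le> 2 * 2"
      using b[OF that(1) r_mem[OF that(2,3)]] b[OF that(1,3)] by (intro mult_mono) auto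
    thus ?thesis by (simp add: norm_mult)
  qed
  have inner: "eventually (\<lambda>N. cmod (I N g h) \<le> w g h * real N) (along D)"
    if g: "g \<in> F1" and h: "h \<in> F2" for g h
  proof (cases "h \<otimes> t \<otimes> g = t")
    case Q: True
    have I: "I N g h = (\<Sum>y=1..N. b N (\<rho> N g y) * cnj (b N y))" for N
      using Q by (simp add: I_def)
    show ?thesis
    proof (cases "g \<in> B")
      case True
      show ?thesis using eventually_in_D
      proof eventually_elim
        case (elim N)
        have "cmod (I N g h) \<le> (\<Sum>y=1..N. 4)"
          unfolding I by (intro sum_norm_le bb[OF elim carr(1)[OF g]])
        thus ?case using Q True by (simp add: w_def)
      qed
    next
      case False
      thus ?thesis using corr[of g] carr(1)[OF g] Q by (simp add: I w_def)
    qed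
  next
    case Q: False
    have hc: "h \<otimes> t \<otimes> g \<in> carrier G" using carr g h t by simp
    have "((\<lambda>N. real (coincidences N (\<rho> N) t (h \<otimes> t \<otimes> g)) / real N) \<longlongrightarrow> 0) (along D)"
      using coincidences_limit[OF t hc] Q by (auto split: if_splits)
    hence "eventually (\<lambda>N. real (coincidences N (\<rho> N) t (h \<otimes> t \<otimes> g)) / real N < e / 4) (along D)"
      using e0 by (intro order_tendstoD(2)) auto
    thus ?thesis using eventually_in_D
    proof eventually_elim
      case (elim N)
      have "cmod (I N g h) \<le> (\<Sum>y=1..N. if \<rho> N t y = \<rho> N (h \<otimes> t \<otimes> g) y then 4 else 0)"
        unfolding I_def using bb[OF elim(2) carr(1)[OF g]] by (intro sum_norm_le) auto
      also have "\<dots> = real (coincidences N (\<rho> N) t (h \<otimes> t \<otimes> g)) * 4"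
        by (simp add: coincidences_def sum.If_cases Int_def)
      also have "\<dots> \<le> e * real N" using elim(1) N_pos[OF elim(2)] by (simp add: field_simps)
      finally show ?case using Q by (simp add: w_def)
    qed
  qed
  have "eventually (\<lambda>N. \<forall>g\<in>F1. \<forall>h\<in>F2. cmod (I N g h) \<le> w g h * real N) (along D)"
    using F inner by (intro eventually_ball_finite ballI) auto
  thus ?thesis using eventually_in_D
  proof eventually_elim
    case (elim N)
    interpret perm_rep G N "\<rho> N" by (rule perm_repI[OF elim(2)])
    have "cmod (twisted_form N (b N) (\<rho> N t) (rep_mat (\<rho> N) f1) (rep_mat (\<rho> N) f2))
      = cmod (\<Sum>g\<in>F1. \<Sum>h\<in>F2. f1 g * f2 h * I N g h)"
      unfolding twisted_form_rep_mat[OF F(1,2) f1 F(3,4) f2 t] I_def ..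
    also have "\<dots> \<le> (\<Sum>g\<in>F1. \<Sum>h\<in>F2. cmod (f1 g) * cmod (f2 h) * (w g h * real N))"
      using elim(1) by (intro sum_norm_le) (auto simp: norm_mult intro!: mult_left_mono)
    also have "\<dots> = real N * (\<Sum>g\<in>F1. \<Sum>h\<in>F2. cmod (f1 g) * cmod (f2 h) * w g h)"
      by (simp add: sum_distrib_left mult_ac)
    also have "\<dots> \<le> real N * (\<delta> * M + 4 * real (card B) * C\<^sup>2 + e * S)"
      unfolding w_def S_def using e0
      by (intro mult_left_mono kernel_sum_bound F t k1 k2 B \<delta>) auto
    also have "\<dots> \<le> real N * (\<delta> * M + 4 * real (card B) * C\<^sup>2 + \<epsilon>)"
      using eS by (intro mult_left_mono) auto
    finally show ?case .
  qed
qed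

text \<open>The kernels are replaced by truncations, at a cost that is an arbitrarily small multiple of
  \<open>N\<close>. The truncations inherit the entrywise bound \<open>C\<close> and the square sum bound \<open>C / \<eta>\<close>.\<close>

lemma twisted_form_asymptotics:
  assumes h1: "h1 \<in> ell2 G" "Pz z1 h1 = delta \<one>" "Im z1 = \<eta>" "Im (h1 \<one>) \<le> C"
    and h2: "h2 \<in> ell2 G" "Pz z2 h2 = delta \<one>" "Im z2 = \<eta>" "Im (h2 \<one>) \<le> C"
    and \<eta>: "\<eta> > 0" and t: "t \<in> carrier G"
    and B: "finite B" and \<delta>: "\<delta> \<ge> 0" and e: "\<epsilon> > 0"
    and b: "\<And>N y. N \<in> D \<Longrightarrow> y \<in> {1..N} \<Longrightarrow> cmod (b N y) \<le> 2"
    and corr: "\<And>g. g \<in> carrier G - B \<Longrightarrow>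
      eventually (\<lambda>N. cmod (\<Sum>y=1..N. b N (\<rho> N g y) * cnj (b N y)) \<le> \<delta> * real N) (along D)"
  shows "eventually (\<lambda>N. cmod (twisted_form N (b N) (\<rho> N t) (Im_res z1 N) (Im_res z2 N))
      \<le> real N * (\<delta> * (C / \<eta>) + 4 * real (card B) * C\<^sup>2 + \<epsilon>)) (along D)"
proof -
  have "0 \<le> cmod (Im_kernel h1 \<one>)" by simp
  also have "\<dots> \<le> C" using Im_kernel_bounded[OF h1(1,2), of \<one>] h1(3,4) \<eta> by simp
  finally have C0: "0 \<le> C" .
  define M where "M = C / \<eta> + 1"
  define R where "R = sqrt (2 * M + 2) + sqrt M"
  have M: "M \<ge> 1" using C0 \<eta> by (simp add: M_def)
  hence R: "R > 0" unfolding R_def by (intro add_pos_pos) auto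
  \<comment> \<open>The two replacement errors add up to \<open>4 s R N\<close>, where \<open>s\<^sup>2 N\<close> bounds the squared distances.\<close>
  define s where "s = min 1 (\<epsilon> / (8 * R))"
  have s: "0 < s" "s \<le> 1" "4 * s * R \<le> \<epsilon> / 2"
    using R e by (auto simp: s_def min_def field_simps)
  have s2: "0 < s\<^sup>2" "s\<^sup>2 \<le> 1" using s by (auto simp: power_le_one)
  have z1: "Im z1 > 0" and z2: "Im z2 > 0" using h1(3) h2(3) \<eta> by auto
  obtain F1 where F1: "finite F1" "F1 \<subseteq> carrier G" "\<one> \<in> F1"
    and ap1: "eventually (\<lambda>N. hs2 N (\<lambda>x y. Im_res z1 N x y - rep_mat (\<rho> N) (cut_kernel F1 h1) x y) \<le> s\<^sup>2 * real N) (along D)"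
    by (rule local_approximation[OF h1(1,2) z1 s2(1)])
  obtain F2 where F2: "finite F2" "F2 \<subseteq> carrier G" "\<one> \<in> F2"
    and ap2: "eventually (\<lambda>N. hs2 N (\<lambda>x y. Im_res z2 N x y - rep_mat (\<rho> N) (cut_kernel F2 h2) x y) \<le> s\<^sup>2 * real N) (along D)"
    by (rule local_approximation[OF h2(1,2) z2 s2(1)])
  have kb: "cmod (cut_kernel F h g) \<le> C" if "h \<in> ell2 G" "Pz z h = delta \<one>" "Im z > 0" "Im (h \<one>) \<le> C" for F h z g
    using Im_kernel_bounded[OF that(1-3), of g] that(4) C0 by auto
  have ks: "(\<Sum>g\<in>F. (cmod (cut_kernel F h g))\<^sup>2) \<le> C / \<eta>"
    if "h \<in> ell2 G" "Pz z h = delta \<one>" "Im z = \<eta>" "Im (h \<one>) \<le> C" "finite F" "F \<subseteq> carrier G" for F h z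
  proof -
    have "(\<Sum>g\<in>F. (cmod (cut_kernel F h g))\<^sup>2) = (\<Sum>g\<in>F. (cmod (Im_kernel h g))\<^sup>2)"
      by (intro sum.cong refl) simp
    also have "\<dots> \<le> Im (h \<one>) / Im z"
      using that \<eta> by (intro Im_kernel_sq_sum) auto
    also have "\<dots> \<le> C / \<eta>" using that \<eta> by (simp add: divide_right_mono)
    finally show ?thesis .
  qed
  have hsA: "eventually (\<lambda>N. hs2 N (rep_mat (\<rho> N) (cut_kernel F h)) \<le> M * real N) (along D)"
    if "h \<in> ell2 G" "Pz z h = delta \<one>" "Im z = \<eta>" "Im (h \<one>) \<le> C" "finite F" "F \<subseteq> carrier G" for F h z
  proof -
    have "((\<lambda>N. hs2 N (rep_mat (\<rho> N) (cut_kernel F h)) / real N) \<longlongrightarrow> (\<Sum>g\<in>F. (cmod (cut_kernel F h g))\<^sup>2)) (along D)"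
      using that by (intro hs2_limit) auto
    moreover have "(\<Sum>g\<in>F. (cmod (cut_kernel F h g))\<^sup>2) < M"
      using ks[OF that] by (simp add: M_def)
    ultimately have "eventually (\<lambda>N. hs2 N (rep_mat (\<rho> N) (cut_kernel F h)) / real N < M) (along D)"
      by (rule order_tendstoD(2))
    thus ?thesis using eventually_in_D
      by eventually_elim (use N_pos in \<open>auto simp: field_simps\<close>)
  qed
  have main: "eventually (\<lambda>N. cmod (twisted_form N (b N) (\<rho> N t) (rep_mat (\<rho> N) (cut_kernel F1 h1)) (rep_mat (\<rho> N) (cut_kernel F2 h2)))
      \<le> real N * (\<delta> * (C / \<eta>) + 4 * real (card B) * C\<^sup>2 + \<epsilon> / 2)) (along D)"
    using e by (intro twisted_form_local_asymptotics[OF F1(1,2) F2(1,2) t _ _ kb[OF h1(1,2) z1 h1(4)]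
        ks[OF h1 F1(1,2)] kb[OF h2(1,2) z2 h2(4)] ks[OF h2 F2(1,2)] B \<delta> _ b corr]) auto
  show ?thesis
    using main ap1 ap2 hsA[OF h1 F1(1,2)] hsA[OF h2 F2(1,2)] eventually_in_D
  proof eventually_elim
    case (elim N)
    interpret perm_rep G N "\<rho> N" by (rule perm_repI[OF elim(6)])
    let ?F1 = "Im_res z1 N" and ?F2 = "Im_res z2 N"
    let ?A1 = "rep_mat (\<rho> N) (cut_kernel F1 h1)" and ?A2 = "rep_mat (\<rho> N) (cut_kernel F2 h2)"
    let ?tf = "twisted_form N (b N) (\<rho> N t)"
    note tb = twisted_form_bound[OF r_permutes[OF t] b[OF elim(6)], unfolded power2_eq_square]
    have sq: "sqrt (s\<^sup>2 * real N) = s * sqrt (real N)" using s by (simp add: real_sqrt_mult)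
    have "hs2 N ?F2 = hs2 N (\<lambda>x y. ?A2 x y - (?A2 x y - ?F2 x y))" by (intro hs2_cong) simp
    also have "\<dots> \<le> 2 * (hs2 N ?A2 + hs2 N (\<lambda>x y. ?A2 x y - ?F2 x y))" by (rule hs2_diff_le)
    also have "hs2 N (\<lambda>x y. ?A2 x y - ?F2 x y) = hs2 N (\<lambda>x y. ?F2 x y - ?A2 x y)"
      unfolding hs2_def by (simp only: norm_minus_commute)
    also have "2 * (hs2 N ?A2 + hs2 N (\<lambda>x y. ?F2 x y - ?A2 x y)) \<le> 2 * (M * real N + 1 * real N)"
      using elim(3,5) s2(2) by (intro mult_left_mono add_mono order_trans[OF elim(3) mult_right_mono]) auto
    finally have hF2: "hs2 N ?F2 \<le> (2 * M + 2) * real N" by (simp add: algebra_simps)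
    have d1: "cmod (?tf (\<lambda>x y. ?F1 x y - ?A1 x y) ?F2)
      \<le> 4 * (s * sqrt (real N) * (sqrt (2 * M + 2) * sqrt (real N)))"
    proof -
      have "cmod (?tf (\<lambda>x y. ?F1 x y - ?A1 x y) ?F2)
        \<le> 4 * (sqrt (hs2 N (\<lambda>x y. ?F1 x y - ?A1 x y)) * sqrt (hs2 N ?F2))"
        using tb by simp
      also have "\<dots> \<le> 4 * (sqrt (s\<^sup>2 * real N) * sqrt ((2 * M + 2) * real N))"
        using elim(2) hF2 by (intro mult_left_mono mult_mono real_sqrt_le_mono) (auto simp: hs2_nonneg)
      finally show ?thesis by (simp only: sq real_sqrt_mult[of "2 * M + 2"])
    qed
    have d2: "cmod (?tf ?A1 (\<lambda>x y. ?F2 x y - ?A2 x y))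
      \<le> 4 * (sqrt M * sqrt (real N) * (s * sqrt (real N)))"
    proof -
      have "cmod (?tf ?A1 (\<lambda>x y. ?F2 x y - ?A2 x y))
        \<le> 4 * (sqrt (hs2 N ?A1) * sqrt (hs2 N (\<lambda>x y. ?F2 x y - ?A2 x y)))"
        using tb by simp
      also have "\<dots> \<le> 4 * (sqrt (M * real N) * sqrt (s\<^sup>2 * real N))"
        using elim(3,4) M by (intro mult_left_mono mult_mono real_sqrt_le_mono) (auto simp: hs2_nonneg)
      finally show ?thesis by (simp only: sq real_sqrt_mult[of M])
    qed
    have NN: "sqrt (real N) * sqrt (real N) = real N" by simp
    have "?tf ?F1 ?F2 = ?tf ?A1 ?A2 + (?tf (\<lambda>x y. ?F1 x y - ?A1 x y) ?F2 + ?tf ?A1 (\<lambda>x y. ?F2 x y - ?A2 x y))"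
      unfolding twisted_form_diff_left twisted_form_diff_right by simp
    hence "cmod (?tf ?F1 ?F2) \<le> cmod (?tf ?A1 ?A2) +
       (cmod (?tf (\<lambda>x y. ?F1 x y - ?A1 x y) ?F2) + cmod (?tf ?A1 (\<lambda>x y. ?F2 x y - ?A2 x y)))"
      by (metis (no_types, lifting) norm_triangle_le add_left_mono norm_triangle_ineq)
    also have "\<dots> \<le> real N * (\<delta> * (C / \<eta>) + 4 * real (card B) * C\<^sup>2 + \<epsilon> / 2)
      + (4 * (s * sqrt (real N) * (sqrt (2 * M + 2) * sqrt (real N)))
        + 4 * (sqrt M * sqrt (real N) * (s * sqrt (real N))))"
      using elim(1) d1 d2 by (intro add_mono)
    also have "4 * (s * sqrt (real N) * (sqrt (2 * M + 2) * sqrt (real N)))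
        + 4 * (sqrt M * sqrt (real N) * (s * sqrt (real N)))
      = 4 * s * R * (sqrt (real N) * sqrt (real N))"
      by (simp add: R_def algebra_simps)
    also have "\<dots> \<le> \<epsilon> / 2 * real N" unfolding NN using s(3) by (intro mult_right_mono) auto
    finally show ?case by (simp add: algebra_simps)
  qed
qed

end

section \<open>Words and asymptotically uncorrelated sequences\<close>

context group
begin

abbreviation word_value :: "'a list \<Rightarrow> 'a" where
  "word_value ws \<equiv> foldr (\<lambda>x y. x \<otimes> y) ws \<one>"

lemma word_value_closed: "set ws \<subseteq> carrier G \<Longrightarrow> word_value ws \<in> carrier G"
  by (induction ws) auto

lemma word_value_append:
  "set us \<subseteq> carrier G \<Longrightarrow> set ws \<subseteq> carrier G \<Longrightarrow> word_value (us @ ws) = word_value us \<otimes> word_value ws"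
  by (induction us) (auto simp: word_value_closed m_assoc)

lemma generate_word:
  assumes S: "S \<subseteq> carrier G" and g: "g \<in> generate G S"
  shows "\<exists>ws. set ws \<subseteq> S \<union> (\<lambda>s. inv s) ` S \<and> word_value ws = g"
  using g
proof induction
  case one
  show ?case by (intro exI[of _ "[]"]) auto
next
  case (incl h)
  thus ?case using S by (intro exI[of _ "[h]"]) auto
next
  case (inv h)
  thus ?case using S by (intro exI[of _ "[inv h]"]) auto
next
  case (eng h1 h2)
  then obtain us ws where us: "set us \<subseteq> S \<union> (\<lambda>s. inv s) ` S" "word_value us = h1"
    and ws: "set ws \<subseteq> S \<union> (\<lambda>s. inv s) ` S" "word_value ws = h2" by blast
  have c: "S \<union> (\<lambda>s. inv s) ` S \<subseteq> carrier G" using S by auto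
  have "word_value (us @ ws) = h1 \<otimes> h2"
    using us(2) ws(2) word_value_append[OF subset_trans[OF us(1) c] subset_trans[OF ws(1) c]] by simp
  thus ?case using us(1) ws(1) by (intro exI[of _ "us @ ws"]) auto
qed

text \<open>Balls of the word metric are images of finite sets of words, so that \<open>|g| \<rightarrow> \<infinity>\<close> excludes only
  finitely many elements at each stage.\<close>

lemma finite_word_ball:
  assumes S: "finite S" "S \<subseteq> carrier G" "generate G S = carrier G"
  shows "finite {g \<in> carrier G. word_length G S g < n}"
proof -
  let ?A = "S \<union> (\<lambda>s. inv s) ` S"
  have "{g \<in> carrier G. word_length G S g < n} \<subseteq> word_value ` {ws. set ws \<subseteq> ?A \<and> length ws \<le> n}"
  proof
    fix g assume g: "g \<in> {g \<in> carrier G. word_length G S g < n}"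
    have "\<exists>k ws. length ws = k \<and> set ws \<subseteq> ?A \<and> word_value ws = g"
      using generate_word[OF S(2), of g] g S(3) by auto
    hence "\<exists>ws. length ws = word_length G S g \<and> set ws \<subseteq> ?A \<and> word_value ws = g"
      unfolding word_length_def by (rule LeastI_ex)
    thus "g \<in> word_value ` {ws. set ws \<subseteq> ?A \<and> length ws \<le> n}" using g by force
  qed
  moreover have "finite {ws. set ws \<subseteq> ?A \<and> length ws \<le> n}"
    using S(1) by (intro finite_lists_length_le) auto
  ultimately show ?thesis by (meson finite_imageI finite_subset)
qed

end

context perm_seq
begin

lemma uncorrelated_outside_finite:
  assumes S: "finite S" "S \<subseteq> carrier G" "generate G S = carrier G"
    and a: "asymp_uncorrelated_vec G S D \<rho> a" and \<delta>: "\<delta> > 0"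
  obtains B where "finite B"
    "\<And>g. g \<in> carrier G - B \<Longrightarrow> eventually (\<lambda>N. cmod (\<Sum>y=1..N.
        (a N (\<rho> N g y) - vec_avg N (a N)) * cnj (a N y - vec_avg N (a N))) \<le> \<delta> * real N) (along D)"
proof -
  have "eventually (\<lambda>g. correlation D \<rho> a g < ereal \<delta>) (at_group_infinity G S)"
    using a \<delta> unfolding asymp_uncorrelated_vec_def by (intro order_tendstoD(2)) auto
  then obtain n where n: "\<And>g. g \<in> carrier G \<Longrightarrow> n \<le> word_length G S g \<Longrightarrow> correlation D \<rho> a g < ereal \<delta>"
    unfolding at_group_infinity_def eventually_inf_principal eventually_filtercomap_at_top_linorder
    by blast
  show thesis
  proof (rule that[OF finite_word_ball[OF S, of n]])
    fix g assume "g \<in> carrier G - {g \<in> carrier G. word_length G S g < n}"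
    hence "correlation D \<rho> a g < ereal \<delta>" using n by auto
    hence "eventually (\<lambda>N. ereal (cmod ((\<Sum>x=1..N. cnj (a N x - vec_avg N (a N)) *
        (a N (\<rho> N g x) - vec_avg N (a N))) / of_nat N)) < ereal \<delta>) (along D)"
      unfolding correlation_def by (rule Limsup_lessD)
    thus "eventually (\<lambda>N. cmod (\<Sum>y=1..N.
        (a N (\<rho> N g y) - vec_avg N (a N)) * cnj (a N y - vec_avg N (a N))) \<le> \<delta> * real N) (along D)"
      using eventually_in_D
    proof eventually_elim
      case (elim N)
      have "(\<Sum>x=1..N. cnj (a N x - vec_avg N (a N)) * (a N (\<rho> N g x) - vec_avg N (a N)))
        = (\<Sum>y=1..N. (a N (\<rho> N g y) - vec_avg N (a N)) * cnj (a N y - vec_avg N (a N)))"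
        by (intro sum.cong refl mult.commute)
      thus ?case using elim(1) N_pos[OF elim(2)] by (simp add: norm_divide field_simps)
    qed
  qed
qed

end

section \<open>Local observables\<close>

context perm_rep
begin

text \<open>Where several \<open>t \<in> T\<close> move \<open>y\<close> to the same \<open>x\<close>, the entry \<open>K x y\<close> occurs in each of the terms
  indexed by these \<open>t\<close>; the last summand corrects for the multiplicity.\<close>

lemma local_observable_decomposition:
  assumes T: "finite T"
  shows "K x y - avg_mat N r T K x y
    = (\<Sum>t\<in>T. (K (r t y) y - vec_avg N (\<lambda>x. K (r t x) x)) * perm_mat (r t) x y)
      + K x y * (1 - (\<Sum>t\<in>T. perm_mat (r t) x y))"
proof -
  have "avg_mat N r T K x y = (\<Sum>t\<in>T. avg_coeff N r T K t * perm_mat (r t) x y)"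
    unfolding avg_mat_def by (rule rep_mat_support[OF T]) (auto simp: avg_coeff_def)
  also have "\<dots> = (\<Sum>t\<in>T. vec_avg N (\<lambda>x. K (r t x) x) * perm_mat (r t) x y)"
    by (intro sum.cong refl) (simp add: avg_coeff_def vec_avg_def)
  finally have 1: "avg_mat N r T K x y = (\<Sum>t\<in>T. vec_avg N (\<lambda>x. K (r t x) x) * perm_mat (r t) x y)" .
  have 2: "K x y * (\<Sum>t\<in>T. perm_mat (r t) x y) = (\<Sum>t\<in>T. K (r t y) y * perm_mat (r t) x y)"
    unfolding sum_distrib_left by (intro sum.cong refl) (auto simp: perm_mat_def)
  show ?thesis
    unfolding 1 left_diff_distrib sum_subtractf right_diff_distrib 2 by simp
qed

text \<open>If \<open>c\<close> elements of \<open>T\<close> move \<open>y\<close> to \<open>x\<close>, the squared error is at most \<open>(1 - c)\<^sup>2 \<le> c\<^sup>2 - c\<close> when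
  \<open>c \<ge> 1\<close>, and locality makes it vanish when \<open>c = 0\<close>. The sum of \<open>c\<close> over all entries is \<open>card T * N\<close>, and that of
  \<open>c\<^sup>2\<close> is the squared norm of the representation of the indicator of \<open>T\<close>. Under convergence to the
  regular representation the latter is asymptotic to \<open>card T * N\<close> too, so the bound is \<open>o(N)\<close>.\<close>

lemma overlap_error_bound:
  assumes T: "finite T" "T \<subseteq> carrier G" and loc: "is_local N r T K"
    and K: "\<And>x y. x \<in> {1..N} \<Longrightarrow> y \<in> {1..N} \<Longrightarrow> cmod (K x y) \<le> 1"
  shows "hs2 N (\<lambda>x y. K x y * (1 - (\<Sum>t\<in>T. perm_mat (r t) x y)))
    \<le> hs2 N (rep_mat r (\<lambda>g. if g \<in> T then 1 else 0)) - real (card T) * real N"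
proof -
  define c where "c x y = card {t \<in> T. x = r t y}" for x y
  have c: "(\<Sum>t\<in>T. perm_mat (r t) x y) = of_nat (c x y)" for x y
    using T(1) by (simp add: perm_mat_def c_def sum.If_cases Int_def)
  have rep: "rep_mat r (\<lambda>g. if g \<in> T then 1 else 0) x y = of_nat (c x y)" for x y
  proof -
    have "rep_mat r (\<lambda>g. if g \<in> T then 1 else 0) x y
      = (\<Sum>g\<in>T. (if g \<in> T then 1 else 0) * perm_mat (r g) x y)"
      by (rule rep_mat_support[OF T(1)]) auto
    also have "\<dots> = (\<Sum>g\<in>T. perm_mat (r g) x y)" by (intro sum.cong refl) simp
    finally show ?thesis by (simp only: c)
  qed
  have term_le: "(cmod (K x y * (1 - of_nat (c x y))))\<^sup>2 \<le> (real (c x y))\<^sup>2 - real (c x y)"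
    if x: "x \<in> {1..N}" and y: "y \<in> {1..N}" for x y
  proof (cases "c x y = 0")
    case True
    hence "\<nexists>g. g \<in> T \<and> x = r g y" using T(1) by (auto simp: c_def)
    hence "K x y = 0" using loc x y by (simp add: is_local_def)
    thus ?thesis using True by simp
  next
    case False
    hence n: "real (c x y) \<ge> 1" by simp
    have "cmod (1 - of_nat (c x y)) = \<bar>1 - real (c x y)\<bar>"
      by (metis norm_of_real of_real_1 of_real_diff of_real_of_nat_eq)
    hence "cmod (K x y * (1 - of_nat (c x y))) \<le> 1 * \<bar>1 - real (c x y)\<bar>"
      unfolding norm_mult using K[OF x y] by (intro mult_mono) auto
    hence "(cmod (K x y * (1 - of_nat (c x y))))\<^sup>2 \<le> (1 - real (c x y))\<^sup>2"
      by (metis abs_norm_cancel abs_le_square_iff abs_abs mult_1)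
    also have "\<dots> \<le> (real (c x y))\<^sup>2 - real (c x y)" using n by (simp add: power2_diff)
    finally show ?thesis .
  qed
  have cs: "(\<Sum>x=1..N. \<Sum>y=1..N. real (c x y)) = real (card T) * real N"
  proof -
    have "(\<Sum>x=1..N. real (c x y)) = real (card T)" if y: "y \<in> {1..N}" for y
    proof -
      have "real (c x y) = (\<Sum>t\<in>T. if x = r t y then 1 else 0)" for x
        using T(1) by (simp add: c_def sum.If_cases Int_def)
      hence "(\<Sum>x=1..N. real (c x y)) = (\<Sum>x=1..N. \<Sum>t\<in>T. if x = r t y then 1 else 0)" by simp
      also have "\<dots> = (\<Sum>t\<in>T. \<Sum>x=1..N. if x = r t y then 1 else 0)" by (rule sum.swap)
      also have "\<dots> = (\<Sum>t\<in>T. 1)"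
      proof (rule sum.cong[OF refl])
        fix t assume "t \<in> T"
        hence "r t y \<in> {1..N}" using r_mem[OF _ y] T(2) by auto
        thus "(\<Sum>x=1..N. if x = r t y then 1 else (0::real)) = 1" by (simp add: sum.delta)
      qed
      finally show ?thesis by simp
    qed
    hence "(\<Sum>y=1..N. \<Sum>x=1..N. real (c x y)) = (\<Sum>y=1..N. real (card T))"
      by (rule sum.cong[OF refl])
    thus ?thesis by (subst sum.swap) simp
  qed
  have "hs2 N (\<lambda>x y. K x y * (1 - (\<Sum>t\<in>T. perm_mat (r t) x y)))
     \<le> (\<Sum>x=1..N. \<Sum>y=1..N. (real (c x y))\<^sup>2 - real (c x y))"
    unfolding hs2_def c by (intro sum_mono term_le)
  also have "\<dots> = hs2 N (rep_mat r (\<lambda>g. if g \<in> T then 1 else 0)) - real (card T) * real N"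
    unfolding sum_subtractf cs by (simp add: hs2_def rep)
  finally show ?thesis .
qed

lemma fluctuation_decomposition:
  fixes K :: cmatrix
  assumes T: "finite T" "T \<subseteq> carrier G"
  defines "b \<equiv> \<lambda>t y. K (r t y) y - vec_avg N (\<lambda>x. K (r t x) x)"
    and "R \<equiv> \<lambda>x y. K x y * (1 - (\<Sum>t\<in>T. perm_mat (r t) x y))"
  shows "fluctuation N r T K f h \<le> real (card T + 1) *
    ((\<Sum>t\<in>T. (cmod (\<Sum>y=1..N. cnj (f (r t y)) * (b t y * h y)))\<^sup>2)
      + (cmod (vec_inner N f (mat_vec N R h)))\<^sup>2)"
proof -
  let ?v = "\<lambda>t. \<Sum>y=1..N. cnj (f (r t y)) * (b t y * h y)"
  have mv: "vec_inner N f (mat_vec N A h) = (\<Sum>x=1..N. \<Sum>y=1..N. cnj (f x) * (A x y * h y))" for A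
    by (simp add: vec_inner_def mat_vec_def sum_distrib_left)
  have "vec_inner N f (mat_vec N K h) - vec_inner N f (mat_vec N (avg_mat N r T K) h)
    = (\<Sum>x=1..N. \<Sum>y=1..N. cnj (f x) * ((K x y - avg_mat N r T K x y) * h y))"
    unfolding mv sum_subtractf[symmetric] by (intro sum.cong refl) (simp add: algebra_simps)
  also have "\<dots> = (\<Sum>x=1..N. \<Sum>y=1..N. (\<Sum>t\<in>T. cnj (f x) * (b t y * perm_mat (r t) x y * h y))
      + cnj (f x) * (R x y * h y))"
    unfolding local_observable_decomposition[OF T(1)] b_def R_def
    by (simp only: distrib_right distrib_left sum_distrib_left sum_distrib_right)
  also have "\<dots> = (\<Sum>t\<in>T. ?v t) + vec_inner N f (mat_vec N R h)"
  proof -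
    have "(\<Sum>x=1..N. \<Sum>y=1..N. \<Sum>t\<in>T. cnj (f x) * (b t y * perm_mat (r t) x y * h y))
       = (\<Sum>t\<in>T. \<Sum>x=1..N. \<Sum>y=1..N. cnj (f x) * (b t y * perm_mat (r t) x y * h y))"
      by (rule sum_swap_third[symmetric])
    also have "\<dots> = (\<Sum>t\<in>T. \<Sum>y=1..N. \<Sum>x=1..N. cnj (f x) * (b t y * perm_mat (r t) x y * h y))"
      by (intro sum.cong refl sum.swap)
    also have "\<dots> = (\<Sum>t\<in>T. ?v t)"
    proof (intro sum.cong refl)
      fix t y assume t: "t \<in> T" and y: "y \<in> {1..N}"
      have "(\<Sum>x=1..N. cnj (f x) * (b t y * perm_mat (r t) x y * h y))
        = (\<Sum>x=1..N. if x = r t y then cnj (f (r t y)) * (b t y * h y) else 0)"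
        by (intro sum.cong refl) (auto simp: perm_mat_def)
      also have "\<dots> = cnj (f (r t y)) * (b t y * h y)"
        using r_mem[OF _ y, of t] t T(2) by (simp add: sum.delta subset_iff)
      finally show "(\<Sum>x=1..N. cnj (f x) * (b t y * perm_mat (r t) x y * h y))
        = cnj (f (r t y)) * (b t y * h y)" .
    qed
    finally show ?thesis by (simp only: sum.distrib mv)
  qed
  finally have eq: "vec_inner N f (mat_vec N K h) - vec_inner N f (mat_vec N (avg_mat N r T K) h)
    = (\<Sum>t\<in>T. ?v t) + vec_inner N f (mat_vec N R h)" .
  let ?w = "case_option (cmod (vec_inner N f (mat_vec N R h))) (\<lambda>t. cmod (?v t))"
  \<comment> \<open>The Cauchy-Schwarz inequality for \<open>card T + 1\<close> summands, with \<open>None\<close> indexing the overlap term.\<close>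
  let ?O = "insert None (Some ` T)"
  have sumO: "(\<Sum>i\<in>?O. F i) = F None + (\<Sum>t\<in>T. F (Some t))" for F :: "'g option \<Rightarrow> real"
    using T(1) by (subst sum.insert) (auto simp: sum.reindex)
  have "cmod ((\<Sum>t\<in>T. ?v t) + vec_inner N f (mat_vec N R h)) \<le> (\<Sum>i\<in>?O. ?w i * 1)"
    unfolding sumO using norm_triangle_ineq[of "\<Sum>t\<in>T. ?v t" "vec_inner N f (mat_vec N R h)"]
      norm_sum[of ?v T] by simp
  hence "(cmod ((\<Sum>t\<in>T. ?v t) + vec_inner N f (mat_vec N R h)))\<^sup>2 \<le> (\<Sum>i\<in>?O. ?w i * 1)\<^sup>2"
    by (intro power_mono) auto
  also have "\<dots> \<le> (\<Sum>i\<in>?O. (?w i)\<^sup>2) * (\<Sum>i\<in>?O. 1\<^sup>2)"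
    by (rule Cauchy_Schwarz_ineq_sum)
  also have "\<dots> = real (card T + 1) * ((\<Sum>t\<in>T. (cmod (?v t))\<^sup>2) + (cmod (vec_inner N f (mat_vec N R h)))\<^sup>2)"
    unfolding sumO by simp
  finally show ?thesis unfolding fluctuation_def eq .
qed

end

section \<open>Mixing sums over short spectral windows\<close>

context ac_seq
begin

abbreviation window :: "nat \<Rightarrow> real \<Rightarrow> real \<Rightarrow> nat set" where
  "window N E \<eta> \<equiv> spec_indices N (l N) {E - \<eta>..E + \<eta>}"

abbreviation translate_sum :: "nat \<Rightarrow> (nat \<Rightarrow> nat) \<Rightarrow> cvec \<Rightarrow> nat set \<Rightarrow> nat set \<Rightarrow> real" where
  "translate_sum N \<tau> b J1 J2 \<equiv> (\<Sum>\<alpha>\<in>J1. \<Sum>\<beta>\<in>J2.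
     (cmod (\<Sum>y=1..N. cnj (\<phi> N \<beta> (\<tau> y)) * (b y * \<phi> N \<alpha> y)))\<^sup>2)"

lemma window_weight:
  assumes N: "N \<in> D" and a: "\<alpha> \<in> {1..N}" and \<eta>: "\<eta> > 0"
  shows "0 \<le> Im (1 / (l N \<alpha> - Complex E \<eta>))"
    "\<alpha> \<in> window N E \<eta> \<Longrightarrow> 1 \<le> 2 * \<eta> * Im (1 / (l N \<alpha> - Complex E \<eta>))"
proof -
  interpret eb: hermitian_eigenbasis N "\<phi> N" "rep_mat (\<rho> N) p" "l N" by (rule eigenbasisI[OF N])
  note im = Im_inverse_real_shift[OF eb.Im_eigenvalue[OF a]]
  show "0 \<le> Im (1 / (l N \<alpha> - Complex E \<eta>))" using \<eta> by (simp add: im)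
  assume "\<alpha> \<in> window N E \<eta>"
  hence "\<bar>Re (l N \<alpha>) - E\<bar> \<le> \<eta>" by (auto simp: spec_indices_def)
  hence "(Re (l N \<alpha>) - E)\<^sup>2 \<le> \<eta>\<^sup>2"
    using \<eta> by (intro abs_le_square_iff[THEN iffD1]) auto
  moreover have "0 < (Re (l N \<alpha>) - E)\<^sup>2 + \<eta>\<^sup>2" using \<eta> by (intro add_nonneg_pos) auto
  ultimately show "1 \<le> 2 * \<eta> * Im (1 / (l N \<alpha> - Complex E \<eta>))"
    unfolding im by (simp add: pos_le_divide_eq power2_eq_square)
qed

text \<open>Each window indicator is bounded by \<open>2 \<eta>\<close> times the imaginary part of the resolvent, and the
  sums are then extended to the full eigenbasis by positivity.\<close>

lemma windowed_sum_le_twisted_form: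
  assumes N: "N \<in> D" and \<eta>: "\<eta> > 0"
  shows "(translate_sum N \<tau> b (window N E1 \<eta>) (window N E2 \<eta>))
    \<le> 4 * \<eta>\<^sup>2 * cmod (twisted_form N b \<tau> (Im_res (Complex E1 \<eta>) N) (Im_res (Complex E2 \<eta>) N))"
proof -
  interpret eb: hermitian_eigenbasis N "\<phi> N" "rep_mat (\<rho> N) p" "l N" by (rule eigenbasisI[OF N])
  let ?f = "\<lambda>E \<alpha>. Im (1 / (l N \<alpha> - Complex E \<eta>))"
  let ?w = "\<lambda>\<alpha> \<beta>. (cmod (\<Sum>y=1..N. cnj (\<phi> N \<beta> (\<tau> y)) * (b y * \<phi> N \<alpha> y)))\<^sup>2"
  have sub: "window N E \<eta> \<subseteq> {1..N}" for E by (auto simp: spec_indices_def)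
  have nn: "0 \<le> ?f E \<alpha>" if "\<alpha> \<in> {1..N}" for E \<alpha> by (rule window_weight(1)[OF N that \<eta>])
  have nnw: "0 \<le> ?f E \<alpha>" if "\<alpha> \<in> window N E' \<eta>" for E E' \<alpha> by (rule nn[OF subsetD[OF sub that]])
  have "(\<Sum>\<alpha>\<in>window N E1 \<eta>. \<Sum>\<beta>\<in>window N E2 \<eta>. ?w \<alpha> \<beta>)
     \<le> (\<Sum>\<alpha>\<in>window N E1 \<eta>. \<Sum>\<beta>\<in>window N E2 \<eta>. 4 * \<eta>\<^sup>2 * (?f E1 \<alpha> * ?f E2 \<beta> * ?w \<alpha> \<beta>))"
  proof (intro sum_mono)
    fix \<alpha> \<beta> assume a: "\<alpha> \<in> window N E1 \<eta>" and b: "\<beta> \<in> window N E2 \<eta>"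
    have w: "1 \<le> 2 * \<eta> * ?f E1 \<alpha>" "1 \<le> 2 * \<eta> * ?f E2 \<beta>"
      using window_weight(2)[OF N subsetD[OF sub a] \<eta> a] window_weight(2)[OF N subsetD[OF sub b] \<eta> b]
      by auto
    have "1 * 1 \<le> (2 * \<eta> * ?f E1 \<alpha>) * (2 * \<eta> * ?f E2 \<beta>)"
      by (rule mult_mono[OF w]) (use w in linarith)+
    hence "1 * ?w \<alpha> \<beta> \<le> (2 * \<eta> * ?f E1 \<alpha>) * (2 * \<eta> * ?f E2 \<beta>) * ?w \<alpha> \<beta>"
      by (intro mult_right_mono) auto
    also have "\<dots> = 4 * \<eta>\<^sup>2 * (?f E1 \<alpha> * ?f E2 \<beta> * ?w \<alpha> \<beta>)"
      by (simp add: power2_eq_square)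
    finally show "?w \<alpha> \<beta> \<le> 4 * \<eta>\<^sup>2 * (?f E1 \<alpha> * ?f E2 \<beta> * ?w \<alpha> \<beta>)" by simp
  qed
  also have "\<dots> \<le> (\<Sum>\<alpha>\<in>window N E1 \<eta>. \<Sum>\<beta>=1..N. 4 * \<eta>\<^sup>2 * (?f E1 \<alpha> * ?f E2 \<beta> * ?w \<alpha> \<beta>))"
    by (intro sum_mono sum_mono2 mult_nonneg_nonneg nn nnw sub) auto
  also have "\<dots> \<le> (\<Sum>\<alpha>=1..N. \<Sum>\<beta>=1..N. 4 * \<eta>\<^sup>2 * (?f E1 \<alpha> * ?f E2 \<beta> * ?w \<alpha> \<beta>))"
    by (intro sum_mono2 sum_nonneg mult_nonneg_nonneg nn sub) auto
  also have "\<dots> = 4 * \<eta>\<^sup>2 * (\<Sum>\<alpha>=1..N. \<Sum>\<beta>=1..N. ?f E1 \<alpha> * ?f E2 \<beta> * ?w \<alpha> \<beta>)"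
    by (simp only: sum_distrib_left)
  also have "(\<Sum>\<alpha>=1..N. \<Sum>\<beta>=1..N. ?f E1 \<alpha> * ?f E2 \<beta> * ?w \<alpha> \<beta>)
     \<le> cmod (twisted_form N b \<tau> (Im_res (Complex E1 \<eta>) N) (Im_res (Complex E2 \<eta>) N))"
  proof -
    have "x \<le> cmod (complex_of_real x)" for x by simp
    from this[of "\<Sum>\<alpha>=1..N. \<Sum>\<beta>=1..N. ?f E1 \<alpha> * ?f E2 \<beta> * ?w \<alpha> \<beta>"]
    show ?thesis unfolding eb.weighted_matrix_elements twisted_form_def .
  qed
  finally show ?thesis using \<eta> by simp
qed

text \<open>The bound on the twisted form, multiplied by \<open>4 \<eta>\<^sup>2\<close>, is
  \<open>4 \<eta> (\<delta> C + \<eta> Q) N\<close>. Choosing \<open>\<delta>\<close> first makes the first term at most half of \<open>\<epsilon> \<eta> N\<close>; it fixes \<open>B\<close> and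
  hence \<open>Q\<close>, and the second term is then controlled by taking \<open>\<eta>\<close> small.\<close>

lemma single_translate_mixing:
  assumes t: "t \<in> carrier G"
    and b: "\<And>N y. N \<in> D \<Longrightarrow> y \<in> {1..N} \<Longrightarrow> cmod (b N y) \<le> 2"
    and corr: "\<And>\<delta>. \<delta> > 0 \<Longrightarrow> \<exists>B. finite B \<and> (\<forall>g\<in>carrier G - B.
      eventually (\<lambda>N. cmod (\<Sum>y=1..N. b N (\<rho> N g y) * cnj (b N y)) \<le> \<delta> * real N) (along D))"
    and e: "\<epsilon> > 0"
  shows "\<exists>\<eta>0>0. \<eta>0 \<le> 1 \<and> (\<forall>\<eta> E1 E2. 0 < \<eta> \<longrightarrow> \<eta> \<le> \<eta>0 \<longrightarrow> E1 \<in> I0 \<longrightarrow> E2 \<in> I0 \<longrightarrow>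
    eventually (\<lambda>N. (translate_sum N (\<rho> N t) (b N) (window N E1 \<eta>) (window N E2 \<eta>)) \<le> \<epsilon> * \<eta> * real N) (along D))"
proof -
  define \<delta> where "\<delta> = \<epsilon> / (8 * C)"
  have \<delta>: "\<delta> > 0" using e C1 by (simp add: \<delta>_def)
  obtain B where B: "finite B" "\<And>g. g \<in> carrier G - B \<Longrightarrow>
      eventually (\<lambda>N. cmod (\<Sum>y=1..N. b N (\<rho> N g y) * cnj (b N y)) \<le> \<delta> * real N) (along D)"
    using corr[OF \<delta>] by blast
  define Q where "Q = 4 * real (card B) * C\<^sup>2 + 1"
  have Q: "Q > 0" by (simp add: Q_def add_nonneg_pos)
  define \<eta>0 where "\<eta>0 = min 1 (\<epsilon> / (8 * Q))"
  have \<eta>0: "0 < \<eta>0" "\<eta>0 \<le> 1" using e Q by (auto simp: \<eta>0_def)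
  show ?thesis
  proof (intro exI[of _ \<eta>0] conjI allI impI \<eta>0)
    fix \<eta> E1 E2 assume \<eta>: "0 < \<eta>" "\<eta> \<le> \<eta>0" and E: "E1 \<in> I0" "E2 \<in> I0"
    have \<eta>1: "\<eta> \<le> 1" using \<eta> \<eta>0 by simp
    have \<eta>Q: "\<eta> * Q \<le> \<epsilon> / 8"
    proof -
      have "\<eta> * Q \<le> \<epsilon> / (8 * Q) * Q" using \<eta>(2) Q by (intro mult_right_mono) (auto simp: \<eta>0_def)
      thus ?thesis using Q by simp
    qed
    obtain h1 where h1: "h1 \<in> ell2 G" "Pz (Complex E1 \<eta>) h1 = delta \<one>" "Im (h1 \<one>) \<le> C"
      using green[OF E(1) \<eta>(1) \<eta>1] by blast
    obtain h2 where h2: "h2 \<in> ell2 G" "Pz (Complex E2 \<eta>) h2 = delta \<one>" "Im (h2 \<one>) \<le> C"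
      using green[OF E(2) \<eta>(1) \<eta>1] by blast
    have "eventually (\<lambda>N. cmod (twisted_form N (b N) (\<rho> N t) (Im_res (Complex E1 \<eta>) N) (Im_res (Complex E2 \<eta>) N))
      \<le> real N * (\<delta> * (C / \<eta>) + 4 * real (card B) * C\<^sup>2 + 1)) (along D)"
      using \<delta> by (intro twisted_form_asymptotics[OF h1(1,2) _ h1(3) h2(1,2) _ h2(3) \<eta>(1) t B(1) _ _ b B(2)]) auto
    thus "eventually (\<lambda>N. (translate_sum N (\<rho> N t) (b N) (window N E1 \<eta>) (window N E2 \<eta>)) \<le> \<epsilon> * \<eta> * real N) (along D)"
      using eventually_in_D
    proof eventually_elim
      case (elim N)
      have "(translate_sum N (\<rho> N t) (b N) (window N E1 \<eta>) (window N E2 \<eta>))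
        \<le> 4 * \<eta>\<^sup>2 * cmod (twisted_form N (b N) (\<rho> N t) (Im_res (Complex E1 \<eta>) N) (Im_res (Complex E2 \<eta>) N))"
        by (rule windowed_sum_le_twisted_form[OF elim(2) \<eta>(1)])
      also have "4 * \<eta>\<^sup>2 * cmod (twisted_form N (b N) (\<rho> N t) (Im_res (Complex E1 \<eta>) N) (Im_res (Complex E2 \<eta>) N))
        \<le> 4 * \<eta>\<^sup>2 * (real N * (\<delta> * (C / \<eta>) + 4 * real (card B) * C\<^sup>2 + 1))"
        using elim(1) by (intro mult_left_mono) auto
      also have "\<dots> = (4 * \<delta> * C + 4 * (\<eta> * Q)) * (\<eta> * real N)"
        using \<eta>(1) by (simp add: Q_def power2_eq_square field_simps)
      also have "\<dots> \<le> \<epsilon> * (\<eta> * real N)"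
        using \<eta>Q \<eta>(1) C1 by (intro mult_right_mono) (auto simp: \<delta>_def)
      finally show ?case by (simp add: mult.assoc)
    qed
  qed
qed

end

lemma fluctuation_nonneg: "0 \<le> fluctuation N r T K f h"
  by (simp add: fluctuation_def)

lemma sum_UN_le:
  fixes f :: "'a \<Rightarrow> real"
  assumes "finite X" "\<And>x. x \<in> X \<Longrightarrow> finite (A x)" "\<And>y. 0 \<le> f y"
  shows "sum f (\<Union>x\<in>X. A x) \<le> (\<Sum>x\<in>X. sum f (A x))"
  using assms(1,2)
proof (induction X rule: finite_induct)
  case (insert x X)
  have "sum f (A x \<union> (\<Union>x\<in>X. A x)) \<le> sum f (A x) + sum f (\<Union>x\<in>X. A x)"
    using insert by (subst sum.union_inter[symmetric]) (auto intro: sum_nonneg assms(3))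
  thus ?case using insert by auto
qed simp

lemma interval_net:
  fixes a b \<eta> :: real
  assumes "a \<le> b" "\<eta> > 0"
  obtains X where "finite X" "X \<subseteq> {a..b}" "real (card X) * \<eta> \<le> b - a + \<eta>"
    "\<And>E. E \<in> {a..b} \<Longrightarrow> \<exists>x\<in>X. \<bar>E - x\<bar> \<le> \<eta>"
proof
  define n where "n = nat \<lfloor>(b - a) / \<eta>\<rfloor>"
  let ?X = "(\<lambda>k. a + real k * \<eta>) ` {..n}"
  have n: "real n * \<eta> \<le> b - a"
  proof -
    have "real n \<le> (b - a) / \<eta>" using assms by (simp add: n_def)
    thus ?thesis using assms by (simp add: pos_le_divide_eq)
  qed
  show "finite ?X" by simp
  show "?X \<subseteq> {a..b}"
  proof
    fix x assume "x \<in> ?X"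
    then obtain k where k: "k \<le> n" "x = a + real k * \<eta>" by auto
    have "real k * \<eta> \<le> real n * \<eta>" using k assms by (intro mult_right_mono) auto
    hence "x \<le> b" using n k(2) by linarith
    thus "x \<in> {a..b}" using k(2) assms by simp
  qed
  have "real (card ?X) \<le> real n + 1" using card_image_le[of "{..n}" "\<lambda>k. a + real k * \<eta>"] by simp
  hence "real (card ?X) * \<eta> \<le> (real n + 1) * \<eta>" using assms by (intro mult_right_mono) auto
  thus "real (card ?X) * \<eta> \<le> b - a + \<eta>" using n by (simp add: algebra_simps)
  fix E assume E: "E \<in> {a..b}"
  define k where "k = nat \<lfloor>(E - a) / \<eta>\<rfloor>"
  have "(E - a) / \<eta> \<le> (b - a) / \<eta>" using E assms by (simp add: divide_right_mono)
  hence kn: "k \<le> n" unfolding k_def n_def by (intro nat_mono floor_mono)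
  have "real k \<le> (E - a) / \<eta>" "(E - a) / \<eta> < real k + 1"
    using E assms by (auto simp: k_def)
  hence "real k * \<eta> \<le> E - a" "E - a < (real k + 1) * \<eta>"
    using assms by (simp_all add: pos_le_divide_eq pos_divide_less_eq)
  hence "\<bar>E - (a + real k * \<eta>)\<bar> \<le> \<eta>" by (simp add: algebra_simps)
  thus "\<exists>x\<in>?X. \<bar>E - x\<bar> \<le> \<eta>" using kn by blast
qed

locale observable_seq = ac_seq G p D \<rho> \<phi> l C I0
  for G :: "('g, 'b) monoid_scheme" (structure) and p D \<rho> \<phi> l C I0 +
  fixes T :: "'g set" and K :: "nat \<Rightarrow> cmatrix" and S :: "'g set"
  assumes T: "finite T" "T \<subseteq> carrier G"
    and loc: "\<And>N. N \<in> D \<Longrightarrow> is_local N (\<rho> N) T (K N)"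
    and K_norm: "\<And>N. N \<in> D \<Longrightarrow> norm_1_inf N (K N) \<le> 1"
    and S: "finite S" "S \<subseteq> carrier G" "generate G S = carrier G"
    and unc: "asymp_uncorrelated G S D \<rho> T K"
begin

lemma K_le_1:
  assumes "N \<in> D" "x \<in> {1..N}" "y \<in> {1..N}"
  shows "cmod (K N x y) \<le> 1"
proof -
  have "cmod (K N x y) \<le> norm_1_inf N (K N)"
    unfolding norm_1_inf_def using assms(2,3) by (intro Max_ge) force+
  thus ?thesis using K_norm[OF assms(1)] by linarith
qed

definition mixing_sum :: "nat \<Rightarrow> nat set \<Rightarrow> nat set \<Rightarrow> real" where
  "mixing_sum N J1 J2 = (\<Sum>\<alpha>\<in>J1. \<Sum>\<beta>\<in>J2. fluctuation N (\<rho> N) T (K N) (\<phi> N \<beta>) (\<phi> N \<alpha>))"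

lemma mixing_sum_mono:
  assumes "J1 \<subseteq> J1'" "J2 \<subseteq> J2'" "finite J1'" "finite J2'"
  shows "mixing_sum N J1 J2 \<le> mixing_sum N J1' J2'"
proof -
  have "mixing_sum N J1 J2 \<le> (\<Sum>\<alpha>\<in>J1. \<Sum>\<beta>\<in>J2'. fluctuation N (\<rho> N) T (K N) (\<phi> N \<beta>) (\<phi> N \<alpha>))"
    unfolding mixing_sum_def using assms by (intro sum_mono sum_mono2) (auto simp: fluctuation_nonneg)
  also have "\<dots> \<le> mixing_sum N J1' J2'"
    unfolding mixing_sum_def using assms by (intro sum_mono2 sum_nonneg) (auto simp: fluctuation_nonneg)
  finally show ?thesis .
qed

lemma finite_spec_indices: "finite (spec_indices N f J)"
  by (simp add: spec_indices_def)

text \<open>Each of the \<open>card T\<close> translates, and the overlap error, contributes at most \<open>e' \<eta> N\<close>. The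
  overlap error is \<open>o(N)\<close>, so it is eventually below this for each fixed \<open>\<eta>\<close>.\<close>

lemma mixing_at_fixed_energies:
  assumes e: "\<epsilon> > 0"
  shows "\<exists>\<eta>0>0. \<eta>0 \<le> 1 \<and> (\<forall>\<eta> E1 E2. 0 < \<eta> \<longrightarrow> \<eta> \<le> \<eta>0 \<longrightarrow> E1 \<in> I0 \<longrightarrow> E2 \<in> I0 \<longrightarrow>
    eventually (\<lambda>N. mixing_sum N (window N E1 \<eta>) (window N E2 \<eta>) \<le> \<epsilon> * \<eta> * real N) (along D))"
proof -
  define b where "b t N y = K N (\<rho> N t y) y - vec_avg N (\<lambda>x. K N (\<rho> N t x) x)" for t N y
  define q where "q = real (card T + 1)"
  have q: "q > 0" by (simp add: q_def)
  define e' where "e' = \<epsilon> / (2 * q * q)"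
  have e': "e' > 0" using e q by (simp add: e'_def)
  have b2: "cmod (b t N y) \<le> 2" if t: "t \<in> T" and N: "N \<in> D" and y: "y \<in> {1..N}" for t N y
  proof -
    interpret perm_rep G N "\<rho> N" by (rule perm_repI[OF N])
    have tc: "t \<in> carrier G" using t T by auto
    have 1: "cmod (K N (\<rho> N t x) x) \<le> 1" if "x \<in> {1..N}" for x
      by (rule K_le_1[OF N r_mem[OF tc that] that])
    have "cmod (\<Sum>x=1..N. K N (\<rho> N t x) x) \<le> (\<Sum>x=1..N. 1)"
      by (intro sum_norm_le 1)
    hence "cmod (vec_avg N (\<lambda>x. K N (\<rho> N t x) x)) \<le> 1"
      using N_pos[OF N] by (simp add: vec_avg_def norm_divide)
    thus ?thesis
      unfolding b_def
      using norm_triangle_ineq4[of "K N (\<rho> N t y) y" "vec_avg N (\<lambda>x. K N (\<rho> N t x) x)"] 1[OF y]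
      by linarith
  qed
  have corr: "\<exists>B. finite B \<and> (\<forall>g\<in>carrier G - B. eventually (\<lambda>N.
      cmod (\<Sum>y=1..N. b t N (\<rho> N g y) * cnj (b t N y)) \<le> \<delta> * real N) (along D))"
    if t: "t \<in> T" and \<delta>: "\<delta> > 0" for t \<delta>
  proof -
    have "asymp_uncorrelated_vec G S D \<rho> (\<lambda>N x. K N (\<rho> N t x) x)"
      using unc t by (simp add: asymp_uncorrelated_def)
    then obtain B where "finite B" "\<And>g. g \<in> carrier G - B \<Longrightarrow> eventually (\<lambda>N.
        cmod (\<Sum>y=1..N. b t N (\<rho> N g y) * cnj (b t N y)) \<le> \<delta> * real N) (along D)"
      using uncorrelated_outside_finite[OF S _ \<delta>, of "\<lambda>N x. K N (\<rho> N t x) x"]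
      unfolding b_def by blast
    thus ?thesis by blast
  qed
  have "\<forall>t\<in>T. \<exists>\<eta>0>0. \<eta>0 \<le> 1 \<and> (\<forall>\<eta> E1 E2. 0 < \<eta> \<longrightarrow> \<eta> \<le> \<eta>0 \<longrightarrow> E1 \<in> I0 \<longrightarrow> E2 \<in> I0 \<longrightarrow>
    eventually (\<lambda>N. (translate_sum N (\<rho> N t) (b t N) (window N E1 \<eta>) (window N E2 \<eta>)) \<le> e' * \<eta> * real N) (along D))"
    using single_translate_mixing[OF _ b2 corr e'] T(2) by (intro ballI) blast
  from bchoice[OF this] obtain \<eta>f where \<eta>f: "\<forall>t\<in>T. \<eta>f t > 0 \<and> \<eta>f t \<le> 1 \<and>
    (\<forall>\<eta> E1 E2. 0 < \<eta> \<longrightarrow> \<eta> \<le> \<eta>f t \<longrightarrow> E1 \<in> I0 \<longrightarrow> E2 \<in> I0 \<longrightarrow>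
    eventually (\<lambda>N. (translate_sum N (\<rho> N t) (b t N) (window N E1 \<eta>) (window N E2 \<eta>)) \<le> e' * \<eta> * real N) (along D))" ..
  define \<eta>0 where "\<eta>0 = Min (insert 1 (\<eta>f ` T))"
  have \<eta>0: "0 < \<eta>0" "\<eta>0 \<le> 1" "\<And>t. t \<in> T \<Longrightarrow> \<eta>0 \<le> \<eta>f t"
    using T(1) \<eta>f by (auto simp: \<eta>0_def)
  show ?thesis
  proof (intro exI[of _ \<eta>0] conjI allI impI \<eta>0)
    fix \<eta> E1 E2 assume \<eta>: "0 < \<eta>" "\<eta> \<le> \<eta>0" and E: "E1 \<in> I0" "E2 \<in> I0"
    let ?sum = "\<lambda>t N. translate_sum N (\<rho> N t) (b t N) (window N E1 \<eta>) (window N E2 \<eta>)"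
    have 1: "eventually (\<lambda>N. \<forall>t\<in>T. ?sum t N \<le> e' * \<eta> * real N) (along D)"
    proof (rule eventually_ball_finite[OF T(1)], rule ballI)
      fix t assume "t \<in> T"
      thus "eventually (\<lambda>N. ?sum t N \<le> e' * \<eta> * real N) (along D)"
        using \<eta>f \<eta>(1) order_trans[OF \<eta>(2) \<eta>0(3)] E by blast
    qed
    have "((\<lambda>N. hs2 N (rep_mat (\<rho> N) (\<lambda>g. if g \<in> T then 1 else 0)) / real N)
       \<longlongrightarrow> (\<Sum>g\<in>T. (cmod (if g \<in> T then 1 else 0))\<^sup>2)) (along D)"
      by (rule hs2_limit[OF T]) auto
    also have "(\<Sum>g\<in>T. (cmod (if g \<in> T then 1 else 0))\<^sup>2) = real (card T)" by simp
    finally have "((\<lambda>N. hs2 N (rep_mat (\<rho> N) (\<lambda>g. if g \<in> T then 1 else 0)) / real N)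
       \<longlongrightarrow> real (card T)) (along D)" .
    moreover have "real (card T) < real (card T) + e' * \<eta>" using e' \<eta> by simp
    ultimately have 2: "eventually (\<lambda>N. hs2 N (rep_mat (\<rho> N) (\<lambda>g. if g \<in> T then 1 else 0)) / real N
        < real (card T) + e' * \<eta>) (along D)" by (rule order_tendstoD(2))
    show "eventually (\<lambda>N. mixing_sum N (window N E1 \<eta>) (window N E2 \<eta>) \<le> \<epsilon> * \<eta> * real N) (along D)"
      using 1 2 eventually_in_D
    proof eventually_elim
      case (elim N)
      interpret perm_rep G N "\<rho> N" by (rule perm_repI[OF elim(3)])
      interpret eb: hermitian_eigenbasis N "\<phi> N" "rep_mat (\<rho> N) p" "l N" by (rule eigenbasisI[OF elim(3)])
      have Np: "real N > 0" using N_pos[OF elim(3)] by simp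
      define R where "R = (\<lambda>x y. K N x y * (1 - (\<Sum>t\<in>T. perm_mat (\<rho> N t) x y)))"
      have "hs2 N R \<le> hs2 N (rep_mat (\<rho> N) (\<lambda>g. if g \<in> T then 1 else 0)) - real (card T) * real N"
        unfolding R_def by (rule overlap_error_bound[OF T loc[OF elim(3)] K_le_1[OF elim(3)]])
      also have "\<dots> \<le> e' * \<eta> * real N" using elim(2) Np by (simp add: field_simps)
      finally have hsR: "hs2 N R \<le> e' * \<eta> * real N" .
      have sub: "window N E \<eta> \<subseteq> {1..N}" for E by (auto simp: spec_indices_def)
      have "mixing_sum N (window N E1 \<eta>) (window N E2 \<eta>)
        \<le> (\<Sum>\<alpha>\<in>window N E1 \<eta>. \<Sum>\<beta>\<in>window N E2 \<eta>. q * ((\<Sum>t\<in>T.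
            (cmod (\<Sum>y=1..N. cnj (\<phi> N \<beta> (\<rho> N t y)) * (b t N y * \<phi> N \<alpha> y)))\<^sup>2)
          + (cmod (vec_inner N (\<phi> N \<beta>) (mat_vec N R (\<phi> N \<alpha>))))\<^sup>2))"
        unfolding mixing_sum_def q_def b_def R_def
        by (intro sum_mono fluctuation_decomposition[OF T])
      also have "\<dots> = q * ((\<Sum>\<alpha>\<in>window N E1 \<eta>. \<Sum>\<beta>\<in>window N E2 \<eta>. \<Sum>t\<in>T.
            (cmod (\<Sum>y=1..N. cnj (\<phi> N \<beta> (\<rho> N t y)) * (b t N y * \<phi> N \<alpha> y)))\<^sup>2)
          + (\<Sum>\<alpha>\<in>window N E1 \<eta>. \<Sum>\<beta>\<in>window N E2 \<eta>. (cmod (vec_inner N (\<phi> N \<beta>) (mat_vec N R (\<phi> N \<alpha>))))\<^sup>2))"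
        by (simp only: sum.distrib flip: sum_distrib_left)
      also have "(\<Sum>\<alpha>\<in>window N E1 \<eta>. \<Sum>\<beta>\<in>window N E2 \<eta>. \<Sum>t\<in>T.
            (cmod (\<Sum>y=1..N. cnj (\<phi> N \<beta> (\<rho> N t y)) * (b t N y * \<phi> N \<alpha> y)))\<^sup>2)
         = (\<Sum>t\<in>T. ?sum t N)"
        by (rule sum_swap_third[symmetric])
      also have "(\<Sum>\<alpha>\<in>window N E1 \<eta>. \<Sum>\<beta>\<in>window N E2 \<eta>. (cmod (vec_inner N (\<phi> N \<beta>) (mat_vec N R (\<phi> N \<alpha>))))\<^sup>2)
         \<le> e' * \<eta> * real N"
      proof -
        have "(\<Sum>\<alpha>\<in>window N E1 \<eta>. \<Sum>\<beta>\<in>window N E2 \<eta>. (cmod (vec_inner N (\<phi> N \<beta>) (mat_vec N R (\<phi> N \<alpha>))))\<^sup>2)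
          \<le> (\<Sum>\<alpha>\<in>window N E1 \<eta>. \<Sum>\<beta>=1..N. (cmod (vec_inner N (\<phi> N \<beta>) (mat_vec N R (\<phi> N \<alpha>))))\<^sup>2)"
          using sub by (intro sum_mono sum_mono2) auto
        also have "\<dots> \<le> (\<Sum>\<alpha>=1..N. \<Sum>\<beta>=1..N. (cmod (vec_inner N (\<phi> N \<beta>) (mat_vec N R (\<phi> N \<alpha>))))\<^sup>2)"
          using sub by (intro sum_mono2 sum_nonneg) auto
        also have "\<dots> = hs2 N R" by (rule eb.hs2_matrix_elements)
        finally show ?thesis using hsR by linarith
      qed
      also have "(\<Sum>t\<in>T. ?sum t N) \<le> (\<Sum>t\<in>T. e' * \<eta> * real N)"
        using elim(1) by (intro sum_mono) auto
      finally have "mixing_sum N (window N E1 \<eta>) (window N E2 \<eta>)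
          \<le> q * ((\<Sum>t\<in>T. e' * \<eta> * real N) + e' * \<eta> * real N)" using q by simp
      also have "\<dots> = q * q * e' * (\<eta> * real N)" by (simp add: q_def algebra_simps)
      also have "\<dots> = \<epsilon> / 2 * (\<eta> * real N)" using q by (simp add: e'_def)
      also have "\<dots> \<le> \<epsilon> * (\<eta> * real N)" using e \<eta> by (intro mult_right_mono) auto
      finally show ?case by (simp add: mult.assoc)
    qed
  qed
qed

lemma window_subset:
  assumes "\<bar>E - x\<bar> \<le> \<delta>"
  shows "window N E \<eta> \<subseteq> window N x (\<eta> + \<delta>)"
proof -
  have "{E - \<eta>..E + \<eta>} \<subseteq> {x - (\<eta> + \<delta>)..x + (\<eta> + \<delta>)}" using assms by auto
  thus ?thesis unfolding spec_indices_def by blast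
qed

text \<open>A window of radius \<open>\<eta>\<close> is contained in a window of radius \<open>2 \<eta>\<close> around a point of a finite
  \<open>\<eta>\<close>-net, so finitely many pairs of energies suffice.\<close>

lemma uniform_mixing:
  assumes ab: "a \<le> b" "{a..b} \<subseteq> I0" and e: "\<epsilon> > 0"
  shows "\<exists>\<eta>0>0. \<forall>\<eta>. 0 < \<eta> \<longrightarrow> \<eta> \<le> \<eta>0 \<longrightarrow> eventually (\<lambda>N. \<forall>E1\<in>{a..b}. \<forall>E2\<in>{a..b}.
     mixing_sum N (window N E1 \<eta>) (window N E2 \<eta>) \<le> \<epsilon> * \<eta> * real N) (along D)"
proof -
  have "\<epsilon> / 2 > 0" using e by simp
  from mixing_at_fixed_energies[OF this] obtain \<eta>0 where \<eta>0: "\<eta>0 > 0"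
    and mix: "\<And>\<eta> E1 E2. 0 < \<eta> \<Longrightarrow> \<eta> \<le> \<eta>0 \<Longrightarrow> E1 \<in> I0 \<Longrightarrow> E2 \<in> I0 \<Longrightarrow>
      eventually (\<lambda>N. mixing_sum N (window N E1 \<eta>) (window N E2 \<eta>) \<le> \<epsilon> / 2 * \<eta> * real N) (along D)"
    by blast
  show ?thesis
  proof (intro exI[of _ "\<eta>0 / 2"] conjI allI impI)
    show "\<eta>0 / 2 > 0" using \<eta>0 by simp
    fix \<eta> assume \<eta>: "0 < \<eta>" "\<eta> \<le> \<eta>0 / 2"
    obtain X where X: "finite X" "X \<subseteq> {a..b}" "\<And>E. E \<in> {a..b} \<Longrightarrow> \<exists>x\<in>X. \<bar>E - x\<bar> \<le> \<eta>"
      by (rule interval_net[OF ab(1) \<eta>(1)]) blast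
    have "eventually (\<lambda>N. mixing_sum N (window N x1 (\<eta> + \<eta>)) (window N x2 (\<eta> + \<eta>))
        \<le> \<epsilon> / 2 * (\<eta> + \<eta>) * real N) (along D)" if "x1 \<in> X" "x2 \<in> X" for x1 x2
      using that X(2) ab(2) \<eta> by (intro mix) auto
    hence "eventually (\<lambda>N. \<forall>x1\<in>X. \<forall>x2\<in>X. mixing_sum N (window N x1 (\<eta> + \<eta>)) (window N x2 (\<eta> + \<eta>))
        \<le> \<epsilon> / 2 * (\<eta> + \<eta>) * real N) (along D)"
      using X(1) by (intro eventually_ball_finite ballI) auto
    thus "eventually (\<lambda>N. \<forall>E1\<in>{a..b}. \<forall>E2\<in>{a..b}.
      mixing_sum N (window N E1 \<eta>) (window N E2 \<eta>) \<le> \<epsilon> * \<eta> * real N) (along D)"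
    proof eventually_elim
      case (elim N)
      show ?case
      proof (intro ballI)
        fix E1 E2 assume "E1 \<in> {a..b}" "E2 \<in> {a..b}"
        then obtain x1 x2 where x: "x1 \<in> X" "\<bar>E1 - x1\<bar> \<le> \<eta>" "x2 \<in> X" "\<bar>E2 - x2\<bar> \<le> \<eta>"
          using X(3) by meson
        have "mixing_sum N (window N E1 \<eta>) (window N E2 \<eta>)
          \<le> mixing_sum N (window N x1 (\<eta> + \<eta>)) (window N x2 (\<eta> + \<eta>))"
          using x by (intro mixing_sum_mono window_subset finite_spec_indices)
        also have "\<dots> \<le> \<epsilon> / 2 * (\<eta> + \<eta>) * real N" using elim x by blast
        finally show "mixing_sum N (window N E1 \<eta>) (window N E2 \<eta>) \<le> \<epsilon> * \<eta> * real N" by simp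
      qed
    qed
  qed
qed

text \<open>A window of radius \<open>\<eta>\<close> contains a window of radius \<open>\<eta> / 2\<close> around a point of a finite \<open>\<eta> / 2\<close>-net.\<close>

lemma uniform_density:
  assumes ab: "a \<le> b" "{a..b} \<subseteq> I0" and \<eta>: "0 < \<eta>" "\<eta> \<le> 1"
  shows "eventually (\<lambda>N. \<forall>E\<in>{a..b}. \<eta> / (32 * C ^ 3) * real N \<le> real (card (window N E \<eta>))) (along D)"
proof -
  have \<eta>2: "0 < \<eta> / 2" "\<eta> / 2 \<le> 1" using \<eta> by auto
  obtain X where X: "finite X" "X \<subseteq> {a..b}" "\<And>E. E \<in> {a..b} \<Longrightarrow> \<exists>x\<in>X. \<bar>E - x\<bar> \<le> \<eta> / 2"
    by (rule interval_net[OF ab(1) \<eta>2(1)]) blast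
  have "eventually (\<lambda>N. \<forall>x\<in>X. \<eta> / 2 / (16 * C ^ 3) * real N \<le> real (card (window N x (\<eta> / 2)))) (along D)"
    using X(1,2) ab(2) by (intro eventually_ball_finite ballI density_lower_bound \<eta>2) auto
  thus ?thesis
  proof eventually_elim
    case (elim N)
    show ?case
    proof
      fix E assume "E \<in> {a..b}"
      then obtain x where x: "x \<in> X" "\<bar>E - x\<bar> \<le> \<eta> / 2" using X(3) by blast
      have "window N x (\<eta> / 2) \<subseteq> window N E (\<eta> / 2 + \<eta> / 2)"
        using x(2) by (intro window_subset) (simp add: abs_minus_commute)
      hence "card (window N x (\<eta> / 2)) \<le> card (window N E \<eta>)"
        by (intro card_mono finite_spec_indices) simp
      moreover have "\<eta> / 2 / (16 * C ^ 3) * real N \<le> real (card (window N x (\<eta> / 2)))"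
        using elim x(1) by blast
      ultimately show "\<eta> / (32 * C ^ 3) * real N \<le> real (card (window N E \<eta>))" by simp
    qed
  qed
qed

lemma quantum_mixing_holds:
  assumes ab: "a < b" "{a..b} \<subseteq> I0"
  shows "quantum_mixing D \<rho> T K \<phi> l {a..b}"
  unfolding quantum_mixing_def
proof -
  let ?S = "\<lambda>\<eta> N. SUP (E1, E2)\<in>interior {a..b} \<times> interior {a..b}.
    ereal (mixing_avg N (\<rho> N) T (K N) (\<phi> N) (l N) \<eta> E1 E2)"
  have ne: "interior {a..b} \<times> interior {a..b} \<noteq> {}" using ab by simp
  have avg: "mixing_avg N (\<rho> N) T (K N) (\<phi> N) (l N) \<eta> E1 E2
     = mixing_sum N (window N E1 \<eta>) (window N E2 \<eta>) / real (card (window N E1 \<eta>))" for N \<eta> E1 E2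
    by (simp add: mixing_avg_def mixing_sum_def)
  have nonneg: "0 \<le> Limsup (along D) (?S \<eta>)" for \<eta>
  proof (rule le_Limsup[OF along_neq_bot[OF D_inf]], rule always_eventually, rule allI)
    fix N
    obtain E where E: "E \<in> interior {a..b} \<times> interior {a..b}" using ne by blast
    have "0 \<le> (\<lambda>(E1, E2). ereal (mixing_avg N (\<rho> N) T (K N) (\<phi> N) (l N) \<eta> E1 E2)) E"
      by (simp add: avg mixing_sum_def sum_nonneg fluctuation_nonneg split_def)
    also have "\<dots> \<le> ?S \<eta> N" by (rule SUP_upper[OF E])
    finally show "0 \<le> ?S \<eta> N" .
  qed
  have upper: "eventually (\<lambda>\<eta>. Limsup (along D) (?S \<eta>) \<le> ereal e) (at_right 0)" if e: "e > 0" for e :: real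
  proof -
    define c where "c = 1 / (32 * C ^ 3)"
    have c: "c > 0" using C1 by (simp add: c_def)
    obtain \<eta>0 where \<eta>0: "\<eta>0 > 0" and mix: "\<And>\<eta>. 0 < \<eta> \<Longrightarrow> \<eta> \<le> \<eta>0 \<Longrightarrow>
      eventually (\<lambda>N. \<forall>E1\<in>{a..b}. \<forall>E2\<in>{a..b}.
        mixing_sum N (window N E1 \<eta>) (window N E2 \<eta>) \<le> (e * c) * \<eta> * real N) (along D)"
      using uniform_mixing[of a b "e * c"] ab e c by auto
    have "eventually (\<lambda>\<eta>. 0 < \<eta> \<and> \<eta> < min \<eta>0 1) (at_right 0)"
      using \<eta>0 by (simp add: eventually_at_right_less eventually_conj_iff eventually_at_right_field)
        (metis \<eta>0 min_less_iff_conj zero_less_one)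
    thus ?thesis
    proof eventually_elim
      case (elim \<eta>)
      hence \<eta>: "0 < \<eta>" "\<eta> \<le> \<eta>0" "\<eta> \<le> 1" by auto
      have "eventually (\<lambda>N. ?S \<eta> N \<le> ereal e) (along D)"
        using mix[OF \<eta>(1,2)] uniform_density[OF less_imp_le[OF ab(1)] ab(2) \<eta>(1,3)] eventually_in_D
      proof eventually_elim
        case (elim N)
        show ?case
        proof (rule SUP_least, clarify)
          fix E1 E2 assume "E1 \<in> interior {a..b}" "E2 \<in> interior {a..b}"
          hence E: "E1 \<in> {a..b}" "E2 \<in> {a..b}" using interior_subset by blast+
          have cnt: "\<eta> * c * real N \<le> real (card (window N E1 \<eta>))"
            using elim(2) E(1) by (simp add: c_def)
          have pos: "0 < \<eta> * c * real N" using \<eta> c N_pos[OF elim(3)] by simp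
          have "mixing_sum N (window N E1 \<eta>) (window N E2 \<eta>) \<le> e * (\<eta> * c * real N)"
            using elim(1) E by (simp add: mult_ac)
          also have "\<dots> \<le> e * real (card (window N E1 \<eta>))" using cnt e by (intro mult_left_mono) auto
          finally show "ereal (mixing_avg N (\<rho> N) T (K N) (\<phi> N) (l N) \<eta> E1 E2) \<le> ereal e"
            using cnt pos by (simp add: avg pos_divide_le_eq)
        qed
      qed
      thus ?case by (rule Limsup_bounded)
    qed
  qed
  show "((\<lambda>\<eta>. Limsup (along D) (?S \<eta>)) \<longlongrightarrow> 0) (at_right 0)"
  proof (rule order_tendstoI)
    fix x :: ereal assume "x < 0"
    thus "eventually (\<lambda>\<eta>. x < Limsup (along D) (?S \<eta>)) (at_right 0)"
      using nonneg by (intro always_eventually allI) (rule less_le_trans)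
  next
    fix x :: ereal assume "0 < x"
    then obtain e where e: "0 < ereal e" "ereal e < x" using ereal_dense2 by blast
    hence "e > 0" by simp
    from upper[OF this] show "eventually (\<lambda>\<eta>. Limsup (along D) (?S \<eta>) < x) (at_right 0)"
      by eventually_elim (rule le_less_trans[OF _ e(2)])
  qed
qed

text \<open>The interval is covered by windows of radius \<open>\<eta>\<close> around the points of an \<open>\<eta>\<close>-net. A
  diagonal fluctuation is one term of the mixing sum of its window with itself, so the total is at
  most \<open>e' \<eta> N\<close> times the number of windows, which is \<open>O(1 / \<eta>)\<close>. One window of fixed radius at the
  midpoint bounds the number of eigenvalues from below by a multiple of \<open>N\<close>.\<close>

lemma quantum_ergodicity_holds:
  assumes ab: "a < b" "{a..b} \<subseteq> I0"
  shows "quantum_ergodicity D \<rho> T K \<phi> l {a..b}"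
  unfolding quantum_ergodicity_def
proof (rule tendstoI)
  fix e :: real assume e: "e > 0"
  let ?L = "\<lambda>N. spec_indices N (l N) {a..b}"
  let ?Q = "\<lambda>N. \<Sum>\<alpha>\<in>?L N. fluctuation N (\<rho> N) T (K N) (\<phi> N \<alpha>) (\<phi> N \<alpha>)"
  define w where "w = min 1 ((b - a) / 2)"
  define c where "c = w / (16 * C ^ 3)"
  have w: "0 < w" "w \<le> 1" using ab by (auto simp: w_def)
  have w_half: "w \<le> (b - a) / 2" unfolding w_def by (rule min.cobounded2)
  have c: "c > 0" using w C1 by (simp add: c_def)
  have mid: "(a + b) / 2 \<in> I0" using ab by (auto simp: subset_iff)
  have dens: "eventually (\<lambda>N. c * real N \<le> real (card (window N ((a + b) / 2) w))) (along D)"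
    unfolding c_def by (rule density_lower_bound[OF mid w(1,2)])
  define e' where "e' = e * c / (2 * (b - a + 1))"
  have e': "e' > 0" using e c ab by (simp add: e'_def)
  obtain \<eta>0 where \<eta>0: "\<eta>0 > 0" and mix: "\<And>\<eta>. 0 < \<eta> \<Longrightarrow> \<eta> \<le> \<eta>0 \<Longrightarrow>
    eventually (\<lambda>N. \<forall>E1\<in>{a..b}. \<forall>E2\<in>{a..b}.
      mixing_sum N (window N E1 \<eta>) (window N E2 \<eta>) \<le> e' * \<eta> * real N) (along D)"
    using uniform_mixing[of a b e'] ab e' by auto
  define \<eta> where "\<eta> = min \<eta>0 1"
  have \<eta>: "0 < \<eta>" "\<eta> \<le> \<eta>0" "\<eta> \<le> 1" using \<eta>0 by (auto simp: \<eta>_def)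
  have ab': "a \<le> b" using ab by simp
  obtain X where X: "finite X" "X \<subseteq> {a..b}" "real (card X) * \<eta> \<le> b - a + \<eta>"
    "\<And>E. E \<in> {a..b} \<Longrightarrow> \<exists>x\<in>X. \<bar>E - x\<bar> \<le> \<eta>"
    by (rule interval_net[OF ab' \<eta>(1)]) blast
  show "eventually (\<lambda>N. dist (?Q N / real (card (?L N))) 0 < e) (along D)"
    using dens mix[OF \<eta>(1,2)] eventually_in_D
  proof eventually_elim
    case (elim N)
    have Np: "real N > 0" using N_pos[OF elim(3)] by simp
    have cover: "?L N \<subseteq> (\<Union>x\<in>X. window N x \<eta>)"
    proof
      fix \<alpha> assume "\<alpha> \<in> ?L N"
      then obtain E where E: "\<alpha> \<in> {1..N}" "l N \<alpha> = of_real E" "E \<in> {a..b}"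
        by (auto simp: spec_indices_def)
      then obtain x where x: "x \<in> X" "\<bar>E - x\<bar> \<le> \<eta>" using X(4) by blast
      hence "E \<in> {x - \<eta>..x + \<eta>}" by auto
      hence "\<alpha> \<in> window N x \<eta>" using E by (auto simp: spec_indices_def)
      thus "\<alpha> \<in> (\<Union>x\<in>X. window N x \<eta>)" using x by blast
    qed
    have "?Q N \<le> (\<Sum>\<alpha>\<in>(\<Union>x\<in>X. window N x \<eta>). fluctuation N (\<rho> N) T (K N) (\<phi> N \<alpha>) (\<phi> N \<alpha>))"
      using cover X(1) finite_spec_indices by (intro sum_mono2) (auto simp: fluctuation_nonneg)
    also have "\<dots> \<le> (\<Sum>x\<in>X. \<Sum>\<alpha>\<in>window N x \<eta>. fluctuation N (\<rho> N) T (K N) (\<phi> N \<alpha>) (\<phi> N \<alpha>))"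
      by (intro sum_UN_le fluctuation_nonneg X(1) finite_spec_indices)
    also have "\<dots> \<le> (\<Sum>x\<in>X. mixing_sum N (window N x \<eta>) (window N x \<eta>))"
      unfolding mixing_sum_def
      by (intro sum_mono member_le_sum finite_spec_indices fluctuation_nonneg)
    also have "\<dots> \<le> (\<Sum>x\<in>X. e' * \<eta> * real N)" using elim(2) X(2) by (intro sum_mono) blast
    also have "\<dots> = e' * real N * (real (card X) * \<eta>)" by simp
    also have "\<dots> \<le> e' * real N * (b - a + 1)"
      using X(3) \<eta>(3) e' by (intro mult_left_mono) auto
    also have "\<dots> = e / 2 * (c * real N)" using ab by (simp add: e'_def field_simps)
    finally have Q: "?Q N \<le> e / 2 * (c * real N)" .
    have "{(a + b) / 2 - w..(a + b) / 2 + w} \<subseteq> {a..b}" using w_half by (auto simp: field_simps)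
    hence "window N ((a + b) / 2) w \<subseteq> ?L N" unfolding spec_indices_def by blast
    hence "card (window N ((a + b) / 2) w) \<le> card (?L N)"
      by (intro card_mono finite_spec_indices)
    hence cnt: "c * real N \<le> real (card (?L N))" using elim(1) by linarith
    have pos: "0 < c * real N" using c Np by simp
    have "?Q N \<le> e / 2 * real (card (?L N))"
      using Q cnt e by (meson mult_left_mono order_trans half_gt_zero less_imp_le)
    hence le: "?Q N / real (card (?L N)) \<le> e / 2" using cnt pos by (subst pos_divide_le_eq) auto
    have nn: "0 \<le> ?Q N / real (card (?L N))"
      by (intro divide_nonneg_nonneg sum_nonneg fluctuation_nonneg) simp
    show ?case unfolding dist_real_def diff_0_right abs_of_nonneg[OF nn] using le e by linarith
  qed
qed

end

section \<open>Quantum ergodicity and quantum mixing\<close>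

theorem theorem1p3:
  fixes G :: "('g, 'b) monoid_scheme"
    and S T :: "'g set"
    and D :: "nat set"
    and \<rho> :: "nat \<Rightarrow> 'g \<Rightarrow> nat \<Rightarrow> nat"
    and p :: "'g \<Rightarrow> complex"
    and a0 b0 a b :: real
    and \<phi> :: "nat \<Rightarrow> nat \<Rightarrow> nat \<Rightarrow> complex"
    and l :: "nat \<Rightarrow> nat \<Rightarrow> complex"
    and K :: "nat \<Rightarrow> nat \<Rightarrow> nat \<Rightarrow> complex"
  assumes "group G"
    and "finite S" "S \<subseteq> carrier G" "generate G S = carrier G"
    and "infinite D" "0 \<notin> D"
    and "\<And>N. N \<in> D \<Longrightarrow> \<rho> N \<in> hom G (sym_group N)"
    and "converges_to_regular G D \<rho>"
    and "p \<in> group_algebra G" "ga_star G p = p"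
    and "cond_AC G (left_regular_alg G p) {a0..b0}"
    and "a < b" "{a..b} \<subseteq> interior {a0..b0}"
    and "\<And>N. N \<in> D \<Longrightarrow> orthonormal_eigenbasis N (rep_mat (\<rho> N) p) (\<phi> N) (l N)"
    and "finite T" "T \<subseteq> carrier G"
    and "\<And>N. N \<in> D \<Longrightarrow> is_local N (\<rho> N) T (K N)"
    and "\<And>N. N \<in> D \<Longrightarrow> norm_1_inf N (K N) \<le> 1"
    and "asymp_uncorrelated G S D \<rho> T K"
  shows "quantum_ergodicity D \<rho> T K \<phi> l {a..b} \<and> quantum_mixing D \<rho> T K \<phi> l {a..b}"
proof -
  interpret group G by fact
  interpret hermitian_element G p by unfold_locales fact+
  interpret quantum_seq G p D \<rho> \<phi> l by unfold_locales fact+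
  obtain C where C: "C \<ge> 1"
    "\<And>E \<eta>. E \<in> {a0..b0} \<Longrightarrow> 0 < \<eta> \<Longrightarrow> \<eta> \<le> 1 \<Longrightarrow>
       \<exists>h\<in>ell2 G. Pz (Complex E \<eta>) h = delta \<one>\<^bsub>G\<^esub> \<and> 1 / C \<le> Im (h \<one>\<^bsub>G\<^esub>) \<and> Im (h \<one>\<^bsub>G\<^esub>) \<le> C"
    by (rule AC_green[OF assms(11)]) blast
  interpret ac_seq G p D \<rho> \<phi> l C "{a0..b0}" by unfold_locales (fact C)+
  interpret observable_seq G p D \<rho> \<phi> l C "{a0..b0}" T K S by unfold_locales fact+
  have "{a..b} \<subseteq> {a0..b0}" using assms(13) interior_subset by blast
  thus ?thesis using quantum_ergodicity_holds quantum_mixing_holds assms(12) by blast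
qed

end
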